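(* Let $R$ be a commutative local ring with principal nonzero maximal ideal $\mathfrak{m}=(p)$ satisfying $\mathfrak{m}^2=0$, and let $\mathscr{C}$ be the category of finitely generated free $R$-modules. Let $n\geq 3$ be an integer and let $\Sigma\colon\mathscr{C}\to\mathscr{C}$ be the identity functor. Let $\mathscr{N}$ be the collection of all $n$-$\Sigma$-sequences in $\mathscr{C}$ isomorphic to a direct sum $C_\bullet\oplus F(p)_\bullet$, where $C_\bullet$ is a contractible candidate $n$-angle in $\mathscr{C}$, $F$ is a free module in $\mathscr{C}$, and $F(p)_\bullet$ is the $n$-$\Sigma$-sequence $$F\xrightarrow{p}F\xrightarrow{p}\cdots\xrightarrow{p}F\xrightarrow{p}\Sigma F.$$ Then $(\mathscr{C},\Sigma,\mathscr{N})$ is an $n$-angulated category whenever $n$ is even, or when $n$ is odd and $2p=0$ in $R$.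
   Context: Let $\mathscr{C}$ be an additive category with an automorphism $\Sigma\colon\mathscr{C}\to\mathscr{C}$, and let $n\geq 3$ be an integer. An $n$-$\Sigma$-sequence is a sequence $A_\bullet\colon A_1\xrightarrow{\alpha_1}A_2\xrightarrow{\alpha_2}\cdots\xrightarrow{\alpha_{n-1}}A_n\xrightarrow{\alpha_n}\Sigma A_1$ of objects and morphisms in $\mathscr{C}$. Its left rotation is $A_2\xrightarrow{\alpha_2}A_3\to\cdots\xrightarrow{\alpha_n}\Sigma A_1\xrightarrow{(-1)^n\Sigma\alpha_1}\Sigma A_2$. A morphism $\varphi\colon A_\bullet\to B_\bullet$ is a sequence $(\varphi_1,\dots,\varphi_n)$ of morphisms $\varphi_i\colon A_i\to B_i$ with $\varphi_{i+1}\alpha_i=\beta_i\varphi_i$ for $1\le i\le n$, where $\varphi_{n+1}:=\Sigma\varphi_1$; it is an isomorphism if all $\varphi_i$ are. A candidate $n$-angle is an $n$-$\Sigma$-sequence with $\alpha_2\alpha_1=0,\dots,\alpha_n\alpha_{n-1}=0$ and $(\Sigma\alpha_1)\alpha_n=0$. An $n$-$\Sigma$-sequence is contractible if its identity morphism is nullhomotopic, i.e. there are morphisms $\Theta_i\colon A_{i+1}\to A_i$ ($1\le i\le n$, $A_{n+1}:=\Sigma A_1$) with $1_{A_i}=\Theta_i\alpha_i+\alpha_{i-1}\Theta_{i-1}$ for $2\le i\le n$ and $1_{\Sigma A_1}=(\Sigma\Theta_1)(\Sigma\alpha_1)+\alpha_n\Theta_n$. A collection $\mathscr{N}$ of $n$-$\Sigma$-sequences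 is an $n$-angulation of $(\mathscr{C},\Sigma)$, and $(\mathscr{C},\Sigma,\mathscr{N})$ is an $n$-angulated category, if: (N1) (a) $\mathscr{N}$ is closed under direct sums, direct summands and isomorphisms of $n$-$\Sigma$-sequences; (b) for all $A\in\mathscr{C}$, the sequence $A\xrightarrow{1}A\to0\to\cdots\to0\to\Sigma A$ belongs to $\mathscr{N}$; (c) every morphism in $\mathscr{C}$ is the first morphism of some $n$-$\Sigma$-sequence in $\mathscr{N}$. (N2) An $n$-$\Sigma$-sequence belongs to $\mathscr{N}$ if and only if its left rotation does. (N3) Given $A_\bullet,B_\bullet\in\mathscr{N}$ and morphisms $\varphi_1\colon A_1\to B_1$, $\varphi_2\colon A_2\to B_2$ with $\varphi_2\alpha_1=\beta_1\varphi_1$, there exist $\varphi_3,\dots,\varphi_n$ such that $(\varphi_1,\dots,\varphi_n)$ is a morphism $A_\bullet\to B_\bullet$. (N4) In the situation of (N3), $\varphi_3,\dots,\varphi_n$ can be chosen such that the mapping cone $$A_2\oplus B_1\xrightarrow{\left[\begin{smallmatrix}-\alpha_2&0\\ \varphi_2&\beta_1\end{smallmatrix}\right]}A_3\oplus B_2\xrightarrow{\left[\begin{smallmatrix}-\alpha_3&0\\ \varphi_3&\beta_2\end{smallmatrix}\right]}\cdots\xrightarrow{\left[\begin{smallmatrix}-\alpha_n&0\\ \varphi_n&\beta_{n-1}\end{smallmatrix}\right]}\Sigma A_1\oplus B_n\xrightarrow{\left[\begin{smallmatrix}-\Sigma\alpha_1&0\\ \Sigma\varphi_1&\beta_n\end{smallmatrix}\right]}\Sigma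 A_2\oplus\Sigma B_1$$ belongs to $\mathscr{N}$. The arrows labelled $p$ in $F(p)_\bullet$ are multiplication by the element $p\in R$. *)

theory Defs
  imports "HOL-Algebra.Ideal_Product" "HOL-Algebra.Module" "HOL-Library.FuncSet"
begin

section \<open>Additive categories with an automorphism\<close>

text \<open>Every arrow carries its source and target; \<open>cmp C g f\<close> is the composite of \<open>f\<close>
  followed by \<open>g\<close>. The operations are only constrained where they make sense.\<close>

record ('o, 'a) addcat =
  obj :: "'o set"
  arr :: "'a set"
  src :: "'a \<Rightarrow> 'o"
  tgt :: "'a \<Rightarrow> 'o"
  ide :: "'o \<Rightarrow> 'a"
  cmp :: "'a \<Rightarrow> 'a \<Rightarrow> 'a"
  hadd :: "'a \<Rightarrow> 'a \<Rightarrow> 'a"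
  hzero :: "'o \<Rightarrow> 'o \<Rightarrow> 'a"
  hneg :: "'a \<Rightarrow> 'a"

definition homs :: "('o, 'a) addcat \<Rightarrow> 'o \<Rightarrow> 'o \<Rightarrow> 'a set" where
  "homs C A B = {f \<in> arr C. src C f = A \<and> tgt C f = B}"

locale category =
  fixes C :: "('o, 'a) addcat"
  assumes src_obj: "f \<in> arr C \<Longrightarrow> src C f \<in> obj C"
    and tgt_obj: "f \<in> arr C \<Longrightarrow> tgt C f \<in> obj C"
    and ide_hom: "A \<in> obj C \<Longrightarrow> ide C A \<in> homs C A A"
    and cmp_hom: "f \<in> homs C A B \<Longrightarrow> g \<in> homs C B D \<Longrightarrow> cmp C g f \<in> homs C A D"
    and ide_left: "f \<in> homs C A B \<Longrightarrow> cmp C (ide C B) f = f"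
    and ide_right: "f \<in> homs C A B \<Longrightarrow> cmp C f (ide C A) = f"
    and cmp_assoc: "f \<in> homs C A B \<Longrightarrow> g \<in> homs C B D \<Longrightarrow> h \<in> homs C D E \<Longrightarrow>
      cmp C h (cmp C g f) = cmp C (cmp C h g) f"

locale preadditive_category = category +
  assumes hzero_hom: "A \<in> obj C \<Longrightarrow> B \<in> obj C \<Longrightarrow> hzero C A B \<in> homs C A B"
    and hadd_hom: "f \<in> homs C A B \<Longrightarrow> g \<in> homs C A B \<Longrightarrow> hadd C f g \<in> homs C A B"
    and hneg_hom: "f \<in> homs C A B \<Longrightarrow> hneg C f \<in> homs C A B"
    and hadd_assoc: "f \<in> homs C A B \<Longrightarrow> g \<in> homs C A B \<Longrightarrow> h \<in> homs C A B \<Longrightarrow>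
      hadd C (hadd C f g) h = hadd C f (hadd C g h)"
    and hadd_commute: "f \<in> homs C A B \<Longrightarrow> g \<in> homs C A B \<Longrightarrow> hadd C f g = hadd C g f"
    and hadd_zero: "f \<in> homs C A B \<Longrightarrow> hadd C f (hzero C A B) = f"
    and hadd_neg: "f \<in> homs C A B \<Longrightarrow> hadd C f (hneg C f) = hzero C A B"
    and cmp_hadd_left: "f \<in> homs C A B \<Longrightarrow> g \<in> homs C B D \<Longrightarrow> g' \<in> homs C B D \<Longrightarrow>
      cmp C (hadd C g g') f = hadd C (cmp C g f) (cmp C g' f)"
    and cmp_hadd_right: "f \<in> homs C A B \<Longrightarrow> f' \<in> homs C A B \<Longrightarrow> g \<in> homs C B D \<Longrightarrow>
      cmp C g (hadd C f f') = hadd C (cmp C g f) (cmp C g f')"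

definition is_zero_object :: "('o, 'a) addcat \<Rightarrow> 'o \<Rightarrow> bool" where
  "is_zero_object C Z \<longleftrightarrow> Z \<in> obj C \<and>
     (\<forall>A\<in>obj C. (\<exists>!f. f \<in> homs C A Z) \<and> (\<exists>!f. f \<in> homs C Z A))"

record ('o, 'a) biproduct =
  bobj :: 'o
  in1 :: 'a
  in2 :: 'a
  pr1 :: 'a
  pr2 :: 'a

definition is_biproduct :: "('o, 'a) addcat \<Rightarrow> 'o \<Rightarrow> 'o \<Rightarrow> ('o, 'a) biproduct \<Rightarrow> bool" where
  "is_biproduct C A B D \<longleftrightarrow>
     A \<in> obj C \<and> B \<in> obj C \<and> bobj D \<in> obj C \<and>
     in1 D \<in> homs C A (bobj D) \<and> in2 D \<in> homs C B (bobj D) \<and>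
     pr1 D \<in> homs C (bobj D) A \<and> pr2 D \<in> homs C (bobj D) B \<and>
     cmp C (pr1 D) (in1 D) = ide C A \<and> cmp C (pr2 D) (in2 D) = ide C B \<and>
     cmp C (pr2 D) (in1 D) = hzero C A B \<and> cmp C (pr1 D) (in2 D) = hzero C B A \<and>
     hadd C (cmp C (in1 D) (pr1 D)) (cmp C (in2 D) (pr2 D)) = ide C (bobj D)"

locale additive_category = preadditive_category +
  assumes zero_object: "\<exists>Z. is_zero_object C Z"
    and biproducts: "A \<in> obj C \<Longrightarrow> B \<in> obj C \<Longrightarrow> \<exists>D. is_biproduct C A B D"

text \<open>The arrow between two chosen biproducts \<open>D = X1 \<oplus> X2\<close> and \<open>E = Y1 \<oplus> Y2\<close> with matrix
  \<open>[a b; c d]\<close>, where \<open>a : X1 \<rightarrow> Y1\<close>, \<open>b : X2 \<rightarrow> Y1\<close>, \<open>c : X1 \<rightarrow> Y2\<close>, \<open>d : X2 \<rightarrow> Y2\<close>.\<close>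

definition bimat :: "('o, 'a) addcat \<Rightarrow> ('o, 'a) biproduct \<Rightarrow> ('o, 'a) biproduct \<Rightarrow>
    'a \<Rightarrow> 'a \<Rightarrow> 'a \<Rightarrow> 'a \<Rightarrow> 'a" where
  "bimat C D E a b c d =
     hadd C
       (hadd C (cmp C (in1 E) (cmp C a (pr1 D))) (cmp C (in1 E) (cmp C b (pr2 D))))
       (hadd C (cmp C (in2 E) (cmp C c (pr1 D))) (cmp C (in2 E) (cmp C d (pr2 D))))"

definition is_iso :: "('o, 'a) addcat \<Rightarrow> 'a \<Rightarrow> bool" where
  "is_iso C f \<longleftrightarrow> f \<in> arr C \<and> (\<exists>g \<in> homs C (tgt C f) (src C f).
     cmp C g f = ide C (src C f) \<and> cmp C f g = ide C (tgt C f))"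

record ('o, 'a) endofun =
  fob :: "'o \<Rightarrow> 'o"
  far :: "'a \<Rightarrow> 'a"

locale category_automorphism = category +
  fixes T :: "('o, 'a) endofun"
  assumes far_hom: "f \<in> homs C A B \<Longrightarrow> far T f \<in> homs C (fob T A) (fob T B)"
    and far_ide: "A \<in> obj C \<Longrightarrow> far T (ide C A) = ide C (fob T A)"
    and far_cmp: "f \<in> homs C A B \<Longrightarrow> g \<in> homs C B D \<Longrightarrow>
      far T (cmp C g f) = cmp C (far T g) (far T f)"
    and fob_bij: "bij_betw (fob T) (obj C) (obj C)"
    and far_bij: "bij_betw (far T) (arr C) (arr C)"

definition identity_functor :: "('o, 'a) endofun" where
  "identity_functor = \<lparr>fob = (\<lambda>A. A), far = (\<lambda>f. f)\<rparr>"

text \<open>The image of a biproduct diagram. Automorphisms are automatically additive, so this is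
  again a biproduct diagram.\<close>

definition fbip :: "('o, 'a) endofun \<Rightarrow> ('o, 'a) biproduct \<Rightarrow> ('o, 'a) biproduct" where
  "fbip T D = \<lparr>bobj = fob T (bobj D), in1 = far T (in1 D), in2 = far T (in2 D),
     pr1 = far T (pr1 D), pr2 = far T (pr2 D)\<rparr>"


section \<open>$n$-$\Sigma$-sequences\<close>

text \<open>Only the objects and arrows with indices in \<open>{1..n}\<close> matter. Entries at other indices
  are arbitrary, and all notions below ignore them. The functor \<open>T\<close> plays the role of
  $\Sigma$.\<close>

record ('o, 'a) nseq =
  sob :: "nat \<Rightarrow> 'o"
  sar :: "nat \<Rightarrow> 'a"

text \<open>Continuation of \<open>x 1, \<dots>, x n\<close> beyond \<open>n\<close> by \<open>x (n + i) = F (x i)\<close>; this is the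
  convention $A_{n+1} = \Sigma A_1$, $\varphi_{n+1} = \Sigma\varphi_1$, and so on.\<close>

definition ext :: "('b \<Rightarrow> 'b) \<Rightarrow> nat \<Rightarrow> (nat \<Rightarrow> 'b) \<Rightarrow> nat \<Rightarrow> 'b" where
  "ext F n x i = (if i \<le> n then x i else F (x (i - n)))"

abbreviation xob :: "('o, 'a) endofun \<Rightarrow> nat \<Rightarrow> ('o, 'a) nseq \<Rightarrow> nat \<Rightarrow> 'o" where
  "xob T n A \<equiv> ext (fob T) n (sob A)"

abbreviation xar :: "('o, 'a) endofun \<Rightarrow> nat \<Rightarrow> ('o, 'a) nseq \<Rightarrow> nat \<Rightarrow> 'a" where
  "xar T n A \<equiv> ext (far T) n (sar A)"

definition is_nseq ::
    "('o, 'a) addcat \<Rightarrow> ('o, 'a) endofun \<Rightarrow> nat \<Rightarrow> ('o, 'a) nseq \<Rightarrow> bool" where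
  "is_nseq C T n A \<longleftrightarrow>
     (\<forall>i\<in>{1..n}. sob A i \<in> obj C \<and> sar A i \<in> homs C (sob A i) (xob T n A (i + 1)))"

definition left_rotation ::
    "('o, 'a) addcat \<Rightarrow> ('o, 'a) endofun \<Rightarrow> nat \<Rightarrow> ('o, 'a) nseq \<Rightarrow> ('o, 'a) nseq" where
  "left_rotation C T n A =
     \<lparr>sob = (\<lambda>i. xob T n A (i + 1)),
      sar = (\<lambda>i. if i = n then (if even n then far T (sar A 1) else hneg C (far T (sar A 1)))
                 else sar A (i + 1))\<rparr>"

definition is_nseq_morphism :: "('o, 'a) addcat \<Rightarrow> ('o, 'a) endofun \<Rightarrow> nat \<Rightarrow>
    ('o, 'a) nseq \<Rightarrow> ('o, 'a) nseq \<Rightarrow> (nat \<Rightarrow> 'a) \<Rightarrow> bool" where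
  "is_nseq_morphism C T n A B \<phi> \<longleftrightarrow>
     (\<forall>i\<in>{1..n}. \<phi> i \<in> homs C (sob A i) (sob B i) \<and>
        cmp C (ext (far T) n \<phi> (i + 1)) (sar A i) = cmp C (sar B i) (\<phi> i))"

definition isomorphic_nseqs :: "('o, 'a) addcat \<Rightarrow> ('o, 'a) endofun \<Rightarrow> nat \<Rightarrow>
    ('o, 'a) nseq \<Rightarrow> ('o, 'a) nseq \<Rightarrow> bool" where
  "isomorphic_nseqs C T n A B \<longleftrightarrow>
     (\<exists>\<phi>. is_nseq_morphism C T n A B \<phi> \<and> (\<forall>i\<in>{1..n}. is_iso C (\<phi> i)))"

text \<open>\<open>S\<close> is a direct sum of \<open>A\<close> and \<open>B\<close>, formed degreewise with respect to some choice of
  biproducts \<open>A\<^sub>i \<oplus> B\<^sub>i\<close>.\<close>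

definition is_direct_sum :: "('o, 'a) addcat \<Rightarrow> ('o, 'a) endofun \<Rightarrow> nat \<Rightarrow>
    ('o, 'a) nseq \<Rightarrow> ('o, 'a) nseq \<Rightarrow> ('o, 'a) nseq \<Rightarrow> bool" where
  "is_direct_sum C T n S A B \<longleftrightarrow>
     (\<exists>D. \<forall>i\<in>{1..n}. is_biproduct C (sob A i) (sob B i) (D i) \<and> sob S i = bobj (D i) \<and>
        sar S i = bimat C (D i) (ext (fbip T) n D (i + 1))
          (sar A i) (hzero C (sob B i) (xob T n A (i + 1)))
          (hzero C (sob A i) (xob T n B (i + 1))) (sar B i))"

definition is_candidate ::
    "('o, 'a) addcat \<Rightarrow> ('o, 'a) endofun \<Rightarrow> nat \<Rightarrow> ('o, 'a) nseq \<Rightarrow> bool" where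
  "is_candidate C T n A \<longleftrightarrow> is_nseq C T n A \<and>
     (\<forall>i\<in>{1..n}. cmp C (xar T n A (i + 1)) (sar A i) = hzero C (sob A i) (xob T n A (i + 2)))"

definition is_contractible ::
    "('o, 'a) addcat \<Rightarrow> ('o, 'a) endofun \<Rightarrow> nat \<Rightarrow> ('o, 'a) nseq \<Rightarrow> bool" where
  "is_contractible C T n A \<longleftrightarrow> is_nseq C T n A \<and>
     (\<exists>\<Theta>. (\<forall>i\<in>{1..n}. \<Theta> i \<in> homs C (xob T n A (i + 1)) (sob A i)) \<and>
        (\<forall>i\<in>{2..n}. ide C (sob A i) =
           hadd C (cmp C (\<Theta> i) (sar A i)) (cmp C (sar A (i - 1)) (\<Theta> (i - 1)))) \<and>
        ide C (fob T (sob A 1)) =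
           hadd C (cmp C (far T (\<Theta> 1)) (far T (sar A 1))) (cmp C (sar A n) (\<Theta> n)))"

text \<open>The sequence $A \to A \to 0 \to \dots \to 0 \to \Sigma A$ for a zero object \<open>Z\<close>.\<close>

definition trivial_nseq :: "('o, 'a) addcat \<Rightarrow> ('o, 'a) endofun \<Rightarrow> nat \<Rightarrow> 'o \<Rightarrow> 'o \<Rightarrow>
    ('o, 'a) nseq" where
  "trivial_nseq C T n A Z =
     (let ob = (\<lambda>i. if i \<le> 2 then A else Z)
      in \<lparr>sob = ob,
          sar = (\<lambda>i. if i = 1 then ide C A else hzero C (ob i) (ext (fob T) n ob (i + 1)))\<rparr>)"

text \<open>The mapping cone of \<open>\<phi> : A \<rightarrow> B\<close>, where \<open>D i\<close> is the chosen biproduct of the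
  \<open>(i + 1)\<close>-st object of \<open>A\<close> and the \<open>i\<close>-th object of \<open>B\<close>.\<close>

definition mapping_cone :: "('o, 'a) addcat \<Rightarrow> ('o, 'a) endofun \<Rightarrow> nat \<Rightarrow>
    ('o, 'a) nseq \<Rightarrow> ('o, 'a) nseq \<Rightarrow> (nat \<Rightarrow> 'a) \<Rightarrow> (nat \<Rightarrow> ('o, 'a) biproduct) \<Rightarrow>
    ('o, 'a) nseq" where
  "mapping_cone C T n A B \<phi> D =
     \<lparr>sob = (\<lambda>i. bobj (D i)),
      sar = (\<lambda>i. bimat C (D i) (ext (fbip T) n D (i + 1))
        (hneg C (xar T n A (i + 1))) (hzero C (sob B i) (xob T n A (i + 2)))
        (ext (far T) n \<phi> (i + 1)) (sar B i))\<rparr>"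


section \<open>$n$-angulated categories\<close>

text \<open>In N4 the mapping cone is required to lie in \<open>N\<close> for every choice of biproducts; the
  cones for different choices are isomorphic.\<close>

locale n_angulated_category = additive_category + category_automorphism +
  fixes n :: nat and N :: "('o, 'a) nseq set"
  assumes n_ge_3: "n \<ge> 3"
    and N_nseq: "A \<in> N \<Longrightarrow> is_nseq C T n A"
    and N1_direct_sum: "A \<in> N \<Longrightarrow> B \<in> N \<Longrightarrow> is_direct_sum C T n S A B \<Longrightarrow> S \<in> N"
    and N1_summand: "S \<in> N \<Longrightarrow> is_nseq C T n A \<Longrightarrow> is_nseq C T n B \<Longrightarrow>
      is_direct_sum C T n S A B \<Longrightarrow> A \<in> N \<and> B \<in> N"
    and N1_iso: "A \<in> N \<Longrightarrow> is_nseq C T n B \<Longrightarrow> isomorphic_nseqs C T n A B \<Longrightarrow> B \<in> N"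
    and N1_trivial: "X \<in> obj C \<Longrightarrow> is_zero_object C Z \<Longrightarrow> trivial_nseq C T n X Z \<in> N"
    and N1_first: "f \<in> arr C \<Longrightarrow> \<exists>A\<in>N. sar A 1 = f"
    and N2: "is_nseq C T n A \<Longrightarrow> A \<in> N \<longleftrightarrow> left_rotation C T n A \<in> N"
    and N3: "A \<in> N \<Longrightarrow> B \<in> N \<Longrightarrow>
      f1 \<in> homs C (sob A 1) (sob B 1) \<Longrightarrow> f2 \<in> homs C (sob A 2) (sob B 2) \<Longrightarrow>
      cmp C f2 (sar A 1) = cmp C (sar B 1) f1 \<Longrightarrow>
      \<exists>\<phi>. \<phi> 1 = f1 \<and> \<phi> 2 = f2 \<and> is_nseq_morphism C T n A B \<phi>"
    and N4: "A \<in> N \<Longrightarrow> B \<in> N \<Longrightarrow>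
      f1 \<in> homs C (sob A 1) (sob B 1) \<Longrightarrow> f2 \<in> homs C (sob A 2) (sob B 2) \<Longrightarrow>
      cmp C f2 (sar A 1) = cmp C (sar B 1) f1 \<Longrightarrow>
      \<exists>\<phi>. \<phi> 1 = f1 \<and> \<phi> 2 = f2 \<and> is_nseq_morphism C T n A B \<phi> \<and>
        (\<forall>D. (\<forall>i\<in>{1..n}. is_biproduct C (xob T n A (i + 1)) (sob B i) (D i)) \<longrightarrow>
           mapping_cone C T n A B \<phi> D \<in> N)"


section \<open>Finitely generated free modules\<close>

definition local_ring :: "('r, 'x) ring_scheme \<Rightarrow> bool" where
  "local_ring R \<longleftrightarrow> cring R \<and> (\<exists>!I. maximalideal I R)"

definition is_basis :: "('r, 'x) ring_scheme \<Rightarrow> ('r, 'u) module \<Rightarrow> 'u set \<Rightarrow> bool" where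
  "is_basis R M B \<longleftrightarrow> finite B \<and> B \<subseteq> carrier M \<and>
     (\<forall>x\<in>carrier M. \<exists>!c. c \<in> B \<rightarrow>\<^sub>E carrier R \<and> x = (\<Oplus>\<^bsub>M\<^esub>b\<in>B. c b \<odot>\<^bsub>M\<^esub> b))"

definition is_fg_free :: "('r, 'x) ring_scheme \<Rightarrow> ('r, 'u) module \<Rightarrow> bool" where
  "is_fg_free R M \<longleftrightarrow> module R M \<and> (\<exists>B. is_basis R M B)"

text \<open>Homomorphisms are required to be undefined outside the carrier, so that they
  are determined by their values on it.\<close>

definition module_homs ::
    "('r, 'x) ring_scheme \<Rightarrow> ('r, 'u) module \<Rightarrow> ('r, 'u) module \<Rightarrow> ('u \<Rightarrow> 'u) set" where
  "module_homs R M M' = {f \<in> carrier M \<rightarrow>\<^sub>E carrier M'.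
     (\<forall>x\<in>carrier M. \<forall>y\<in>carrier M. f (x \<oplus>\<^bsub>M\<^esub> y) = f x \<oplus>\<^bsub>M'\<^esub> f y) \<and>
     (\<forall>r\<in>carrier R. \<forall>x\<in>carrier M. f (r \<odot>\<^bsub>M\<^esub> x) = r \<odot>\<^bsub>M'\<^esub> f x)}"

type_synonym ('r, 'u) module_arrow = "('r, 'u) module \<times> ('u \<Rightarrow> 'u) \<times> ('r, 'u) module"

text \<open>The category of all finitely generated free \<open>R\<close>-modules whose carrier is a subset of
  the type \<open>'u\<close>, which serves as the universe. Its arrows are triples consisting of the source,
  a homomorphism and the target. The \<open>mult\<close> and \<open>one\<close> fields which a module record inherits
  from rings are irrelevant: changing them yields an isomorphic object.\<close>

definition fg_free_modules ::
    "('r, 'x) ring_scheme \<Rightarrow> (('r, 'u) module, ('r, 'u) module_arrow) addcat" where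
  "fg_free_modules R =
     \<lparr>obj = {M. is_fg_free R M},
      arr = {(M, f, M'). is_fg_free R M \<and> is_fg_free R M' \<and> f \<in> module_homs R M M'},
      src = (\<lambda>(M, f, M'). M),
      tgt = (\<lambda>(M, f, M'). M'),
      ide = (\<lambda>M. (M, \<lambda>x\<in>carrier M. x, M)),
      cmp = (\<lambda>(_, g, M'') (M, f, _). (M, compose (carrier M) g f, M'')),
      hadd = (\<lambda>(M, f, M') (_, g, _). (M, \<lambda>x\<in>carrier M. f x \<oplus>\<^bsub>M'\<^esub> g x, M')),
      hzero = (\<lambda>M M'. (M, \<lambda>x\<in>carrier M. \<zero>\<^bsub>M'\<^esub>, M')),
      hneg = (\<lambda>(M, f, M'). (M, \<lambda>x\<in>carrier M. \<ominus>\<^bsub>M'\<^esub> f x, M'))\<rparr>"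

text \<open>The sequence $F \to F \to \dots \to F \to \Sigma F$ with all arrows multiplication by
  \<open>p\<close>, for $\Sigma$ the identity functor.\<close>

definition mult_nseq ::
    "'r \<Rightarrow> ('r, 'u) module \<Rightarrow> (('r, 'u) module, ('r, 'u) module_arrow) nseq" where
  "mult_nseq p F = \<lparr>sob = (\<lambda>_. F), sar = (\<lambda>_. (F, \<lambda>x\<in>carrier F. p \<odot>\<^bsub>F\<^esub> x, F))\<rparr>"

definition N_collection :: "('r, 'x) ring_scheme \<Rightarrow> 'r \<Rightarrow> nat \<Rightarrow>
    (('r, 'u) module, ('r, 'u) module_arrow) nseq set" where
  "N_collection R p n =
     {A. is_nseq (fg_free_modules R) identity_functor n A \<and>
        (\<exists>S K F. is_candidate (fg_free_modules R) identity_functor n K \<and>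
           is_contractible (fg_free_modules R) identity_functor n K \<and>
           F \<in> obj (fg_free_modules R) \<and>
           is_direct_sum (fg_free_modules R) identity_functor n S K (mult_nseq p F) \<and>
           isomorphic_nseqs (fg_free_modules R) identity_functor n A S)}"

end

theory Submission
  imports Defs
begin

text \<open>
  Because $\Sigma$ is the identity, an $n$-$\Sigma$-sequence is an $n$-periodic sequence of free
  modules. The collection in question has an intrinsic description. Let $A$ be an $n$-periodic
  complex of free modules. As the annihilator of $p$ is $(p)$, multiplication by $p$
  identifies $A/pA$ with $pA$. If $A$ is exact, the connecting homomorphisms of $0 \to pA \to
  A \to A/pA \to 0$ are therefore isomorphisms from each homology group of $A/pA$ to the next
  one, and composing $n$ of them gives an automorphism of $H_1(A/pA)$, the monodromy of $A$.
  The members of the collection are the exact complexes with trivial monodromy; these are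
  called angles here.

  For a contractible complex the homology of $A/pA$ is zero, and for $F(p)_\bullet$ all
  connecting homomorphisms are the identity, so both are angles. Conversely, unit entries of
  the differentials of an angle can be eliminated, each time splitting off a contractible
  summand (\<open>eliminate_at\<close>). What remains has differentials $p b_k$ with
  invertible $b_k$, and trivial monodromy means that the product of the $b_k$ is congruent to
  1 modulo $p$, which makes it isomorphic to $F(p)_\bullet$ (\<open>minimal_angle\<close>).
  Every angle thus is the direct sum of a contractible complex and some $F(p)_\bullet$, onto
  which it can be deformed (\<open>angle_sdr_multiplication\<close>,
  \<open>angle_decomposition\<close>).

  In the intrinsic description, closure under sums, summands and isomorphisms is formal. A
  rotation conjugates the monodromy by a connecting homomorphism and multiplies it by
  $(-1)^n$, which is 1 modulo $p$ under the assumption on $n$ and $p$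
  (\<open>rotation_angle\<close>). Every morphism is of the form $1 \oplus p \oplus 0$ in
  suitable bases, and each block begins an angle (\<open>every_morphism_first\<close>). For
  the axioms on morphisms, the retractions reduce the construction to morphisms $g$ between
  $F(p)_\bullet$ and $G(p)_\bullet$ plus nullhomotopic ones
  (\<open>nullhomotopic_extension\<close>). The components of $g$ must agree modulo $p$, but
  the monodromy of the mapping cone also depends on their differences; a suitable choice of
  the third component, available because $n \geq 3$, makes it trivial
  (\<open>ex_balanced\<close>, \<open>cone_angle\<close>).

  All these arguments are equational. They are carried out in a ring in which the morphisms of a
  preadditive category are embedded, so that composition and addition of composable morphisms
  become ring operations. One ring serves for all categories simultaneously, since types do
  not depend on terms.
\<close>

section \<open>Preadditive categories inside a ring\<close>

text \<open>The elements of \<open>H A B\<close> stand for the morphisms from \<open>A\<close> to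
  \<open>B\<close> of a preadditive category, all of them taken in one ring, and
  \<open>e A\<close> is the identity of \<open>A\<close>. Multiplication by \<open>p\<close>
  is an endomorphism of the identity functor with square zero. A unit of the ring would have
  to be the sum of all the \<open>e A\<close>, hence the class of rings without unit.\<close>

locale ring_category =
  fixes p :: "'e::ring" and Ob :: "'o set" and e :: "'o \<Rightarrow> 'e" and H :: "'o \<Rightarrow> 'o \<Rightarrow> 'e set"
  assumes p_comm: "p * x = x * p"
    and p_square: "p * p = 0"
    and H_src: "x \<in> H A B \<Longrightarrow> A \<in> Ob"
    and H_tgt: "x \<in> H A B \<Longrightarrow> B \<in> Ob"
    and H_id: "A \<in> Ob \<Longrightarrow> e A \<in> H A A"
    and id_left: "x \<in> H A B \<Longrightarrow> e B * x = x"
    and id_right: "x \<in> H A B \<Longrightarrow> x * e A = x"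
    and H_zero: "A \<in> Ob \<Longrightarrow> B \<in> Ob \<Longrightarrow> 0 \<in> H A B"
    and H_add: "x \<in> H A B \<Longrightarrow> y \<in> H A B \<Longrightarrow> x + y \<in> H A B"
    and H_uminus: "x \<in> H A B \<Longrightarrow> - x \<in> H A B"
    and H_mult: "y \<in> H B D \<Longrightarrow> x \<in> H A B \<Longrightarrow> y * x \<in> H A D"
    and H_p: "x \<in> H A B \<Longrightarrow> p * x \<in> H A B"
begin

lemma H_diff: "x \<in> H A B \<Longrightarrow> y \<in> H A B \<Longrightarrow> x - y \<in> H A B"
  using H_add[OF _ H_uminus, of x A B y] by simp

lemma H_sum: "A \<in> Ob \<Longrightarrow> B \<in> Ob \<Longrightarrow> (\<And>j. j \<in> J \<Longrightarrow> x j \<in> H A B) \<Longrightarrow> sum x J \<in> H A B"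
  by (induction J rule: infinite_finite_induct) (auto intro: H_add H_zero)

lemma id_left_assoc: "x \<in> H A B \<Longrightarrow> e B * (x * y) = x * y"
  by (simp add: id_left flip: mult.assoc)

lemma id_right_assoc: "x \<in> H A B \<Longrightarrow> x * (e A * y) = x * y"
  by (simp add: id_right flip: mult.assoc)

lemmas H_intros = H_mult H_add H_diff H_uminus H_p

lemma p_square_left: "p * (p * x) = 0"
  by (simp add: p_square flip: mult.assoc)

lemma p_left_comm: "x * (p * y) = p * (x * y)"
  by (metis p_comm mult.assoc)

definition bip :: "'o \<Rightarrow> 'o \<Rightarrow> 'o \<Rightarrow> 'e \<Rightarrow> 'e \<Rightarrow> 'e \<Rightarrow> 'e \<Rightarrow> bool" where
  "bip S A B u v q r \<longleftrightarrow> u \<in> H A S \<and> v \<in> H B S \<and> q \<in> H S A \<and> r \<in> H S B \<and>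
     q * u = e A \<and> r * v = e B \<and> r * u = 0 \<and> q * v = 0 \<and> u * q + v * r = e S"

text \<open>The inclusions \<open>w\<close> and the projections \<open>c\<close> identify \<open>A\<close>
  with the direct sum of \<open>m\<close> copies of \<open>I\<close>.\<close>

definition coords :: "'o \<Rightarrow> 'o \<Rightarrow> nat \<Rightarrow> (nat \<Rightarrow> 'e) \<Rightarrow> (nat \<Rightarrow> 'e) \<Rightarrow> bool" where
  "coords I A m w c \<longleftrightarrow> A \<in> Ob \<and> (\<forall>j<m. w j \<in> H I A \<and> c j \<in> H A I) \<and>
     (\<forall>i<m. \<forall>j<m. c i * w j = (if i = j then e I else 0)) \<and> (\<Sum>j<m. w j * c j) = e A"

lemma coords_H:
  assumes "coords I A m w c" "j < m"
  shows "w j \<in> H I A" "c j \<in> H A I"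
  using assms by (auto simp: coords_def)

lemma coords_cw: "coords I A m w c \<Longrightarrow> i < m \<Longrightarrow> j < m \<Longrightarrow> c i * w j = (if i = j then e I else 0)"
  by (auto simp: coords_def)

lemma coords_expand: 
  assumes "coords I A m w c" "x \<in> H X A"
  shows "x = (\<Sum>j<m. w j * (c j * x))"
proof -
  have "x = e A * x" using assms id_left by simp
  also have "e A = (\<Sum>j<m. w j * c j)" using assms by (simp add: coords_def)
  finally show ?thesis by (simp add: sum_distrib_right mult.assoc)
qed

lemma coords_expand_right: 
  assumes "coords I A m w c" "x \<in> H A X"
  shows "x = (\<Sum>j<m. x * w j * c j)"
proof -
  have "x = x * e A" using assms id_right by simp
  also have "e A = (\<Sum>j<m. w j * c j)" using assms by (simp add: coords_def)
  finally show ?thesis by (simp add: sum_distrib_left mult.assoc)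
qed

end

section \<open>Elimination over a local ring with square-zero maximal ideal\<close>

text \<open>The model is the category of finitely generated free modules over a local ring with maximal
  ideal $(p)$ and $p^2 = 0$: the object \<open>I\<close> is the ring itself,
  \<open>I_torsion\<close> says that $(p)$ is the annihilator of $p$, and
  \<open>I_local\<close> that everything outside $(p)$ is a unit.\<close>

locale free_ring_category = ring_category p Ob e H
  for p :: "'e::ring" and Ob :: "'o set" and e :: "'o \<Rightarrow> 'e" and H :: "'o \<Rightarrow> 'o \<Rightarrow> 'e set" +
  fixes I :: 'o
  assumes I_obj: "I \<in> Ob" and I_nonzero: "e I \<noteq> 0"
    and I_torsion: "x \<in> H I I \<Longrightarrow> p * x = 0 \<Longrightarrow> \<exists>y\<in>H I I. x = p * y"
    and I_local: "x \<in> H I I \<Longrightarrow> (\<exists>y\<in>H I I. x = p * y) \<or> (\<exists>y\<in>H I I. x * y = e I \<and> y * x = e I)"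
    and ex_coords: "A \<in> Ob \<Longrightarrow> \<exists>m w c. coords I A m w c"
    and ex_rank: "\<exists>A w c. coords I A m w c"
begin

text \<open>A morphism is the sum of its matrix entries, each framed by an inclusion and a projection, and
  \<open>p\<close> can be pulled out of that sum.\<close>

lemma p_divisible_entrywise:
  assumes "x \<in> H A B" "coords I A m w c" "coords I B l v d"
    and "\<And>i j. i < l \<Longrightarrow> j < m \<Longrightarrow> \<exists>y\<in>H I I. d i * x * w j = p * y"
  shows "\<exists>y\<in>H A B. x = p * y"
proof -
  obtain Y where Y: "\<And>i j. i < l \<Longrightarrow> j < m \<Longrightarrow> Y i j \<in> H I I \<and> d i * x * w j = p * Y i j"
    using assms(4) by metis
  have "x = (\<Sum>i<l. v i * (d i * x))" using coords_expand[OF assms(3,1)] .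
  also have "\<dots> = (\<Sum>i<l. v i * (\<Sum>j<m. d i * x * w j * c j))"
    using assms by (intro sum.cong refl arg_cong[where f="\<lambda>z. _ * z"] coords_expand_right[where A=A and X=I] H_intros)
       (auto intro: coords_H)
  also have "\<dots> = (\<Sum>i<l. v i * (\<Sum>j<m. p * Y i j * c j))" using Y by simp
  also have "\<dots> = p * (\<Sum>i<l. v i * (\<Sum>j<m. Y i j * c j))"
    by (simp add: sum_distrib_left mult.assoc p_left_comm)
  finally have "x = p * (\<Sum>i<l. v i * (\<Sum>j<m. Y i j * c j))" .
  moreover have "(\<Sum>i<l. v i * (\<Sum>j<m. Y i j * c j)) \<in> H A B"
    using assms Y by (intro H_sum H_mult H_sum I_obj) (auto intro: coords_H H_src H_tgt)
  ultimately show ?thesis by blast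
qed

lemma torsion:
  assumes "x \<in> H A B" "p * x = 0"
  shows "\<exists>y\<in>H A B. x = p * y"
proof -
  obtain m w c l v d where A: "coords I A m w c" and B: "coords I B l v d"
    using ex_coords assms H_src H_tgt by metis
  show ?thesis
  proof (rule p_divisible_entrywise[OF assms(1) A B])
    fix i j assume ij: "i < l" "j < m"
    have "p * (d i * x * w j) = d i * (p * x) * w j" by (simp add: p_left_comm mult.assoc)
    then show "\<exists>y\<in>H I I. d i * x * w j = p * y"
      using assms ij A B by (intro I_torsion H_intros) (auto intro: coords_H)
  qed
qed

lemma coords_append:
  assumes A: "coords I A m w c" and B: "coords I B l v d" and S: "coords I S (m + l) u q"
  shows "bip S A B (\<Sum>j<m. u j * c j) (\<Sum>j<l. u (m + j) * d j)
    (\<Sum>j<m. w j * q j) (\<Sum>j<l. v j * q (m + j))"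
proof -
  have obj: "A \<in> Ob" "B \<in> Ob" "S \<in> Ob" using A B S by (auto simp: coords_def)
  have qu: "q i * (u j * x) = (if i = j then e I * x else 0)" if "i < m + l" "j < m + l" for i j x
    using coords_cw[OF S that] by (simp flip: mult.assoc)
  have cw: "c i * (w j * x) = (if i = j then e I * x else 0)" if "i < m" "j < m" for i j x
    using coords_cw[OF A that] by (simp flip: mult.assoc)
  have dv: "d i * (v j * x) = (if i = j then e I * x else 0)" if "i < l" "j < l" for i j x
    using coords_cw[OF B that] by (simp flip: mult.assoc)
  have [simp]: "e I * c j = c j" if "j < m" for j using id_left coords_H(2)[OF A that] by blast
  have [simp]: "e I * d j = d j" if "j < l" for j using id_left coords_H(2)[OF B that] by blast
  have [simp]: "e I * q j = q j" if "j < m + l" for j using id_left coords_H(2)[OF S that] by blast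
  have "(\<Sum>j<m. u j * c j) * (\<Sum>j<m. w j * q j) + (\<Sum>j<l. u (m + j) * d j) * (\<Sum>j<l. v j * q (m + j))
      = (\<Sum>j<m. u j * q j) + (\<Sum>j<l. u (m + j) * q (m + j))"
    by (simp add: sum_product mult.assoc cw dv if_distrib[of "\<lambda>x. _ * x"] cong: if_cong)
  also have "\<dots> = (\<Sum>j<m+l. u j * q j)"
    by (induction l) (simp_all add: add.assoc)
  also have "\<dots> = e S" using S by (simp add: coords_def)
  finally have 1: "(\<Sum>j<m. u j * c j) * (\<Sum>j<m. w j * q j) + (\<Sum>j<l. u (m + j) * d j) * (\<Sum>j<l. v j * q (m + j)) = e S" .
  have 2: "(\<Sum>j<m. w j * c j) = e A" "(\<Sum>j<l. v j * d j) = e B"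
    using A B by (auto simp: coords_def)
  have mem: "u j * c j \<in> H A S" "w j * q j \<in> H S A" if "j < m" for j
    using that by (auto intro!: H_mult[of _ I] coords_H[OF A] coords_H[OF S])
  have mem': "u (m + j) * d j \<in> H B S" "v j * q (m + j) \<in> H S B" if "j < l" for j
    using that by (auto intro!: H_mult[of _ I] coords_H[OF B] coords_H[OF S])
  show ?thesis
    unfolding bip_def
  proof (intro conjI H_sum obj 1)
    show "(\<Sum>j<m. w j * q j) * (\<Sum>j<m. u j * c j) = e A"
     "(\<Sum>j<l. v j * q (m + j)) * (\<Sum>j<l. u (m + j) * d j) = e B"
     "(\<Sum>j<l. v j * q (m + j)) * (\<Sum>j<m. u j * c j) = 0"
     "(\<Sum>j<m. w j * q j) * (\<Sum>j<l. u (m + j) * d j) = 0"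
      unfolding 2[symmetric] sum_product by (simp_all add: mult.assoc qu if_distrib[of "\<lambda>x. _ * x"] cong: if_cong)
  qed (auto intro: mem mem')
qed

lemma ex_bip:
  assumes "A \<in> Ob" "B \<in> Ob"
  shows "\<exists>S u v q r. bip S A B u v q r"
proof -
  obtain m w c l v d where A: "coords I A m w c" and B: "coords I B l v d"
    using ex_coords assms by metis
  obtain S u q where "coords I S (m + l) u q" using ex_rank by blast
  from coords_append[OF A B this] show ?thesis by blast
qed

lemma ex_zero: "\<exists>Z\<in>Ob. e Z = 0"
  using ex_rank[of 0] by (force simp: coords_def)

lemma bip_obj: "bip S A B u v q r \<Longrightarrow> S \<in> Ob \<and> A \<in> Ob \<and> B \<in> Ob"
  by (auto simp: bip_def intro: H_src H_tgt)

lemma bipD: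
  assumes "bip S A B u v q r"
  shows "u \<in> H A S" "v \<in> H B S" "q \<in> H S A" "r \<in> H S B"
    "q * u = e A" "r * v = e B" "r * u = 0" "q * v = 0" "u * q + v * r = e S"
  using assms by (auto simp: bip_def)

text \<open>A functional that is not divisible by \<open>p\<close> takes a unit as value on some basis
  vector. With that vector rescaled and the other ones corrected by multiples of it, the
  functional becomes a coordinate.\<close>

lemma split_functional:
  assumes A: "coords I A m w c" and f: "f \<in> H A I" and nd: "\<not> (\<exists>y\<in>H A I. f = p * y)"
  shows "\<exists>A1 w' c' u v r. m > 0 \<and> coords I A1 (m - 1) w' c' \<and> bip A I A1 u v f r"
proof -
  have II: "coords I I 1 (\<lambda>_. e I) (\<lambda>_. e I)"
    using I_obj H_id[OF I_obj] id_left[OF H_id[OF I_obj]] by (simp add: coords_def)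
  obtain k where k: "k < m" and nd': "\<not> (\<exists>y\<in>H I I. f * w k = p * y)"
  proof -
    have "\<exists>j<m. \<not> (\<exists>y\<in>H I I. e I * f * w j = p * y)"
      using p_divisible_entrywise[OF f A II] nd by blast
    then show ?thesis using that id_left[OF f] by auto
  qed
  have fw: "f * w k \<in> H I I" using coords_H[OF A k] f H_mult by blast
  then obtain g where g: "g \<in> H I I" "f * w k * g = e I" "g * (f * w k) = e I"
    using I_local nd' by blast
  \<comment> \<open>Move the \<open>k\<close>-th coordinate to the front; the others then span a complement.\<close>
  define \<pi> where "\<pi> = (\<lambda>j. if j < k then j else Suc j)"
  have \<pi>: "\<pi> j < m" "\<pi> j \<noteq> k" if "j < m - 1" for j using that k by (auto simp: \<pi>_def)
  have \<pi>_inj: "\<pi> i = \<pi> j \<longleftrightarrow> i = j" for i j by (auto simp: \<pi>_def)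
  obtain A1 w' c' where A1: "coords I A1 (m - 1) w' c'" using ex_rank by blast
  have obj: "A \<in> Ob" "A1 \<in> Ob" using A A1 by (auto simp: coords_def)
  define v0 where "v0 = (\<Sum>j<m-1. w (\<pi> j) * c' j)"
  define r where "r = (\<Sum>j<m-1. w' j * c (\<pi> j))"
  have v0: "v0 \<in> H A1 A"
    unfolding v0_def using \<pi> by (intro H_sum obj H_mult[of _ I]) (auto intro: coords_H[OF A] coords_H[OF A1])
  have r: "r \<in> H A A1"
    unfolding r_def using \<pi> by (intro H_sum obj H_mult[of _ I]) (auto intro: coords_H[OF A] coords_H[OF A1])
  have wk: "w k \<in> H I A" and ck: "c k \<in> H A I" using coords_H[OF A k] by auto
  have cw: "c (\<pi> i) * (w (\<pi> j) * x) = (if i = j then e I * x else 0)" if "i < m - 1" "j < m - 1" for i j x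
    using coords_cw[OF A \<pi>(1)[OF that(1)] \<pi>(1)[OF that(2)]] \<pi>_inj by (simp flip: mult.assoc)
  have cw': "c' i * (w' j * x) = (if i = j then e I * x else 0)" if "i < m - 1" "j < m - 1" for i j x
    using coords_cw[OF A1 that] by (simp flip: mult.assoc)
  have [simp]: "e I * c' j = c' j" if "j < m-1" for j using id_left coords_H(2)[OF A1 that] by blast
  have [simp]: "e I * c (\<pi> j) = c (\<pi> j)" if "j < m-1" for j using id_left coords_H(2)[OF A \<pi>(1)[OF that]] by blast
  have rv: "r * v0 = e A1"
  proof -
    have "r * v0 = (\<Sum>j<m-1. w' j * c' j)"
      unfolding r_def v0_def sum_product by (simp add: mult.assoc cw if_distrib[of "\<lambda>x. _ * x"] cong: if_cong)
    then show ?thesis using A1 by (simp add: coords_def)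
  qed
  have rw: "r * w k = 0"
    unfolding r_def using coords_cw[OF A _ k] \<pi> by (auto simp: sum_distrib_right mult.assoc intro!: sum.neutral)
  have wc: "w k * c k + v0 * r = e A"
  proof -
    have 1: "v0 * r = (\<Sum>j<m-1. w (\<pi> j) * c (\<pi> j))"
      unfolding r_def v0_def sum_product by (simp add: mult.assoc cw' if_distrib[of "\<lambda>x. _ * x"] cong: if_cong)
    have inj: "inj_on \<pi> {..<m-1}" using \<pi>_inj by (auto simp: inj_on_def)
    have "\<pi> ` {..<m-1} \<subseteq> {..<m} - {k}" using \<pi> by auto
    then have img: "\<pi> ` {..<m-1} = {..<m} - {k}"
      using k card_image[OF inj] by (intro card_subset_eq) simp_all
    have "(\<Sum>j<m-1. w (\<pi> j) * c (\<pi> j)) = (\<Sum>j\<in>{..<m} - {k}. w j * c j)"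
      using sum.reindex[OF inj, of "\<lambda>j. w j * c j"] img by (simp add: o_def)
    then show ?thesis using A k 1 sum.remove[of "{..<m}" k "\<lambda>j. w j * c j"] by (simp add: coords_def)
  qed
  define u where "u = w k * g"
  define v where "v = v0 - u * (f * v0)"
  have fu: "f * u = e I" using g by (simp add: u_def mult.assoc)
  have ru: "r * u = 0" using rw by (simp add: u_def flip: mult.assoc)
  have uf: "u * f + v * r = e A"
  proof -
    have "w k = (w k * c k + v0 * r) * w k" using wc id_left[OF wk] by simp
    then have w0: "w k * (c k * w k) = w k" by (simp add: distrib_right mult.assoc rw)
    have "f = f * (w k * c k + v0 * r)" using wc id_right[OF f] by simp
    then have "u * f = u * (f * (w k * c k)) + u * (f * (v0 * r))" by (metis distrib_left)
    moreover have "u * (f * (w k * c k)) = w k * (g * (f * w k)) * c k" by (simp add: u_def mult.assoc)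
    moreover have "w k * (g * (f * w k)) = w k" using g id_right[OF wk] by simp
    ultimately have "u * f = w k * c k + u * (f * (v0 * r))" by simp
    then show ?thesis using wc by (simp add: v_def algebra_simps)
  qed
  have u: "u \<in> H I A" unfolding u_def by (intro H_mult[of _ I] wk g)
  have v: "v \<in> H A1 A" unfolding v_def by (intro H_diff v0 H_mult[of u I] u H_mult[of f A] f)
  have "f * v = f * v0 - f * u * (f * v0)" by (simp add: v_def algebra_simps)
  also have "\<dots> = 0" using fu id_left[OF H_mult[OF f v0]] by simp
  finally have fv: "f * v = 0" .
  have "r * v = r * v0 - r * u * (f * v0)" by (simp add: v_def algebra_simps)
  then have "r * v = e A1" using rv ru by simp
  then have "bip A I A1 u v f r"
    unfolding bip_def using u v f r fu ru fv uf by simp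
  then show ?thesis using A1 k by auto
qed

text \<open>The second projection is sheared, so that it kills the new inclusion \<open>u'\<close>.\<close>

lemma bip_change_section:
  assumes "bip S A B u v q r" "u' \<in> H A S" "q * u' = e A"
  shows "bip S A B u' v q (r - r * u' * q)"
proof -
  note D = bipD[OF assms(1)]
  have vr: "v * r = e S - u * q" using D(9) by (simp add: algebra_simps)
  have 1: "(r - r * u' * q) * u' = 0"
    using assms(3) id_right[OF H_mult[OF D(4) assms(2)]] by (simp add: algebra_simps)
  have 2: "(r - r * u' * q) * v = e B" using D by (simp add: algebra_simps)
  have "v * (r - r * u' * q) = v * r - v * r * (u' * q)" by (simp add: algebra_simps)
  also have "\<dots> = e S - u * q - (e S * u' * q - u * (q * u') * q)"
    unfolding vr by (simp add: algebra_simps)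
  also have "\<dots> = e S - u' * q" using assms(3) id_left[OF assms(2)] id_right[OF D(1)]
    by (simp add: algebra_simps)
  finally have "u' * q + v * (r - r * u' * q) = e S" by simp
  moreover have "r - r * u' * q \<in> H S B"
    by (intro H_diff D H_mult[of "r * u'" A] H_mult[of r S] assms)
  ultimately show ?thesis using D assms 1 2 by (simp add: bip_def)
qed

lemma bip_assoc:
  assumes 1: "bip S A B u v q r" and 2: "bip B A' B' u' v' q' r'" and T: "bip T A A' a a' b b'"
  shows "bip S T B' (u * b + v * u' * b') (v * v') (a * q + a' * q' * r) (r' * r)"
proof -
  note D = bipD[OF 1] and D' = bipD[OF 2] and E = bipD[OF T]
  have [simp]: "q * (u * x) = e A * x" "r * (v * x) = e B * x" "r * (u * x) = 0" "q * (v * x) = 0"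
    "q' * (u' * x) = e A' * x" "r' * (v' * x) = e B' * x" "r' * (u' * x) = 0" "q' * (v' * x) = 0"
    "b * (a * x) = e A * x" "b' * (a' * x) = e A' * x" "b' * (a * x) = 0" "b * (a' * x) = 0" for x
    using D D' E by (simp_all flip: mult.assoc)
  have [simp]: "e A * b = b" "e B * (u' * b') = u' * b'" "e A' * b' = b'" "e B * v' = v'"
     "e A * q = q" "e A' * (q' * r) = q' * r"
     "q' * (e B * x) = q' * x" "r' * (e B * x) = r' * x" for x
    using D D' E by (simp_all add: id_left id_right id_left_assoc id_right_assoc)
  have "(u * b + v * u' * b') * (a * q + a' * q' * r) + v * v' * (r' * r) 
     = u * q + v * (u' * q' + v' * r') * r"
    by (simp add: algebra_simps)
  also have "\<dots> = e S" using D D' id_right[OF D(2)] by simp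
  finally have 3: "(u * b + v * u' * b') * (a * q + a' * q' * r) + v * v' * (r' * r) = e S" .
  have 4: "(a * q + a' * q' * r) * (u * b + v * u' * b') = e T"
    using E by (simp add: algebra_simps)
  show ?thesis
    unfolding bip_def
  proof (intro conjI 3 4)
    show "u * b + v * u' * b' \<in> H T S" "v * v' \<in> H B' S" "a * q + a' * q' * r \<in> H S T" "r' * r \<in> H S B'"
      using D D' E by (meson H_mult H_add)+
  qed (use D D' E in \<open>simp_all add: algebra_simps\<close>)
qed

lemma bip_trivial:
  assumes "A \<in> Ob" "Z \<in> Ob" "e Z = 0"
  shows "bip A Z A 0 (e A) 0 (e A)"
  using assms H_id[of A] by (simp add: bip_def H_zero id_left)

text \<open>Gaussian elimination. As long as some matrix entry of \<open>f\<close> is a unit, an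
  isomorphism of copies of \<open>I\<close> splits off and the rank \<open>m\<close> of the
  source drops. What remains when no entry is a unit is divisible by \<open>p\<close>.\<close>

lemma eliminate_coords:
  assumes "coords I A m w c" "f \<in> H A B"
  shows "\<exists>X A' B' u u' q q' v v' r r' g. bip A X A' u u' q q' \<and> bip B X B' v v' r r' \<and>
    g \<in> H A' B' \<and> f = v * q + p * (v' * g * q')"
  using assms
proof (induction m arbitrary: A B f w c)
  case 0
  then have A: "e A = 0" "A \<in> Ob" "B \<in> Ob" by (auto simp: coords_def intro: H_tgt)
  have "f = 0" using id_right[OF 0(2)] A by simp
  then show ?case
    using bip_trivial[OF A(2,2,1)] bip_trivial[OF A(3,2,1)] H_zero[OF A(2,3)] by fastforce
next
  case (Suc m)
  note A = Suc.prems(1) and f = Suc.prems(2)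
  have obj: "A \<in> Ob" "B \<in> Ob" using f by (auto intro: H_src H_tgt)
  show ?case
  proof (cases "\<exists>y\<in>H A B. f = p * y")
    case True
    then obtain g where g: "g \<in> H A B" "f = p * g" by blast
    obtain Z where Z: "Z \<in> Ob" "e Z = 0" using ex_zero by blast
    have "f = 0 * 0 + p * (e B * g * e A)" using g by (simp add: id_left id_right)
    then show ?thesis
      using bip_trivial[OF obj(1) Z] bip_trivial[OF obj(2) Z] g by blast
  next
    case False
    obtain l v d where B: "coords I B l v d" using ex_coords obj by blast
    then obtain i j where i: "i < l" and j: "j < Suc m"
      and nd: "\<not> (\<exists>y\<in>H I I. d i * f * w j = p * y)"
      using p_divisible_entrywise[OF f A B] False by blast
    define \<rho> where "\<rho> = d i"
    have \<rho>: "\<rho> \<in> H B I" using coords_H[OF B i] by (simp add: \<rho>_def)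
    have w: "w j \<in> H I A" using coords_H[OF A j] by simp
    have \<rho>f: "\<rho> * f \<in> H A I" using \<rho> f H_mult by blast
    have nd1: "\<not> (\<exists>y\<in>H A I. \<rho> * f = p * y)"
    proof
      assume "\<exists>y\<in>H A I. \<rho> * f = p * y"
      then obtain y where "y \<in> H A I" "\<rho> * f = p * y" by blast
      then have "d i * f * w j = p * (y * w j)" "y * w j \<in> H I I"
        using w by (auto simp: \<rho>_def mult.assoc intro: H_mult)
      then show False using nd by blast
    qed
    have nd2: "\<not> (\<exists>y\<in>H B I. \<rho> = p * y)"
    proof
      assume "\<exists>y\<in>H B I. \<rho> = p * y"
      then obtain y where "y \<in> H B I" "\<rho> = p * y" by blast
      then have "\<rho> * f = p * (y * f)" "y * f \<in> H A I"
        using f by (auto simp: mult.assoc intro: H_mult)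
      then show False using nd1 by blast
    qed
    obtain A1 w' c' u v0 r0 where A1: "coords I A1 m w' c'" and bA: "bip A I A1 u v0 (\<rho> * f) r0"
      using split_functional[OF A \<rho>f nd1] by auto
    obtain B1 u2 v2 r2 where "bip B I B1 u2 v2 \<rho> r2"
      using split_functional[OF B \<rho> nd2] by blast
    note DA = bipD[OF bA]
    have "f * u \<in> H I B" "\<rho> * (f * u) = e I" using DA f by (auto simp: mult.assoc intro: H_mult)
    with \<open>bip B I B1 u2 v2 \<rho> r2\<close> obtain R where bB: "bip B I B1 (f * u) v2 \<rho> R"
      using bip_change_section by blast
    note DB = bipD[OF bB]
    have f1: "R * f * v0 \<in> H A1 B1" using DA DB f by (meson H_mult)
    from Suc.IH[OF A1 this] obtain X A' B' u1 u1' q1 q1' v1 v1' s1 s1' g where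
      1: "bip A1 X A' u1 u1' q1 q1'" and 2: "bip B1 X B' v1 v1' s1 s1'"
      and g: "g \<in> H A' B'" and eq: "R * f * v0 = v1 * q1 + p * (v1' * g * q1')"
      by blast
    obtain T a a' b b' where T: "bip T I X a a' b b'"
      using ex_bip I_obj bip_obj[OF 1] by blast
    have ba: "b * (a * x) = e I * x" "b' * (a' * x) = e X * x" "b' * (a * x) = 0" "b * (a' * x) = 0" for x
      using bipD[OF T] by (simp_all flip: mult.assoc)
    have "f = (f * u * \<rho> + v2 * R) * f * (u * (\<rho> * f) + v0 * r0)"
      using DA DB f by (simp add: id_left id_right)
    also have "\<dots> = f * u * (\<rho> * (f * u)) * (\<rho> * f) + f * u * (\<rho> * f * v0) * r0
         + v2 * (R * (f * u)) * (\<rho> * f) + v2 * (R * f * v0) * r0"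
      by (simp add: algebra_simps)
    also have "\<dots> = f * u * (\<rho> * f) + v2 * (R * f * v0) * r0"
      using DA DB by (simp add: id_right)
    also have "\<dots> = (f * u * b + v2 * v1 * b') * (a * (\<rho> * f) + a' * q1 * r0)
        + p * (v2 * v1' * g * (q1' * r0))"
      unfolding eq using \<rho>f bipD[OF 1]
      by (simp add: algebra_simps ba id_left_assoc p_left_comm id_left[OF \<rho>f])
    finally show ?thesis
      using bip_assoc[OF bA 1 T] bip_assoc[OF bB 2 T] g by blast
  qed
qed

lemma eliminate:
  assumes "f \<in> H A B"
  obtains X A' B' u u' q q' v v' r r' g where "bip A X A' u u' q q'" "bip B X B' v v' r r'"
    "g \<in> H A' B'" "f = v * q + p * (v' * g * q')"
proof -
  obtain m w c where "coords I A m w c" using ex_coords H_src[OF assms] by blast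
  from eliminate_coords[OF this assms] show ?thesis using that by blast
qed

text \<open>Elimination writes \<open>i\<close> as a unit part and a part divisible by \<open>p\<close>.
  The retraction \<open>q\<close> forces the latter to live on a zero object, so a complement
  of the image of the unit part is a complement of \<open>i\<close> as well.\<close>

lemma complement:
  assumes i: "i \<in> H F A" and q: "q \<in> H A F" and qi: "q * i = e F"
  shows "\<exists>K a b. bip A K F a i b q"
proof -
  obtain X F' K u u' s s' v v' r r' g where F: "bip F X F' u u' s s'" and A: "bip A X K v v' r r'"
    and g: "g \<in> H F' K" and i_eq: "i = v * s + p * (v' * g * s')"
    by (rule eliminate[OF i])
  note DF = bipD[OF F] and DA = bipD[OF A]
  have iu': "i * u' = p * (v' * g)"
    using DF g DA unfolding i_eq by (simp add: algebra_simps id_right)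
  have "u' = q * (i * u')" using qi id_left DF by (simp flip: mult.assoc)
  then have u'_eq: "u' = p * (q * (v' * g))" unfolding iu' by (simp add: p_left_comm)
  \<comment> \<open>As \<open>u'\<close> is divisible by \<open>p\<close>, so is the identity of \<open>F'\<close>; hence \<open>u'\<close> vanishes.\<close>
  have "p * u' = 0" by (subst u'_eq) (simp add: p_square_left)
  then have "u' * (s' * (p * (q * (v' * g)))) = 0"
    by (simp add: p_left_comm) (simp flip: mult.assoc)
  then have u'0: "u' = 0" using DF by (simp flip: u'_eq add: id_right)
  have us: "u * s = e F" using DF u'0 by simp
  have is': "i = v * s"
  proof -
    have "i = i * (u * s)" using us id_right[OF i] by simp
    also have "i * u = v" unfolding i_eq using DF DA by (simp add: algebra_simps id_right)
    then have "i * (u * s) = v * s" by (simp flip: mult.assoc)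
    finally show ?thesis .
  qed
  define a where "a = v' - i * (q * v')"
  have a: "a \<in> H K A" unfolding a_def by (intro H_diff DA H_mult[of i F] i H_mult[of q A] q)
  have ri: "r' * i = 0" unfolding is' using DA by (simp flip: mult.assoc)
  have "q * a = q * v' - q * i * (q * v')" by (simp add: a_def algebra_simps)
  then have qa: "q * a = 0" using qi id_left[OF H_mult[OF q DA(2)]] by simp
  have ra: "r' * a = e K" using DA ri by (simp add: a_def algebra_simps flip: mult.assoc)
  have iur: "i * (u * r) = v * r" unfolding is' using DF by (simp add: mult.assoc) (metis DA(3) id_left mult.assoc)
  have vr: "v' * r' = e A - i * (u * r)" using DA iur by (simp add: algebra_simps)
  have "a * r' = v' * r' - i * (q * (v' * r'))" by (simp add: a_def algebra_simps)
  also have "\<dots> = e A - i * (u * r) - (i * q * e A - i * (q * i) * (u * r))"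
    unfolding vr by (simp add: algebra_simps)
  also have "\<dots> = e A - i * q" using qi i q by (simp add: algebra_simps id_right id_right_assoc)
  finally have "a * r' + i * q = e A" by simp
  then have "bip A K F a i r' q" unfolding bip_def using a i q DA qa ra ri qi by simp
  then show ?thesis by blast
qed

text \<open>Modulo \<open>p\<close>, a morphism is an isomorphism between direct summands extended by
  zero, and \<open>t\<close> inverts that isomorphism.\<close>

lemma quasi_inverse:
  assumes "f \<in> H A B"
  shows "\<exists>t\<in>H B A. \<exists>h\<in>H A B. f * t * f = f + p * h"
proof -
  obtain X A' B' u u' q q' v v' r r' g where A: "bip A X A' u u' q q'" and B: "bip B X B' v v' r r'"
    and g: "g \<in> H A' B'" and f: "f = v * q + p * (v' * g * q')"
    by (rule eliminate[OF assms])
  note DA = bipD[OF A] and DB = bipD[OF B]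
  have fu: "f * u = v" unfolding f using DA DB by (simp add: algebra_simps id_right)
  have "r * (v * x) = e X * x" "r * (v' * x) = 0" for x
    using DB by (simp_all flip: mult.assoc)
  then have rf: "r * f = q" unfolding f using DA
    by (simp add: distrib_left mult.assoc p_left_comm id_left)
  have "f * (u * r) * f = f + p * (- (v' * g * q'))"
  proof -
    have "f * (u * r) * f = f * u * (r * f)" by (simp add: mult.assoc)
    then show ?thesis using fu rf by (simp add: f)
  qed
  moreover have "u * r \<in> H B A" "- (v' * g * q') \<in> H A B" using DA DB g by (meson H_mult H_uminus)+
  ultimately show ?thesis by blast
qed

end

section \<open>Exact periodic complexes and their monodromy\<close>

locale periodic_sequences = free_ring_category p Ob e H I
  for p :: "'e::ring" and Ob :: "'o set" and e :: "'o \<Rightarrow> 'e" and H :: "'o \<Rightarrow> 'o \<Rightarrow> 'e set"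
    and I :: 'o +
  fixes n :: nat
  assumes n_ge_3: "n \<ge> 3"
    and parity: "even n \<or> (\<forall>A B. \<forall>x\<in>H A B. p * x + p * x = 0)"
begin

lemma n_pos: "n > 0" using n_ge_3 by simp

definition nseq :: "(nat \<Rightarrow> 'o) \<Rightarrow> (nat \<Rightarrow> 'e) \<Rightarrow> bool" where
  "nseq ob a \<longleftrightarrow> (\<forall>k. ob (k + n) = ob k \<and> a (k + n) = a k \<and> a k \<in> H (ob k) (ob (Suc k)))"

definition complex :: "(nat \<Rightarrow> 'o) \<Rightarrow> (nat \<Rightarrow> 'e) \<Rightarrow> bool" where
  "complex ob a \<longleftrightarrow> nseq ob a \<and> (\<forall>k. a (Suc k) * a k = 0)"

text \<open>As in the Yoneda lemma, morphisms from an arbitrary object \<open>X\<close> play the role of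
  elements.\<close>

definition exact :: "(nat \<Rightarrow> 'o) \<Rightarrow> (nat \<Rightarrow> 'e) \<Rightarrow> bool" where
  "exact ob a \<longleftrightarrow> (\<forall>k X. \<forall>x\<in>H X (ob (Suc k)). a (Suc k) * x = 0 \<longrightarrow> (\<exists>y\<in>H X (ob k). x = a k * y))"

text \<open>In an exact complex of free modules the connecting homomorphisms of $0 \to pA \to A \to A/pA
  \to 0$ are isomorphisms between the consecutive homology groups of $A/pA$, because $pA$ is a
  copy of $A/pA$. The equation \<open>a k * x k = p * x (Suc k)\<close> says that
  the class of \<open>x k\<close> is sent to the class of \<open>x (Suc k)\<close>. Once
  around the period, the class must come back to itself. The index 0 stands for
  \<open>n\<close>.\<close>

definition trivial_monodromy :: "(nat \<Rightarrow> 'o) \<Rightarrow> (nat \<Rightarrow> 'e) \<Rightarrow> bool" where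
  "trivial_monodromy ob a \<longleftrightarrow>
     (\<forall>X x. (\<forall>k. x k \<in> H X (ob k)) \<and> (\<forall>k\<in>{1..n}. a k * x k = p * x (Suc k)) \<longrightarrow>
        (\<exists>u\<in>H X (ob 1). \<exists>v\<in>H X (ob 0). x (Suc n) - x 1 = p * u + a 0 * v))"

text \<open>The members of the collection of the theorem, described without reference to a decomposition;
  \<open>angles_eq\<close> below proves that the two descriptions agree.\<close>

definition angle :: "(nat \<Rightarrow> 'o) \<Rightarrow> (nat \<Rightarrow> 'e) \<Rightarrow> bool" where
  "angle ob a \<longleftrightarrow> complex ob a \<and> exact ob a \<and> trivial_monodromy ob a"

lemma periodic_mod: "(\<And>k. f (k + n) = f k) \<Longrightarrow> f (k mod n) = f k"
proof -
  assume f: "\<And>k. f (k + n) = f k"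
  have "f (r + j * n) = f r" for r j
    by (induction j) (use f in \<open>simp_all add: algebra_simps\<close>, metis add.assoc add.commute f)
  from this[of "k mod n" "k div n"] show ?thesis by simp
qed

lemma periodic_cong: "(\<And>k. f (k + n) = f k) \<Longrightarrow> k mod n = l mod n \<Longrightarrow> f k = f l"
  by (metis periodic_mod)

lemma nseqD:
  assumes "nseq ob a"
  shows "ob (k + n) = ob k" "a (k + n) = a k" "a k \<in> H (ob k) (ob (Suc k))" "ob k \<in> Ob"
  using assms by (auto simp: nseq_def intro: H_src)

lemma complexD: "complex ob a \<Longrightarrow> nseq ob a" "complex ob a \<Longrightarrow> a (Suc k) * a k = 0"
  by (auto simp: complex_def)

lemma complex_zero_assoc: "complex ob a \<Longrightarrow> a (Suc k) * (a k * x) = 0"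
  by (simp add: complexD flip: mult.assoc)

lemma exactD:
  assumes "exact ob a" "x \<in> H X (ob (Suc k))" "a (Suc k) * x = 0"
  shows "\<exists>y\<in>H X (ob k). x = a k * y"
  using assms unfolding exact_def by blast

lemma angleD: "angle ob a \<Longrightarrow> complex ob a" "angle ob a \<Longrightarrow> exact ob a" "angle ob a \<Longrightarrow> nseq ob a"
  by (auto simp: angle_def complex_def)

lemma monodromyD:
  assumes "angle ob a" "\<And>k. x k \<in> H X (ob k)" "\<And>k. 1 \<le> k \<Longrightarrow> k \<le> n \<Longrightarrow> a k * x k = p * x (Suc k)"
  shows "\<exists>u\<in>H X (ob 1). \<exists>v\<in>H X (ob 0). x (Suc n) - x 1 = p * u + a 0 * v"
  using assms unfolding angle_def trivial_monodromy_def by (metis atLeastAtMost_iff)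

lemma p_cancel:
  assumes "x \<in> H A B" "y \<in> H A B" "p * x = p * y"
  shows "\<exists>z\<in>H A B. x = y + p * z"
proof -
  obtain z where "z \<in> H A B" "x - y = p * z"
    using torsion[OF H_diff[OF assms(1,2)]] assms(3) by (auto simp: algebra_simps)
  then show ?thesis by (intro bexI[of _ z]) (simp_all add: algebra_simps)
qed

lemma p_kills_divisible: "f * x = p * y \<Longrightarrow> f * (p * x) = 0"
  by (simp only: p_left_comm[of f x] p_square_left)

text \<open>A chain can always be prolonged: the next term exists because \<open>a (Suc k) * y\<close>
  is killed by \<open>p\<close>.\<close>

lemma divisible_next:
  assumes "complex ob a" "y \<in> H X (ob (Suc k))" "a k * x = p * y"
  shows "\<exists>z\<in>H X (ob (Suc (Suc k))). a (Suc k) * y = p * z"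
proof -
  have "p * (a (Suc k) * y) = a (Suc k) * (a k * x)" using assms(3) by (simp add: p_left_comm)
  also have "\<dots> = 0" by (rule complex_zero_assoc[OF assms(1)])
  finally have "p * (a (Suc k) * y) = 0" .
  then show ?thesis
    using torsion[OF H_mult[OF nseqD(3)[OF complexD(1)[OF assms(1)]] assms(2)]] by blast
qed

text \<open>Cycles and chains are carried over by \<open>u\<close>, and the solutions are brought back by
  \<open>q\<close>. Direct summands and isomorphic sequences are both retracts.\<close>

lemma angle_retract:
  assumes A: "angle ob a" and B: "nseq ob' b"
    and u: "\<And>k. u k \<in> H (ob' k) (ob k)" and q: "\<And>k. q k \<in> H (ob k) (ob' k)"
    and per: "u (Suc n) = u 1"
    and qu: "\<And>k. q k * u k = e (ob' k)"
    and ub: "\<And>k. u (Suc k) * b k = a k * u k" and qa: "\<And>k. q (Suc k) * a k = b k * q k"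
  shows "angle ob' b"
proof -
  have qux: "q k * (u k * x) = x" if "x \<in> H X (ob' k)" for k x X
    using that by (simp add: qu id_left flip: mult.assoc)
  have "b (Suc k) * b k = 0" for k
  proof -
    have "b (Suc k) * b k = q (Suc (Suc k)) * (u (Suc (Suc k)) * (b (Suc k) * b k))"
      using qux nseqD(3)[OF B] H_mult by metis
    also have "u (Suc (Suc k)) * (b (Suc k) * b k) = a (Suc k) * (a k * u k)"
      by (metis mult.assoc ub)
    finally show ?thesis using complex_zero_assoc angleD(1)[OF A] by simp
  qed
  then have "complex ob' b" using B by (simp add: complex_def)
  moreover have "exact ob' b"
    unfolding exact_def
  proof (intro allI ballI impI)
    fix k X x assume x: "x \<in> H X (ob' (Suc k))" and 0: "b (Suc k) * x = 0"
    have "a (Suc k) * (u (Suc k) * x) = u (Suc (Suc k)) * (b (Suc k) * x)"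
      by (simp add: ub flip: mult.assoc)
    then obtain y where y: "y \<in> H X (ob k)" "u (Suc k) * x = a k * y"
      using exactD[OF angleD(2)[OF A] H_mult[OF u x]] 0 by auto
    have "x = q (Suc k) * (a k * y)" using qux[OF x] y by simp
    then have "x = b k * (q k * y)" by (simp add: qa flip: mult.assoc)
    then show "\<exists>y\<in>H X (ob' k). x = b k * y" using H_mult[OF q y(1)] by blast
  qed
  moreover have "trivial_monodromy ob' b"
    unfolding trivial_monodromy_def
  proof (intro allI impI, elim conjE)
    fix X x assume x: "\<forall>k. x k \<in> H X (ob' k)" and ch: "\<forall>k\<in>{1..n}. b k * x k = p * x (Suc k)"
    have "a k * (u k * x k) = p * (u (Suc k) * x (Suc k))" if "1 \<le> k" "k \<le> n" for k
      using bspec[OF ch, of k] that by (simp add: p_left_comm flip: mult.assoc ub) (simp add: mult.assoc p_left_comm)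
    moreover have "u k * x k \<in> H X (ob k)" for k using x u H_mult by blast
    ultimately obtain y v where y: "y \<in> H X (ob 1)" "v \<in> H X (ob 0)"
      "u (Suc n) * x (Suc n) - u 1 * x 1 = p * y + a 0 * v"
      using monodromyD[OF A, of "\<lambda>k. u k * x k" X] by blast
    have xn: "x (Suc n) \<in> H X (ob' 1)" using x nseqD(1)[OF B, of 1] by (metis plus_1_eq_Suc)
    have "x (Suc n) - x 1 = q 1 * (u 1 * (x (Suc n) - x 1))"
      using qux[OF H_diff[OF xn]] x by metis
    also have "\<dots> = q 1 * (p * y + a 0 * v)" using y(3) by (simp add: per algebra_simps)
    also have "\<dots> = p * (q 1 * y) + b 0 * (q 0 * v)"
      using qa[of 0] by (simp add: algebra_simps p_left_comm) (simp flip: mult.assoc)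
    finally show "\<exists>y\<in>H X (ob' 1). \<exists>v\<in>H X (ob' 0). x (Suc n) - x 1 = p * y + b 0 * v"
      using H_mult[OF q y(1)] H_mult[OF q y(2)] by blast
  qed
  ultimately show ?thesis by (simp add: angle_def)
qed

lemma angle_sum:
  assumes A: "angle ob a" and B: "angle ob' b" and S: "nseq os s"
    and bip: "\<And>k. bip (os k) (ob k) (ob' k) (u k) (v k) (q k) (r k)"
    and per: "q (Suc n) = q 1" "r (Suc n) = r 1"
    and s: "\<And>k. s k = u (Suc k) * a k * q k + v (Suc k) * b k * r k"
  shows "angle os s"
proof -
  note D = bipD[OF bip]
  have exp: "x = u k * (q k * x) + v k * (r k * x)" if "x \<in> H X (os k)" for k x X
    using id_left[OF that] by (simp flip: D(9)[of k]) (simp add: algebra_simps)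
  have [simp]: "q k * (u k * x) = e (ob k) * x" "r k * (v k * x) = e (ob' k) * x" "q k * (v k * x) = 0"
    "r k * (u k * x) = 0" for k x
    by (simp_all add: D flip: mult.assoc)
  have [simp]: "e (ob (Suc k)) * (a k * x) = a k * x" "e (ob' (Suc k)) * (b k * x) = b k * x" for k x
    using nseqD(3)[OF angleD(3)[OF A]] nseqD(3)[OF angleD(3)[OF B]] by (auto intro: id_left_assoc)
  have qs: "q (Suc k) * (s k * x) = a k * (q k * x)" and rs: "r (Suc k) * (s k * x) = b k * (r k * x)" for k x
    by (simp_all add: s algebra_simps)
  have su: "s k * (u k * x) = u (Suc k) * (a k * (e (ob k) * x))" and sv: "s k * (v k * x) = v (Suc k) * (b k * (e (ob' k) * x))" for k x
    by (simp_all add: s algebra_simps)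
  have ae: "a k * (e (ob k) * x) = a k * x" "b k * (e (ob' k) * x) = b k * x" for k x
    using nseqD(3)[OF angleD(3)[OF A]] nseqD(3)[OF angleD(3)[OF B]] by (auto intro: id_right_assoc)
  have "s (Suc k) * s k = 0" for k
  proof -
    have "s (Suc k) * (u (Suc k) * (a k * q k)) = 0" "s (Suc k) * (v (Suc k) * (b k * r k)) = 0"
      unfolding su sv ae
      using complex_zero_assoc[OF angleD(1)[OF A]] complex_zero_assoc[OF angleD(1)[OF B]] by simp_all
    then show ?thesis by (simp add: s[of k] distrib_left mult.assoc)
  qed
  then have "complex os s" using S by (simp add: complex_def)
  moreover have "exact os s"
    unfolding exact_def
  proof (intro allI ballI impI)
    fix k X x assume x: "x \<in> H X (os (Suc k))" and 0: "s (Suc k) * x = 0"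
    have "a (Suc k) * (q (Suc k) * x) = 0" "b (Suc k) * (r (Suc k) * x) = 0"
      using 0 by (simp_all flip: qs rs)
    then obtain y z where y: "y \<in> H X (ob k)" "q (Suc k) * x = a k * y"
      and z: "z \<in> H X (ob' k)" "r (Suc k) * x = b k * z"
      using exactD[OF angleD(2)[OF A] H_mult[OF D(3) x]] exactD[OF angleD(2)[OF B] H_mult[OF D(4) x]] by blast
    have "x = s k * (u k * y + v k * z)"
      by (subst exp[OF x]) (simp add: y z distrib_left su sv ae)
    moreover have "u k * y + v k * z \<in> H X (os k)" using D y z by (meson H_mult H_add)
    ultimately show "\<exists>y\<in>H X (os k). x = s k * y" by blast
  qed
  moreover have "trivial_monodromy os s"
    unfolding trivial_monodromy_def
  proof (intro allI impI, elim conjE)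
    fix X x assume x: "\<forall>k. x k \<in> H X (os k)" and ch: "\<forall>k\<in>{1..n}. s k * x k = p * x (Suc k)"
    have "a k * (q k * x k) = p * (q (Suc k) * x (Suc k))" "b k * (r k * x k) = p * (r (Suc k) * x (Suc k))"
      if "1 \<le> k" "k \<le> n" for k
      using ch that by (simp_all add: p_left_comm flip: qs rs)
    note ch' = this
    have qx: "q k * x k \<in> H X (ob k)" "r k * x k \<in> H X (ob' k)" for k using x D H_mult by blast+
    obtain y v' where y: "y \<in> H X (ob 1)" "v' \<in> H X (ob 0)"
      "q (Suc n) * x (Suc n) - q 1 * x 1 = p * y + a 0 * v'"
      using monodromyD[OF A, of "\<lambda>k. q k * x k" X, OF qx(1) ch'(1)] by blast
    obtain z w where z: "z \<in> H X (ob' 1)" "w \<in> H X (ob' 0)"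
      "r (Suc n) * x (Suc n) - r 1 * x 1 = p * z + b 0 * w"
      using monodromyD[OF B, of "\<lambda>k. r k * x k" X, OF qx(2) ch'(2)] by blast
    have xn: "x (Suc n) \<in> H X (os 1)" using x nseqD(1)[OF S, of 1] by (metis plus_1_eq_Suc)
    have "x (Suc n) - x 1 = u 1 * (q 1 * (x (Suc n) - x 1)) + v 1 * (r 1 * (x (Suc n) - x 1))"
      using exp H_diff xn x by metis
    also have "\<dots> = u 1 * (p * y + a 0 * v') + v 1 * (p * z + b 0 * w)"
      using y(3) z(3) by (simp add: per algebra_simps)
    also have "\<dots> = p * (u 1 * y + v 1 * z) + s 0 * (u 0 * v' + v 0 * w)"
      by (simp add: distrib_left su sv ae p_left_comm algebra_simps)
    finally show "\<exists>y\<in>H X (os 1). \<exists>v\<in>H X (os 0). x (Suc n) - x 1 = p * y + s 0 * v"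
      using D y z by (meson H_mult H_add)
  qed
  ultimately show ?thesis by (simp add: angle_def)
qed

text \<open>The homotopy writes every cycle modulo \<open>p\<close> as a boundary modulo \<open>p\<close>;
  the monodromy acts on zero groups.\<close>

lemma contractible_angle:
  assumes A: "complex ob a" and T: "\<And>k. T k \<in> H (ob (Suc k)) (ob k)"
    and h: "\<And>k. e (ob (Suc k)) = T (Suc k) * a (Suc k) + a k * T k"
  shows "angle ob a"
proof -
  have exp: "x = T (Suc k) * (a (Suc k) * x) + a k * (T k * x)" if "x \<in> H X (ob (Suc k))" for k x X
    using id_left[OF that] by (simp add: h algebra_simps)
  have "exact ob a"
    unfolding exact_def using exp T H_mult by (metis add.left_neutral mult_zero_right)
  moreover have "trivial_monodromy ob a"
    unfolding trivial_monodromy_def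
  proof (intro allI impI, elim conjE)
    fix X x assume x: "\<forall>k. x k \<in> H X (ob k)" and ch: "\<forall>k\<in>{1..n}. a k * x k = p * x (Suc k)"
    have per: "ob (Suc n) = ob 1" "ob (Suc (Suc n)) = ob 2" "a (Suc n) = a 1"
      using nseqD[OF complexD(1)[OF A], of 1] nseqD[OF complexD(1)[OF A], of 2] by simp_all
    have "a n * x n = p * x (Suc n)" using ch n_ge_3 by simp
    then obtain z where z: "z \<in> H X (ob 2)" "a 1 * x (Suc n) = p * z"
      using divisible_next[OF A spec[OF x, of "Suc n"]] per by auto
    have x': "x 1 \<in> H X (ob (Suc 0))" "x (Suc n) \<in> H X (ob (Suc 0))" "x 2 \<in> H X (ob 2)" using x per by (simp, metis One_nat_def, simp)
    have "a 1 * x 1 = p * x 2" using ch n_ge_3 by (simp add: numeral_2_eq_2)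
    then have "a (Suc 0) * (x (Suc n) - x 1) = p * (z - x 2)" using z(2) by (simp add: right_diff_distrib)
    then have "x (Suc n) - x 1 = p * (T 1 * (z - x 2)) + a 0 * (T 0 * (x (Suc n) - x 1))"
      using exp[OF H_diff[OF x'(2,1)]] by (metis One_nat_def p_left_comm)
    moreover have "T 1 * (z - x 2) \<in> H X (ob 1)" 
      using T[of 1] z x' by (intro H_mult[of _ "ob 2"] H_diff) (auto simp: numeral_2_eq_2)
    moreover have "T 0 * (x (Suc n) - x 1) \<in> H X (ob 0)" 
      using T[of 0] x' by (intro H_mult[of _ "ob (Suc 0)"] H_diff) auto
    ultimately show "\<exists>y\<in>H X (ob 1). \<exists>v\<in>H X (ob 0). x (Suc n) - x 1 = p * y + a 0 * v"
      by blast
  qed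
  ultimately show ?thesis using A by (simp add: angle_def)
qed

text \<open>Here all connecting homomorphisms are the identity of $F/pF$.\<close>

lemma multiplication_angle:
  assumes F: "F \<in> Ob"
  shows "angle (\<lambda>_. F) (\<lambda>_. p * e F)"
proof -
  have pe: "p * e F * x = p * x" if "x \<in> H X F" for x X
    using id_left[OF that] by (simp add: mult.assoc)
  have "complex (\<lambda>_. F) (\<lambda>_. p * e F)"
    using H_p[OF H_id[OF F]] by (auto simp: complex_def nseq_def pe p_square_left)
  moreover have "exact (\<lambda>_. F) (\<lambda>_. p * e F)"
    unfolding exact_def by (simp add: pe torsion)
  moreover have "trivial_monodromy (\<lambda>_. F) (\<lambda>_. p * e F)"
    unfolding trivial_monodromy_def
  proof (intro allI impI, elim conjE)
    fix X x assume x: "\<forall>k. x k \<in> H X F" and ch: "\<forall>k\<in>{1..n}. p * e F * x k = p * x (Suc k)"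
    have "p * x (Suc j) = p * x 1" if "j \<le> n" for j
      using that
    proof (induction j)
      case (Suc j)
      then show ?case using ch x pe by (metis Suc_leD atLeastAtMost_iff le_add1 plus_1_eq_Suc)
    qed simp
    from this[of n] have "p * x (Suc n) = p * x 1" by blast
    then obtain z where "z \<in> H X F" "x (Suc n) = x 1 + p * z" using p_cancel[of "x (Suc n)" X F "x 1"] x by blast
    moreover have "X \<in> Ob" using H_src[OF spec[OF x]] .
    ultimately show "\<exists>y\<in>H X F. \<exists>v\<in>H X F. x (Suc n) - x 1 = p * y + p * e F * v"
      using H_zero[OF _ F] by (intro bexI[of _ z] bexI[of _ 0]) auto
  qed
  ultimately show ?thesis by (simp add: angle_def)
qed

lemma p_neg: "odd n \<Longrightarrow> x \<in> H A B \<Longrightarrow> - (p * x) = p * x"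
  using parity by (auto simp: neg_eq_iff_add_eq_0)

text \<open>The positions divisible by \<open>n\<close> carry the differential that gets the sign
  $(-1)^n$.\<close>

definition rot :: "(nat \<Rightarrow> 'e) \<Rightarrow> nat \<Rightarrow> 'e" where
  "rot a k = (if odd n \<and> k mod n = 0 then - a (Suc k) else a (Suc k))"

text \<open>The monodromies at two neighbouring positions are conjugate under the connecting homomorphism
  between them. The sign of the rotation multiplies the monodromy by $(-1)^n$, which is 1
  modulo \<open>p\<close>: for odd \<open>n\<close> by the assumption $2p = 0$.\<close>

lemma rotation_angle:
  assumes A: "nseq ob a"
  shows "angle (\<lambda>k. ob (Suc k)) (rot a) \<longleftrightarrow> angle ob a"
proof -
  note D = nseqD[OF A]
  have per: "ob (Suc n) = ob 1" "ob (Suc (Suc n)) = ob 2" "a (Suc n) = a 1" "ob n = ob 0" "a n = a 0"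
    using D(1,2)[of 1] D(1,2)[of 2] D(1,2)[of 0] by simp_all
  have S: "nseq (\<lambda>k. ob (Suc k)) (rot a)"
    unfolding nseq_def rot_def using D(3) D(1,2)[of "Suc _"] by (auto intro: H_uminus)
  have cx: "complex (\<lambda>k. ob (Suc k)) (rot a) \<longleftrightarrow> complex ob a"
  proof -
    have "(\<forall>k. rot a (Suc k) * rot a k = 0) \<longleftrightarrow> (\<forall>k. a (Suc (Suc k)) * a (Suc k) = 0)"
      by (auto simp: rot_def)
    also have "\<dots> \<longleftrightarrow> (\<forall>k. a (Suc k) * a k = 0)"
    proof (intro iffI allI)
      fix k assume "\<forall>k. a (Suc (Suc k)) * a (Suc k) = 0"
      then have "a (Suc (Suc (k + n - 1))) * a (Suc (k + n - 1)) = 0" by blast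
      then show "a (Suc k) * a k = 0" using D(2)[of k] D(2)[of "Suc k"] n_ge_3 by simp
    qed blast
    finally show ?thesis using S A by (simp add: complex_def)
  qed
  have ex: "exact (\<lambda>k. ob (Suc k)) (rot a) \<longleftrightarrow> exact ob a"
  proof
    assume E: "exact ob a"
    show "exact (\<lambda>k. ob (Suc k)) (rot a)"
      unfolding exact_def
    proof (intro allI ballI impI)
      fix k X x assume x: "x \<in> H X (ob (Suc (Suc k)))" and 0: "rot a (Suc k) * x = 0"
      then have "a (Suc (Suc k)) * x = 0" by (auto simp: rot_def split: if_splits)
      with x obtain y where y: "y \<in> H X (ob (Suc k))" "x = a (Suc k) * y" using exactD[OF E] by blast
      then have "x = rot a k * y \<or> x = rot a k * (- y)" by (auto simp: rot_def)
      then show "\<exists>y\<in>H X (ob (Suc k)). x = rot a k * y" using y H_uminus by blast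
    qed
  next
    assume E: "exact (\<lambda>k. ob (Suc k)) (rot a)"
    show "exact ob a"
      unfolding exact_def
    proof (intro allI ballI impI)
      fix k X x assume x: "x \<in> H X (ob (Suc k))" and 0: "a (Suc k) * x = 0"
      let ?k = "k + n - 1"
      have eqs: "a (Suc ?k) = a k" "ob (Suc ?k) = ob k" "a (Suc (Suc ?k)) = a (Suc k)" "ob (Suc (Suc ?k)) = ob (Suc k)"
        using D(1,2)[of k] D(1,2)[of "Suc k"] n_ge_3 by simp_all
      have "x \<in> H X (ob (Suc (Suc ?k)))" "rot a (Suc ?k) * x = 0" using x 0 eqs by (auto simp: rot_def)
      then obtain y where y: "y \<in> H X (ob (Suc ?k))" "x = rot a ?k * y" using E unfolding exact_def by blast
      then have "x = a k * y \<or> x = a k * (- y)" using eqs by (auto simp: rot_def split: if_splits)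
      then show "\<exists>y\<in>H X (ob k). x = a k * y" using y eqs H_uminus by metis
    qed
  qed
  have mono: "trivial_monodromy (\<lambda>k. ob (Suc k)) (rot a) \<longleftrightarrow> trivial_monodromy ob a"
    if C: "complex ob a" and E: "exact ob a"
  proof
    assume M: "trivial_monodromy ob a"
    then have ang: "angle ob a" using C E by (simp add: angle_def)
    show "trivial_monodromy (\<lambda>k. ob (Suc k)) (rot a)"
      unfolding trivial_monodromy_def
    proof (intro allI impI, elim conjE)
      fix X x assume x: "\<forall>k. x k \<in> H X (ob (Suc k))" and ch: "\<forall>k\<in>{1..n}. rot a k * x k = p * x (Suc k)"
      have X: "X \<in> Ob" using H_src[OF spec[OF x]] .
      have ch': "a (Suc k) * x k = p * x (Suc k)" if "1 \<le> k" "k < n" for k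
      proof -
        have "k mod n \<noteq> 0" using that by simp
        then show ?thesis using bspec[OF ch, of k] that by (simp add: rot_def)
      qed
      have x1: "x 1 \<in> H X (ob 2)" "x (Suc n) \<in> H X (ob 2)"
        using x per by (metis One_nat_def numeral_2_eq_2, metis)
      have "a 2 * x 1 = p * x 2" using ch'[of 1] n_ge_3 by (simp add: numeral_2_eq_2)
      then have "a (Suc 1) * (p * x 1) = 0" by (intro p_kills_divisible) (simp add: numeral_2_eq_2)
      then obtain x0 where x0: "x0 \<in> H X (ob 1)" "p * x 1 = a 1 * x0"
        using exactD[OF E, of "p * x 1" X 1] x H_p by auto
      define z where "z k = (if k = 0 then 0 else if k = 1 then x0 else x (k - 1))" for k
      have z: "z k \<in> H X (ob k)" for k
        using x0 x H_zero[OF X D(4)] by (cases k) (auto simp: z_def elim: allE[of _ "k - 1"])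
      have "a k * z k = p * z (Suc k)" if "1 \<le> k" "k \<le> n" for k
        using that x0 ch'[of "k - 1"] by (auto simp: z_def)
      then obtain u v where u: "u \<in> H X (ob 1)" "v \<in> H X (ob 0)" "z (Suc n) - z 1 = p * u + a 0 * v"
        using monodromyD[OF ang, of z X] z by blast
      have zn: "x n = x0 + p * u + a 0 * v" using u(3) n_ge_3 by (simp add: z_def algebra_simps)
      have "a 1 * x n = p * x 1 + p * (a 1 * u)"
        using x0 complex_zero_assoc[OF C, of 0] by (simp add: zn distrib_left p_left_comm)
      then have "p * (x 1 + a 1 * u) = a (Suc n) * x n" by (simp add: per distrib_left)
      moreover have "rot a n * x n = p * x (Suc n)" using ch n_ge_3 by simp
      ultimately have sg: "p * x (Suc n) = (if odd n then - (p * (x 1 + a 1 * u)) else p * (x 1 + a 1 * u))"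
        by (auto simp: rot_def split: if_splits)
      have t: "x 1 + a 1 * u \<in> H X (ob 2)" using x1 u D(3)[of 1] by (auto intro!: H_add H_mult simp: numeral_2_eq_2)
      have "p * x (Suc n) = p * (x 1 + a 1 * u)"
        using sg p_neg[OF _ t] by (simp split: if_splits)
      then obtain w where w: "w \<in> H X (ob 2)" "x (Suc n) = x 1 + a 1 * u + p * w"
        using p_cancel[OF x1(2) t] by blast
      have "a 1 * u = rot a 0 * (if odd n then - u else u)" by (simp add: rot_def)
      then have "x (Suc n) - x 1 = p * w + rot a 0 * (if odd n then - u else u)" using w by simp
      moreover have "(if odd n then - u else u) \<in> H X (ob 1)" using u H_uminus by auto
      ultimately show "\<exists>u\<in>H X (ob (Suc 1)). \<exists>v\<in>H X (ob (Suc 0)). x (Suc n) - x 1 = p * u + rot a 0 * v"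
        using w by (metis One_nat_def numeral_2_eq_2)
    qed
  next
    assume M: "trivial_monodromy (\<lambda>k. ob (Suc k)) (rot a)"
    then have ang: "angle (\<lambda>k. ob (Suc k)) (rot a)" using C E cx ex by (simp add: angle_def)
    show "trivial_monodromy ob a"
      unfolding trivial_monodromy_def
    proof (intro allI impI, elim conjE)
      fix X x assume x: "\<forall>k. x k \<in> H X (ob k)" and ch: "\<forall>k\<in>{1..n}. a k * x k = p * x (Suc k)"
      have X: "X \<in> Ob" using H_src[OF spec[OF x]] .
      have x1: "x 1 \<in> H X (ob 1)" "x (Suc n) \<in> H X (ob 1)" "x 2 \<in> H X (ob 2)" using x per by metis+
      have "a n * x n = p * x (Suc n)" using ch n_ge_3 by simp
      then obtain y where y: "y \<in> H X (ob 2)" "a 1 * x (Suc n) = p * y"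
        using divisible_next[OF C spec[OF x, of "Suc n"]] per by auto
      define z where "z k = (if k \<le> n then x (Suc k) else if k = Suc n then (if odd n then - y else y) else 0)" for k
      have z: "z k \<in> H X (ob (Suc k))" for k
        using x x1(2) y H_zero[OF X D(4)] H_uminus per by (auto simp: z_def)
      have "rot a k * z k = p * z (Suc k)" if "1 \<le> k" "k \<le> n" for k
      proof (cases "k = n")
        case True
        then show ?thesis using y by (simp add: rot_def z_def per)
      next
        case False
        then show ?thesis using ch that by (simp add: rot_def z_def)
      qed
      then obtain u v where u: "u \<in> H X (ob 2)" "v \<in> H X (ob 1)" "z (Suc n) - z 1 = p * u + rot a 0 * v"
        using monodromyD[OF ang, of z X] z by (auto simp: numeral_2_eq_2)
      have z1: "z 1 = x 2" using n_ge_3 by (simp add: z_def numeral_2_eq_2)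
      have "p * z (Suc n) = p * y"
        using p_neg[OF _ y(1)] by (simp add: z_def)
      then have "p * y = p * (x 2 + rot a 0 * v)" 
        using u(3) z1 by (simp add: diff_eq_eq distrib_left p_square_left add.commute)
      moreover define w where "w = (if odd n then - v else v)"
      ultimately have py: "p * y = p * x 2 + a 1 * (p * w)" by (simp add: distrib_left p_left_comm rot_def)
      have w: "w \<in> H X (ob 1)" using u H_uminus by (auto simp: w_def)
      have "a 1 * x 1 = p * x 2" using ch n_ge_3 by (simp add: numeral_2_eq_2)
      then have "a (Suc 0) * (x (Suc n) - x 1 - p * w) = 0" using y py by (simp add: algebra_simps)
      then obtain v' where "v' \<in> H X (ob 0)" "x (Suc n) - x 1 - p * w = a 0 * v'"
        using exactD[OF E, of "x (Suc n) - x 1 - p * w" X 0] x1 w by (metis H_diff H_p One_nat_def)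
      then show "\<exists>u\<in>H X (ob 1). \<exists>v\<in>H X (ob 0). x (Suc n) - x 1 = p * u + a 0 * v"
        using w by (metis diff_eq_eq add.commute)
    qed
  qed
  show ?thesis using cx ex mono by (auto simp: angle_def)
qed

end

section \<open>Deformation of an angle onto a multiplication sequence\<close>

context periodic_sequences
begin

text \<open>The complex \<open>(ob', b)\<close> is a deformation retract of \<open>(ob, a)\<close>, with
  inclusion \<open>i\<close>, retraction \<open>q\<close> and homotopy \<open>T\<close>.\<close>

definition sdr where
  "sdr ob a ob' b i q T \<longleftrightarrow> (\<forall>k.
     i k \<in> H (ob' k) (ob k) \<and> q k \<in> H (ob k) (ob' k) \<and> T k \<in> H (ob (Suc k)) (ob k) \<and>
     i (k + n) = i k \<and> q (k + n) = q k \<and> T (k + n) = T k \<and>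
     q k * i k = e (ob' k) \<and> a k * i k = i (Suc k) * b k \<and> q (Suc k) * a k = b k * q k \<and>
     e (ob (Suc k)) = i (Suc k) * q (Suc k) + (T (Suc k) * a (Suc k) + a k * T k))"

lemma sdrD:
  assumes "sdr ob a ob' b i q T"
  shows "i k \<in> H (ob' k) (ob k)" "q k \<in> H (ob k) (ob' k)" "T k \<in> H (ob (Suc k)) (ob k)"
    "i (k + n) = i k" "q (k + n) = q k" "T (k + n) = T k"
    "q k * i k = e (ob' k)" "a k * i k = i (Suc k) * b k" "q (Suc k) * a k = b k * q k"
    "e (ob (Suc k)) = i (Suc k) * q (Suc k) + (T (Suc k) * a (Suc k) + a k * T k)"
  using assms unfolding sdr_def by blast+

lemma sdr_refl:
  assumes "nseq ob a"
  shows "sdr ob a ob a (\<lambda>k. e (ob k)) (\<lambda>k. e (ob k)) (\<lambda>_. 0)"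
proof -
  note D = nseqD[OF assms]
  show ?thesis
    unfolding sdr_def using D(1) D(4) H_id[OF D(4)] id_left[OF H_id[OF D(4)]] id_left[OF D(3)] id_right[OF D(3)]
      H_zero[OF D(4) D(4)] by simp
qed

lemma sdr_trans:
  assumes 1: "sdr ob a ob' b i q T" and 2: "sdr ob' b ob'' c i' q' T'"
  shows "sdr ob a ob'' c (\<lambda>k. i k * i' k) (\<lambda>k. q' k * q k) (\<lambda>k. T k + i k * T' k * q (Suc k))"
proof -
  note D = sdrD[OF 1] and E = sdrD[OF 2]
  have "T k + i k * T' k * q (Suc k) \<in> H (ob (Suc k)) (ob k)" for k
    using D E by (meson H_add H_mult)
  moreover have "q' k * q k * (i k * i' k) = e (ob'' k)" for k
  proof -
    have "q' k * q k * (i k * i' k) = q' k * (q k * i k) * i' k" by (simp add: mult.assoc)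
    then show ?thesis using D(7)[of k] id_right[OF E(2)] E(7)[of k] by simp
  qed
  moreover have "a k * (i k * i' k) = i (Suc k) * i' (Suc k) * c k" for k
  proof -
    have "a k * (i k * i' k) = i (Suc k) * (b k * i' k)" by (simp add: D(8) flip: mult.assoc)
    then show ?thesis by (simp add: E(8) mult.assoc)
  qed
  moreover have "q' (Suc k) * q (Suc k) * a k = c k * (q' k * q k)" for k
  proof -
    have "q' (Suc k) * q (Suc k) * a k = q' (Suc k) * b k * q k" by (simp add: D(9) mult.assoc)
    then show ?thesis by (simp add: E(9) mult.assoc)
  qed
  moreover have "e (ob (Suc k)) = i (Suc k) * i' (Suc k) * (q' (Suc k) * q (Suc k)) +
      ((T (Suc k) + i (Suc k) * T' (Suc k) * q (Suc (Suc k))) * a (Suc k) + a k * (T k + i k * T' k * q (Suc k)))" for k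
  proof -
    have 1: "i (Suc k) * q (Suc k) = i (Suc k) * e (ob' (Suc k)) * q (Suc k)"
      by (simp add: id_right[OF D(1)])
    have 2: "i (Suc k) * (b k * x) = a k * (i k * x)" for x by (simp add: D(8) flip: mult.assoc)
    have "e (ob (Suc k)) = i (Suc k) * e (ob' (Suc k)) * q (Suc k) + (T (Suc k) * a (Suc k) + a k * T k)"
      using D(10)[of k] 1 by simp
    also have "\<dots> = i (Suc k) * i' (Suc k) * (q' (Suc k) * q (Suc k)) +
      i (Suc k) * T' (Suc k) * (b (Suc k) * q (Suc k)) + i (Suc k) * (b k * (T' k * q (Suc k))) + (T (Suc k) * a (Suc k) + a k * T k)"
      by (simp add: E(10)[of k] algebra_simps)
    finally show ?thesis by (simp add: 2 D(9)[symmetric] algebra_simps)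
  qed
  moreover have "i k * i' k \<in> H (ob'' k) (ob k)" "q' k * q k \<in> H (ob k) (ob'' k)" for k
    using H_mult D(1,2) E(1,2) by blast+
  moreover have "q (Suc (k + n)) = q (Suc k)" for k using D(5)[of "Suc k"] by simp
  ultimately show ?thesis
    unfolding sdr_def by (intro allI conjI) (simp_all only: D(4-6) E(4-6))
qed

text \<open>Elimination in the differential \<open>a m\<close> finds a common summand \<open>X\<close> of
  its source and target on which it is the identity. As \<open>a\<close> is a complex, the
  neighbouring differentials do not see \<open>X\<close>, and the summand given by the
  identity of \<open>X\<close> is contractible. The other differentials are only restricted,
  hence remain divisible by \<open>p\<close> if they were.\<close>

lemma eliminate_at:
  assumes A: "complex ob a" and m: "m < n"
  shows "\<exists>ob' b i q T. nseq ob' b \<and> sdr ob a ob' b i q T \<and>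
    (\<exists>y\<in>H (ob' m) (ob' (Suc m)). b m = p * y) \<and>
    (\<forall>k. (\<exists>y\<in>H (ob k) (ob (Suc k)). a k = p * y) \<longrightarrow> (\<exists>y\<in>H (ob' k) (ob' (Suc k)). b k = p * y))"
proof -
  note N = nseqD[OF complexD(1)[OF A]]
  obtain X A' B' u u' q q' v v' r r' g where bA: "bip (ob m) X A' u u' q q'"
    and bB: "bip (ob (Suc m)) X B' v v' r r'" and g: "g \<in> H A' B'" and am: "a m = v * q + p * (v' * g * q')"
    by (rule eliminate[OF N(3)[of m]])
  note DA = bipD[OF bA] and DB = bipD[OF bB]
  have au: "a m * u = v" unfolding am using DA DB by (simp add: distrib_right mult.assoc id_right)
  have "r * (v * x) = e X * x" "r * (v' * x) = 0" "r' * (v * x) = 0" "r' * (v' * x) = e B' * x" for x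
    using DB by (simp_all flip: mult.assoc)
  then have ra: "r * a m = q" and ra': "r' * a m = p * (g * q')" unfolding am using DA g
    by (simp_all add: distrib_left mult.assoc p_left_comm id_left id_left_assoc)
  define P where "P k \<longleftrightarrow> k mod n = m" for k
  define Q where "Q k \<longleftrightarrow> k mod n = Suc m mod n" for k
  have Q: "Q (Suc k) \<longleftrightarrow> P k" for k
    unfolding P_def Q_def using m by (auto simp: mod_Suc split: if_splits)
  have PQ: "\<not> (P k \<and> Q k)" for k
    unfolding P_def Q_def using m n_ge_3 by (auto simp: mod_Suc)
  have per: "P (k + n) = P k" "Q (k + n) = Q k" for k by (simp_all add: P_def Q_def)
  have Pm: "P m" using m by (simp add: P_def)
  have onP: "ob k = ob m" "a k = a m" if "P k" for k
    using that m N by (auto simp: P_def intro: periodic_cong)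
  have onQ: "ob k = ob (Suc m)" "a k = a (Suc m)" if "Q k" for k
    using that N by (auto simp: Q_def intro: periodic_cong)
  define ob' where "ob' k = (if P k then A' else if Q k then B' else ob k)" for k
  define i where "i k = (if P k then u' else if Q k then v' else e (ob k))" for k
  define j where "j k = (if P k then q' else if Q k then r' else e (ob k))" for k
  define T where "T k = (if P k then u * r else 0)" for k
  define D where "D k = (if P k then u * q else if Q k then v * r else 0)" for k
  define b where "b k = j (Suc k) * a k * i k" for k
  have eo: "e (ob k) * e (ob k) = e (ob k)" for k using id_left H_id N(4) by blast
  have i: "i k \<in> H (ob' k) (ob k)" and j: "j k \<in> H (ob k) (ob' k)" for k
    using DA DB onP onQ H_id N(4) by (auto simp: i_def j_def ob'_def)
  have T: "T k \<in> H (ob (Suc k)) (ob k)" for k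
    using onP[of k] onQ(1)[of "Suc k"] Q[of k] DA DB H_zero N(4) by (auto simp: T_def intro: H_mult)
  have ji: "j k * i k = e (ob' k)" for k
    using DA DB eo by (auto simp: i_def j_def ob'_def)
  have ij: "e (ob k) = i k * j k + D k" for k
    using DA DB eo onP onQ by (auto simp: i_def j_def D_def algebra_simps)
  have Dai: "D (Suc k) * a k * i k = 0" for k
  proof -
    have "q * (a k * x) = 0" if "P (Suc k)" for x
    proof -
      have "q * a k = r * (a (Suc k) * a k)" using ra onP[OF that] by (simp flip: mult.assoc)
      then show ?thesis using complexD(2)[OF A] by (simp flip: mult.assoc)
    qed
    moreover have "r * (a k * i k) = 0" if "P k"
      using that onP[OF that] ra DA by (simp add: i_def flip: mult.assoc)
    ultimately show ?thesis using Q[of k] by (auto simp: D_def mult.assoc)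
  qed
  have jaD: "j (Suc k) * a k * D k = 0" for k
  proof -
    have "j (Suc k) * (a k * (u * q)) = 0" if "P k"
    proof -
      have "a k * (u * q) = v * q" using onP[OF that] au by (simp flip: mult.assoc)
      moreover have "j (Suc k) = r'" using that Q[of k] PQ[of "Suc k"] by (auto simp: j_def)
      ultimately show ?thesis using DB by (simp flip: mult.assoc)
    qed
    moreover have "a k * (v * r) = 0" if "Q k"
      using onQ[OF that] au complexD(2)[OF A, of m] by (metis mult.assoc mult_zero_left)
    ultimately show ?thesis by (auto simp: D_def mult.assoc)
  qed
  have DT: "D (Suc k) = T (Suc k) * a (Suc k) + a k * T k" for k
  proof -
    have "u * r * a (Suc k) = u * q" if "P (Suc k)" using onP[OF that] ra by (simp add: mult.assoc)
    moreover have "a k * (u * r) = v * r" if "P k" using onP[OF that] au by (simp flip: mult.assoc)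
    ultimately show ?thesis using Q[of k] PQ[of "Suc k"] by (auto simp: D_def T_def)
  qed
  have "sdr ob a ob' b i j T"
    unfolding sdr_def
  proof (intro allI conjI i j T ji)
    fix k
    show "i (k + n) = i k" "j (k + n) = j k" "T (k + n) = T k"
      by (simp_all add: i_def j_def T_def per N)
    have "a k * i k = (i (Suc k) * j (Suc k) + D (Suc k)) * (a k * i k)"
      using N(3)[of k] by (simp add: id_left_assoc flip: ij)
    also have "\<dots> = i (Suc k) * b k"
      using Dai[of k] by (simp add: b_def distrib_right mult.assoc)
    finally show "a k * i k = i (Suc k) * b k" .
    have "j (Suc k) * a k = j (Suc k) * a k * (i k * j k + D k)"
      using N(3)[of k] by (simp add: id_right mult.assoc flip: ij)
    also have "\<dots> = b k * j k"
      using jaD[of k] by (simp add: b_def distrib_left mult.assoc)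
    finally show "j (Suc k) * a k = b k * j k" .
    show "e (ob (Suc k)) = i (Suc k) * j (Suc k) + (T (Suc k) * a (Suc k) + a k * T k)"
      using ij DT by metis
  qed
  moreover have "b k \<in> H (ob' k) (ob' (Suc k))" for k
    unfolding b_def by (intro H_mult[OF H_mult[OF j N(3)] i])
  then have "nseq ob' b"
    by (simp add: nseq_def) (simp add: b_def ob'_def i_def j_def per N flip: add_Suc)
  moreover have "\<exists>y\<in>H (ob' m) (ob' (Suc m)). b m = p * y"
  proof -
    have "P m" "Q (Suc m)" "\<not> P (Suc m)" using Pm Q PQ by blast+
    then have "ob' m = A'" "ob' (Suc m) = B'" "b m = r' * a m * u'" by (auto simp: ob'_def b_def i_def j_def)
    moreover have "r' * a m * u' = p * g" using ra' DA g by (simp add: mult.assoc id_right)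
    ultimately show ?thesis using g by auto
  qed
  moreover have "\<exists>y\<in>H (ob' k) (ob' (Suc k)). b k = p * y" if "y \<in> H (ob k) (ob (Suc k))" "a k = p * y" for k y
    using that H_mult[OF H_mult[OF j that(1)] i]
    by (intro bexI[of _ "j (Suc k) * y * i k"]) (simp_all add: b_def mult.assoc p_left_comm)
  ultimately show ?thesis by blast
qed

text \<open>After one elimination for each of the \<open>n\<close> positions, no differential has a unit
  part left.\<close>

lemma ex_minimal:
  assumes "angle ob a"
  shows "\<exists>ob' b i q T. angle ob' b \<and> sdr ob a ob' b i q T \<and> (\<forall>k. \<exists>y\<in>H (ob' k) (ob' (Suc k)). b k = p * y)"
proof -
  have "\<exists>ob' b i q T. angle ob' b \<and> sdr ob a ob' b i q T \<and> (\<forall>k<m. \<exists>y\<in>H (ob' k) (ob' (Suc k)). b k = p * y)"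
    if "m \<le> n" for m
    using that
  proof (induction m)
    case 0
    then show ?case using assms sdr_refl[OF angleD(3)] by blast
  next
    case (Suc m)
    then obtain ob' b i q T where 1: "angle ob' b" "sdr ob a ob' b i q T"
      "\<forall>k<m. \<exists>y\<in>H (ob' k) (ob' (Suc k)). b k = p * y" by auto
    obtain ob'' c i' q' T' where 2: "nseq ob'' c" "sdr ob' b ob'' c i' q' T'"
      "\<exists>y\<in>H (ob'' m) (ob'' (Suc m)). c m = p * y"
      "\<forall>k. (\<exists>y\<in>H (ob' k) (ob' (Suc k)). b k = p * y) \<longrightarrow> (\<exists>y\<in>H (ob'' k) (ob'' (Suc k)). c k = p * y)"
      using eliminate_at[OF angleD(1)[OF 1(1)] Suc_le_lessD[OF Suc.prems]] by blast
    note E = sdrD[OF 2(2)]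
    have "angle ob'' c"
      using E(4)[of 1] by (intro angle_retract[OF 1(1) 2(1) E(1,2) _ E(7) E(8)[symmetric] E(9)]) simp
    moreover have "\<exists>y\<in>H (ob'' k) (ob'' (Suc k)). c k = p * y" if "k < Suc m" for k
      using that 1(3) 2(3,4) by (cases "k = m") auto
    ultimately show ?case using sdr_trans[OF 1(2) 2(2)] by blast
  qed
  from this[OF le_refl] obtain ob' b i q T where 1: "angle ob' b" "sdr ob a ob' b i q T"
    "\<forall>k<n. \<exists>y\<in>H (ob' k) (ob' (Suc k)). b k = p * y"
    by blast
  have "\<exists>y\<in>H (ob' k) (ob' (Suc k)). b k = p * y" for k
  proof -
    have "b (k mod n) = b k" "ob' (k mod n) = ob' k" "ob' (Suc (k mod n)) = ob' (Suc k)"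
      using nseqD(1,2)[OF angleD(3)[OF 1(1)]]
      by (metis mod_Suc_eq periodic_cong mod_mod_trivial)+
    then show ?thesis using 1(3)[rule_format, of "k mod n"] n_pos by simp
  qed
  then show ?thesis using 1 by blast
qed

text \<open>Write the differentials as \<open>p * b k\<close>. Exactness makes each \<open>b k\<close>
  invertible modulo \<open>p\<close>, hence invertible. The products of the
  \<open>b k\<close> then identify all the objects with the first one and all differentials
  but the last with \<open>p\<close>; that the last one becomes \<open>p\<close> as well is
  the triviality of the monodromy.\<close>

lemma minimal_angle:
  assumes A: "angle ob a" and min: "\<And>k. \<exists>y\<in>H (ob k) (ob (Suc k)). a k = p * y"
  shows "\<exists>F i q. F \<in> Ob \<and> sdr ob a (\<lambda>_. F) (\<lambda>_. p * e F) i q (\<lambda>_. 0)"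
proof -
  note N = nseqD[OF angleD(3)[OF A]]
  obtain b where b: "\<And>k. b k \<in> H (ob k) (ob (Suc k))" and ab: "\<And>k. a k = p * b k" using min by metis
  have pp: "a k * (p * x) = 0" for k x by (simp add: ab p_left_comm[of "b k"] p_square_left mult.assoc)
  have "\<exists>g\<in>H (ob (Suc k)) (ob k). b k * g = e (ob (Suc k)) \<and> g * b k = e (ob k)" if "k \<ge> 1" for k
  proof -
    have eo: "e (ob l) \<in> H (ob l) (ob l)" for l using H_id N(4) by blast
    obtain y where y: "y \<in> H (ob (Suc k)) (ob k)" "p * e (ob (Suc k)) = a k * y"
      using exactD[OF angleD(2)[OF A] H_p[OF eo] pp] by blast
    then have "p * e (ob (Suc k)) = p * (b k * y)" by (simp add: ab mult.assoc)
    then obtain z where z: "z \<in> H (ob (Suc k)) (ob (Suc k))" "e (ob (Suc k)) = b k * y + p * z"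
      using p_cancel[OF eo H_mult[OF b y(1)]] by blast
    define g where "g = y + p * (y * z)"
    have g: "g \<in> H (ob (Suc k)) (ob k)" unfolding g_def by (intro H_add H_p H_mult[OF y(1) z(1)] y)
    have b_y: "b k * y = e (ob (Suc k)) - p * z" using z(2) by simp
    have "b k * g = b k * y + p * (b k * y * z)" by (simp add: g_def distrib_left p_left_comm[of "b k"] mult.assoc)
    also have "\<dots> = e (ob (Suc k))" unfolding b_y
      using z(1) by (simp add: left_diff_distrib right_diff_distrib id_left mult.assoc p_square_left)
    finally have bg: "b k * g = e (ob (Suc k))" .
    obtain l where l: "k = Suc l" using \<open>k \<ge> 1\<close> by (cases k) auto
    have "a k * (g * b k - e (ob k)) = p * (b k * g * b k - b k * e (ob k))"
      by (simp add: ab algebra_simps)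
    also have "\<dots> = 0" using bg by (simp add: id_left[OF b] id_right[OF b])
    finally obtain x where x: "x \<in> H (ob k) (ob l)" "g * b k - e (ob k) = a l * x"
      using exactD[OF angleD(2)[OF A], of "g * b k - e (ob k)" "ob k" l] l H_diff[OF H_mult[OF g b] eo] by auto
    define w where "w = b l * x"
    have w: "w \<in> H (ob k) (ob k)" using x b[of l] l H_mult by (auto simp: w_def)
    have gb: "g * b k = e (ob k) + p * w" using x(2) by (simp add: ab w_def mult.assoc algebra_simps)
    define h where "h = g - p * (w * g)"
    have h: "h \<in> H (ob (Suc k)) (ob k)" unfolding h_def by (intro H_diff H_p H_mult[OF w g] g)
    have "h * b k = g * b k - p * (w * (g * b k))" by (simp add: h_def algebra_simps)
    also have "\<dots> = e (ob k)" unfolding gb using w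
      by (simp add: distrib_left id_right p_left_comm[of w] p_square_left)
    finally have hb: "h * b k = e (ob k)" .
    have "h = h * (b k * g)" using bg h by (simp add: id_right)
    also have "\<dots> = g" using hb g by (simp add: id_left flip: mult.assoc)
    finally show ?thesis using bg hb g by blast
  qed
  then obtain g where g: "\<And>k. k \<ge> 1 \<Longrightarrow> g k \<in> H (ob (Suc k)) (ob k)"
    and bg: "\<And>k. k \<ge> 1 \<Longrightarrow> b k * g k = e (ob (Suc k))" and gb: "\<And>k. k \<ge> 1 \<Longrightarrow> g k * b k = e (ob k)"
    by metis
  define F where "F = ob 1"
  have F: "F \<in> Ob" "e F \<in> H F F" using N(4) H_id by (auto simp: F_def)
  define f where "f = rec_nat (e F) (\<lambda>k x. b (Suc k) * x)"
  define h where "h = rec_nat (e F) (\<lambda>k x. x * g (Suc k))"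
  have f0: "f 0 = e F" and fS: "f (Suc k) = b (Suc k) * f k" for k by (simp_all add: f_def)
  have h0: "h 0 = e F" and hS: "h (Suc k) = h k * g (Suc k)" for k by (simp_all add: h_def)
  have f: "f k \<in> H F (ob (Suc k))" for k
    by (induction k) (use F in \<open>auto simp: f0 fS F_def intro: H_mult[OF b]\<close>)
  have h: "h k \<in> H (ob (Suc k)) F" for k
    by (induction k) (use F in \<open>auto simp: h0 hS F_def intro!: H_mult[OF _ g]\<close>)
  have hf: "h k * f k = e F" for k
  proof (induction k)
    case (Suc k)
    have "h (Suc k) * f (Suc k) = h k * (g (Suc k) * b (Suc k)) * f k" by (simp add: hS fS mult.assoc)
    then show ?case using gb[of "Suc k"] Suc by (simp add: id_right[OF h])
  qed (use F f0 h0 id_left in auto)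
  have fh: "f k * h k = e (ob (Suc k))" for k
  proof (induction k)
    case (Suc k)
    have "f (Suc k) * h (Suc k) = b (Suc k) * (f k * h k) * g (Suc k)" by (simp add: hS fS mult.assoc)
    then show ?case using bg[of "Suc k"] Suc by (simp add: id_right[OF b])
  qed (use F f0 h0 id_left in \<open>auto simp: F_def\<close>)
  have af: "a (Suc k) * f k = p * f (Suc k)" for k by (simp add: ab fS mult.assoc)
  \<comment> \<open>The chain of the \<open>f k\<close> computes the monodromy, which is thus the identity modulo \<open>p\<close>.\<close>
  have pfn: "p * f n = p * f 0"
  proof -
    define x where "x k = (case k of 0 \<Rightarrow> 0 | Suc k \<Rightarrow> f k)" for k
    have "x k \<in> H F (ob k)" for k using f H_zero[OF F(1) N(4)] by (cases k) (auto simp: x_def)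
    moreover have "a k * x k = p * x (Suc k)" if "1 \<le> k" "k \<le> n" for k
      using that af by (cases k) (auto simp: x_def)
    ultimately obtain u v where "x (Suc n) - x 1 = p * u + a 0 * v"
      using monodromyD[OF A, of x F] by blast
    then have "f n - f 0 = p * (u + b 0 * v)" by (simp add: x_def ab mult.assoc distrib_left)
    then have "p * (f n - f 0) = 0" by (simp add: p_square_left)
    then show ?thesis by (simp add: right_diff_distrib)
  qed
  define j where "j k = (k + (n - 1)) mod n" for k
  have j: "ob (Suc (j k)) = ob k" "a (Suc (j k)) = a k" for k
  proof -
    have "Suc (j k) mod n = k mod n" using n_ge_3 by (simp add: j_def mod_Suc_eq)
    then show "ob (Suc (j k)) = ob k" "a (Suc (j k)) = a k" using periodic_cong N by metis+
  qed
  have jn: "j (k + n) = j k" for k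
    by (simp add: j_def add.assoc flip: add.commute[of n])
  have jS: "p * f (j (Suc k)) = p * f (Suc (j k))" for k
  proof -
    have "j (Suc k) = Suc (j k) mod n" by (simp add: j_def mod_Suc_eq)
    moreover have "j k < n" using n_pos by (simp add: j_def)
    ultimately have "j (Suc k) = (if Suc (j k) = n then 0 else Suc (j k))" by auto
    then show ?thesis using pfn by auto
  qed
  have ai: "a k * f (j k) = f (j (Suc k)) * (p * e F)" for k
  proof -
    have "a k * f (j k) = p * f (j (Suc k))" using af[of "j k"] j jS by simp
    then show ?thesis by (simp add: p_left_comm[of "f _"] id_right[OF f])
  qed
  have "sdr ob a (\<lambda>_. F) (\<lambda>_. p * e F) (\<lambda>k. f (j k)) (\<lambda>k. h (j k)) (\<lambda>_. 0)"
    unfolding sdr_def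
  proof (intro allI conjI)
    fix k
    show "f (j k) \<in> H F (ob k)" "h (j k) \<in> H (ob k) F" using f[of "j k"] h[of "j k"] j by simp_all
    show "0 \<in> H (ob (Suc k)) (ob k)" using H_zero N(4) by simp
    show "f (j (k + n)) = f (j k)" "h (j (k + n)) = h (j k)" by (simp_all add: jn)
    show "h (j k) * f (j k) = e F" by (rule hf)
    show "a k * f (j k) = f (j (Suc k)) * (p * e F)" by (rule ai)
    have "h (j (Suc k)) * a k = h (j (Suc k)) * (a k * (f (j k) * h (j k)))"
      using fh[of "j k"] j N(3)[of k] by (simp add: id_right)
    also have "\<dots> = h (j (Suc k)) * f (j (Suc k)) * (p * e F) * h (j k)" 
      using ai[of k] by (simp add: mult.assoc) (simp flip: mult.assoc)
    finally show "h (j (Suc k)) * a k = p * e F * h (j k)"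
      using hf F H_p[OF F(2)] by (simp add: id_left)
    show "e (ob (Suc k)) = f (j (Suc k)) * h (j (Suc k)) + (0 * a (Suc k) + a k * 0)"
      using fh[of "j (Suc k)"] j by simp
  qed simp
  then show ?thesis using F by blast
qed

text \<open>The retract that elimination leaves is itself isomorphic to a multiplication sequence. The
  side condition \<open>q k * T k = 0\<close> is achieved by replacing the homotopy $T$
  by $(1 - iq)T$.\<close>

theorem angle_sdr_multiplication:
  assumes A: "angle ob a"
  shows "\<exists>F i q T. F \<in> Ob \<and> sdr ob a (\<lambda>_. F) (\<lambda>_. p * e F) i q T \<and> (\<forall>k. q k * T k = 0)"
proof -
  obtain ob' b i q T where 1: "angle ob' b" "sdr ob a ob' b i q T" "\<And>k. \<exists>y\<in>H (ob' k) (ob' (Suc k)). b k = p * y"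
    using ex_minimal[OF A] by blast
  from minimal_angle[OF 1(1,3)] obtain F i' q' where F: "F \<in> Ob" and 2: "sdr ob' b (\<lambda>_. F) (\<lambda>_. p * e F) i' q' (\<lambda>_. 0)"
    by blast
  from sdr_trans[OF 1(2) 2] obtain i q T where S: "sdr ob a (\<lambda>_. F) (\<lambda>_. p * e F) i q T" by blast
  note D = sdrD[OF S] and N = nseqD[OF angleD(3)[OF A]]
  define T' where "T' k = T k - i k * q k * T k" for k
  have "e (ob (Suc k)) = i (Suc k) * q (Suc k) + (T' (Suc k) * a (Suc k) + a k * T' k)" for k
  proof -
    let ?i = "i (Suc k)" and ?q = "q (Suc k)"
    have aiq: "a k * (i k * (q k * x)) = ?i * (?q * (a k * x))" for x
    proof -
      have "a k * (i k * (q k * x)) = a k * i k * q k * x" by (simp add: mult.assoc)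
      also have "\<dots> = ?i * (p * e F * q k) * x" by (simp add: D(8) mult.assoc)
      also have "p * e F * q k = ?q * a k" by (simp add: D(9))
      finally show ?thesis by (simp add: mult.assoc)
    qed
    have h: "T (Suc k) * a (Suc k) + a k * T k = e (ob (Suc k)) - ?i * ?q" using D(10)[of k] by (simp add: algebra_simps)
    have "T' (Suc k) * a (Suc k) + a k * T' k = (T (Suc k) * a (Suc k) + a k * T k)
        - ?i * ?q * (T (Suc k) * a (Suc k) + a k * T k)"
      by (simp add: T'_def algebra_simps aiq)
    also have "\<dots> = e (ob (Suc k)) - ?i * ?q - (?i * ?q * e (ob (Suc k)) - ?i * (?q * ?i) * ?q)"
      unfolding h by (simp add: algebra_simps)
    also have "\<dots> = e (ob (Suc k)) - ?i * ?q"
      unfolding D(7) using id_right[OF H_mult[OF D(1)[of "Suc k"] D(2)[of "Suc k"]]] id_right[OF D(1)[of "Suc k"]] by simp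
    finally show ?thesis by simp
  qed
  moreover have "T' k \<in> H (ob (Suc k)) (ob k)" for k
    unfolding T'_def using D by (meson H_diff H_mult)
  moreover have "T' (k + n) = T' k" for k using D by (simp add: T'_def)
  ultimately have "sdr ob a (\<lambda>_. F) (\<lambda>_. p * e F) i q T'"
    using D unfolding sdr_def by blast
  moreover have "q k * T' k = 0" for k
  proof -
    have "q k * T' k = q k * T k - (q k * i k) * (q k * T k)" by (simp add: T'_def algebra_simps)
    then show ?thesis unfolding D(7) using id_left[OF H_mult[OF D(2)[of k] D(3)[of k]]] by simp
  qed
  ultimately show ?thesis using F by blast
qed

end

section \<open>Extending two components to a morphism\<close>

context periodic_sequences
begin

text \<open>The \<open>x k\<close> and \<open>y k\<close> are the two components of a chain in the
  mapping cone of a morphism \<open>g\<close> between the multiplication sequences of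
  \<open>F\<close> and \<open>G\<close>. Such a \<open>g\<close> is balanced if, once around
  the period, the second component changes only by a boundary modulo \<open>p\<close>.\<close>

definition balanced :: "'o \<Rightarrow> 'o \<Rightarrow> (nat \<Rightarrow> 'e) \<Rightarrow> bool" where
  "balanced F G g \<longleftrightarrow> (\<forall>X x y. (\<forall>k. x k \<in> H X F \<and> y k \<in> H X G) \<and>
     (\<forall>k\<in>{1..n}. p * x (Suc k) = - (p * x k) \<and> g (Suc k) * x k + p * y k = p * y (Suc k)) \<longrightarrow>
     (\<exists>v\<in>H X F. \<exists>w\<in>H X G. y (Suc n) - y 1 = g 1 * v + p * w))"

text \<open>Write the components as $g_k = g_1 + p h_k$. A chain in the cone has $x_{k+1} \equiv -x_k$,
  and summing up the equations for the \<open>y k\<close> leaves an alternating sum of the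
  $h_k$, in which the prescribed $h_2$ can be compensated by $h_3$. For odd \<open>n\<close>
  there is a further term: the connecting homomorphism of $g_1$ itself, from its kernel to its
  cokernel modulo \<open>p\<close>. If $g_1 t g_1 = g_1 + ph$, then this homomorphism is
  induced by $-h$, so that $h_3$ can cancel it too.\<close>

lemma ex_balanced:
  assumes g: "g1 \<in> H F G" "g2 \<in> H F G" "p * g2 = p * g1"
  shows "\<exists>g. g 1 = g1 \<and> g 2 = g2 \<and> (\<forall>k. g k \<in> H F G \<and> g (k + n) = g k \<and> p * g k = p * g1) \<and> balanced F G g"
proof -
  obtain h2 where h2: "h2 \<in> H F G" "g2 = g1 + p * h2" using p_cancel[OF g(2,1,3)] by blast
  obtain t h where t: "t \<in> H G F" and h: "h \<in> H F G" and gtg: "g1 * t * g1 = g1 + p * h"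
    using quasi_inverse[OF g(1)] by blast
  define h3 where "h3 = (if even n then h2 else h2 - h)"
  have h3: "h3 \<in> H F G" using h2 h H_diff by (auto simp: h3_def)
  define g where "g k = (if k mod n = 2 then g2 else if k mod n = 3 mod n then g1 + p * h3 else g1)" for k
  have three: "3 mod n = (if n = 3 then 0 else 3)" using n_ge_3 by simp
  have g12: "g 1 = g1" "g 2 = g2" "g 3 = g1 + p * h3" using n_ge_3 by (simp_all add: g_def three)
  have gk: "g (Suc k) = g1" if "3 \<le> k" "k \<le> n" for k
  proof -
    consider "k = n" | "Suc k = n" | "Suc k < n" using \<open>k \<le> n\<close> by linarith
    then show ?thesis
    proof cases
      case 1
      then show ?thesis using that by (cases "n = 3") (simp_all add: g_def mod_Suc)
    qed (use that in \<open>simp_all add: g_def three\<close>)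
  qed
  have gH: "g k \<in> H F G" for k using assms h3 by (auto simp: g_def intro: H_add H_p)
  have pg: "p * g k = p * g1" for k using g(3) by (auto simp: g_def distrib_left p_square_left)
  have "balanced F G g"
    unfolding balanced_def
  proof (intro allI impI, elim conjE)
    fix X x y
    assume xy: "\<forall>k. x k \<in> H X F \<and> y k \<in> H X G"
      and ch: "\<forall>k\<in>{1..n}. p * x (Suc k) = - (p * x k) \<and> g (Suc k) * x k + p * y k = p * y (Suc k)"
    have x: "x k \<in> H X F" and y: "y k \<in> H X G" for k using xy by auto
    have X: "X \<in> Ob" "F \<in> Ob" using H_src[OF x] H_tgt[OF x] by auto
    define S where "S m = (\<Sum>k=1..m. x k)" for m
    have S: "S m \<in> H X F" for m unfolding S_def using X x by (intro H_sum) auto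
    have px: "p * x (Suc k) = (if even k then p * x 1 else - (p * x 1))" if "k \<le> n" for k
      using that
    proof (induction k)
      case (Suc k)
      then have "p * x (Suc (Suc k)) = - (p * x (Suc k))" using bspec[OF ch, of "Suc k"] by simp
      then show ?case using Suc by simp
    qed simp
    have pS: "p * S m = (if even m then 0 else p * x 1)" if "m \<le> n" for m
      using that
    proof (induction m)
      case (Suc m)
      have "p * S (Suc m) = p * S m + p * x (Suc m)" by (simp add: S_def distrib_left)
      then show ?case using Suc px[of m] by simp
    qed (simp add: S_def)
    have step: "p * y (Suc k) = g (Suc k) * x k + p * y k" if "1 \<le> k" "k \<le> n" for k
      using bspec[OF ch, of k] that by simp
    have tel: "p * (y (Suc m) - y 1) = g1 * S m + p * (h2 * x 1 + h3 * x 2)" if "2 \<le> m" "m \<le> n" for m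
      using that
    proof (induction m rule: nat_induct_at_least)
      case base
      have "p * y 3 = g 3 * x 2 + p * y 2" "p * y 2 = g 2 * x 1 + p * y 1"
        using step[of 1] step[of 2] n_ge_3 by (simp_all add: numeral_2_eq_2 numeral_3_eq_3)
      moreover have "S 2 = x 1 + x 2" by (simp add: S_def numeral_2_eq_2)
      ultimately show ?case using g12 h2
        by (simp add: numeral_3_eq_3[symmetric] algebra_simps)
    next
      case (Suc m)
      have "p * y (Suc (Suc m)) = g1 * x (Suc m) + p * y (Suc m)"
        using step[of "Suc m"] gk[of "Suc m"] Suc by simp
      moreover have "S (Suc m) = S m + x (Suc m)" by (simp add: S_def)
      ultimately show ?case using Suc by (simp add: algebra_simps)
    qed
    have "p * x 2 = - (p * x 1)" using px[of 1] n_ge_3 by (simp add: numeral_2_eq_2)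
    then have "p * (h3 * x 2) = - (p * (h3 * x 1))"
      by (metis p_left_comm mult_minus_right)
    then have main: "p * (y (Suc n) - y 1) = g1 * S n + p * ((h2 - h3) * x 1)"
      using tel[of n] n_ge_3 by (simp add: algebra_simps)
    have "\<exists>v\<in>H X F. p * (y (Suc n) - y 1) = p * (g1 * v)"
    proof (cases "even n")
      case True
      then obtain \<tau> where \<tau>: "\<tau> \<in> H X F" "S n = p * \<tau>" using torsion[OF S, of n] pS[of n] by auto
      then have "p * (y (Suc n) - y 1) = p * (g1 * \<tau>)" using main True by (simp add: h3_def p_left_comm[of g1])
      then show ?thesis using \<tau> by blast
    next
      case False
      then have "p * S n = p * x 1" using pS[of n] by simp
      then obtain \<tau> where \<tau>: "\<tau> \<in> H X F" "S n = x 1 + p * \<tau>" using p_cancel[OF S x] by blast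
      define z where "z = y 2 - y 1 - h2 * x 1"
      have z: "z \<in> H X G" unfolding z_def by (intro H_diff y H_mult[OF h2(1) x])
      have "p * y 2 = g2 * x 1 + p * y 1" using step[of 1] n_ge_3 g12 by (simp add: numeral_2_eq_2)
      then have gx: "g1 * x 1 = p * z" unfolding h2(2) z_def by (simp add: algebra_simps)
      have "g1 * x 1 + p * (h * x 1) = (g1 + p * h) * x 1" by (simp add: distrib_right mult.assoc)
      also have "\<dots> = g1 * (t * (g1 * x 1))" unfolding gtg[symmetric] by (simp add: mult.assoc)
      also have "\<dots> = p * (g1 * (t * z))" unfolding gx by (simp add: p_left_comm[of t] p_left_comm[of g1])
      finally have "p * (y (Suc n) - y 1) = p * (g1 * (t * z + \<tau>))"
        using main False \<tau> by (simp add: h3_def p_left_comm[of g1] algebra_simps)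
      moreover have "t * z + \<tau> \<in> H X F" by (intro H_add H_mult[OF t z] \<tau>)
      ultimately show ?thesis by blast
    qed
    then obtain v where v: "v \<in> H X F" "p * (y (Suc n) - y 1) = p * (g1 * v)" by blast
    then show "\<exists>v\<in>H X F. \<exists>w\<in>H X G. y (Suc n) - y 1 = g 1 * v + p * w"
      using p_cancel[OF H_diff[OF y y] H_mult[OF g(1) v(1)] v(2)] g12 by auto
  qed
  moreover have "g (k + n) = g k" for k by (simp add: g_def)
  ultimately show ?thesis using g12 gH pg by blast
qed

text \<open>The identities of a deformation retraction onto a multiplication sequence, in the form in
  which they are applied to elements.\<close>

lemma sdr_assoc:
  assumes "sdr oa a (\<lambda>_. F) (\<lambda>_. p * e F) i q T"
  shows "a k * i k = p * i (Suc k)" "a k * (i k * x) = p * (i (Suc k) * x)" "q (Suc k) * a k = p * q k"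
   "q (Suc k) * (a k * x) = p * (q k * x)"
  and "x \<in> H X (oa (Suc k)) \<Longrightarrow> x = i (Suc k) * (q (Suc k) * x) + T (Suc k) * (a (Suc k) * x) + a k * (T k * x)"
  and "x \<in> H (oa (Suc k)) X \<Longrightarrow> x = x * i (Suc k) * q (Suc k) + x * T (Suc k) * a (Suc k) + x * a k * T k"
  and "x \<in> H X F \<Longrightarrow> q k * (i k * x) = x"
proof -
  note D = sdrD[OF assms]
  show 1: "a k * i k = p * i (Suc k)" by (simp add: D(8) p_left_comm[of "i _"] id_right[OF D(1)])
  show 2: "q (Suc k) * a k = p * q k" by (simp add: D(9) mult.assoc id_left[OF D(2)])
  show "a k * (i k * x) = p * (i (Suc k) * x)" "q (Suc k) * (a k * x) = p * (q k * x)"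
    using 1 2 by (metis mult.assoc)+
  show "x = i (Suc k) * (q (Suc k) * x) + T (Suc k) * (a (Suc k) * x) + a k * (T k * x)" if "x \<in> H X (oa (Suc k))"
    using id_left[OF that] unfolding D(10) by (simp add: algebra_simps)
  show "x = x * i (Suc k) * q (Suc k) + x * T (Suc k) * a (Suc k) + x * a k * T k" if "x \<in> H (oa (Suc k)) X"
    using id_right[OF that] unfolding D(10) by (simp add: algebra_simps)
  show "q k * (i k * x) = x" if "x \<in> H X F"
    using D(7)[of k] id_left[OF that] by (simp flip: mult.assoc)
qed

text \<open>Between the retracts, the component \<open>h1\<close> vanishes, so the homotopies
  \<open>T\<close> and \<open>S\<close> express \<open>h1\<close> as a boundary
  \<open>s 1 * a 1 + b 0 * s 0\<close>. The part of \<open>h2\<close> that is not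
  accounted for by \<open>s 1\<close> vanishes on the image of \<open>a 1\<close>; it
  factors through \<open>a 2\<close>, because the free modules are injective relative to
  exact sequences of free modules.\<close>

lemma nullhomotopic_extension:
  assumes A: "angle oa a" and B: "angle ob b"
    and SA: "sdr oa a (\<lambda>_. F) (\<lambda>_. p * e F) i q T" and SB: "sdr ob b (\<lambda>_. G) (\<lambda>_. p * e G) j r S"
    and h: "h1 \<in> H (oa 1) (ob 1)" "h2 \<in> H (oa 2) (ob 2)" "h2 * a 1 = b 1 * h1" and rhi: "r 1 * h1 * i 1 = 0"
  shows "\<exists>s. (\<forall>k. s k \<in> H (oa (Suc k)) (ob k) \<and> s (k + n) = s k) \<and>
    h1 = s 1 * a 1 + b 0 * s 0 \<and> h2 = s 2 * a 2 + b 1 * s 1"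
proof -
  note DA = sdrD[OF SA] and DB = sdrD[OF SB] and NA = nseqD[OF angleD(3)[OF A]] and NB = nseqD[OF angleD(3)[OF B]]
  have two: "Suc (Suc 0) = 2" "Suc 1 = 2" by simp_all
  note i = DA(1) and q = DA(2) and T = DA(3) and j = DB(1) and r = DB(2) and S = DB(3) and a = NA(3) and b = NB(3)
  have a': "a 1 \<in> H (oa 1) (oa 2)" "a 0 \<in> H (oa 0) (oa 1)" using a[of 1] a[of 0] two by simp_all
  have b': "b 1 \<in> H (ob 1) (ob 2)" "b 0 \<in> H (ob 0) (ob 1)" using b[of 1] b[of 0] two by simp_all
  have T': "T 1 \<in> H (oa 2) (oa 1)" "T 0 \<in> H (oa 1) (oa 0)" "T 2 \<in> H (oa 3) (oa 2)"
    using T[of 1] T[of 0] T[of 2] by (simp_all add: eval_nat_numeral)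
  have S': "S 1 \<in> H (ob 2) (ob 1)" "S 0 \<in> H (ob 1) (ob 0)"
    using S[of 1] S[of 0] by (simp_all add: eval_nat_numeral)
  have rb: "r 2 * (b 1 * x) = p * (r 1 * x)" for x using sdr_assoc(4)[OF SB, of 1] two by simp
  have "p * (r 1 * (h1 * a 0)) = r 2 * (b 1 * h1) * a 0" by (simp only: rb mult.assoc)
  also have "\<dots> = r 2 * h2 * (a (Suc 0) * a 0)" unfolding h(3)[symmetric] by (simp add: mult.assoc)
  finally have "p * (r 1 * h1 * a 0) = 0" using complexD(2)[OF angleD(1)[OF A], of 0] by (simp add: mult.assoc)
  then obtain u where u: "u \<in> H (oa 0) G" "r 1 * h1 * a 0 = p * u"
    using torsion[OF H_mult[OF H_mult[OF r[of 1] h(1)] a'(2)]] by blast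
  define s1 where "s1 = j 1 * r 1 * h1 * T 1 + S 1 * h2"
  define s0 where "s0 = S 0 * h1 + j 0 * u * T 0"
  have s1: "s1 \<in> H (oa 2) (ob 1)"
    unfolding s1_def by (intro H_add H_mult[OF S'(1) h(2)] H_mult[OF _ T'(1)] H_mult[OF _ h(1)] H_mult[OF j r])
  have s0: "s0 \<in> H (oa 1) (ob 0)"
    unfolding s0_def by (intro H_add H_mult[OF S'(2) h(1)] H_mult[OF _ T'(2)] H_mult[OF j u(1)])
  have e1: "h1 = j 1 * (r 1 * h1) + S 1 * (b 1 * h1) + b 0 * (S 0 * h1)"
    using sdr_assoc(5)[OF SB, of h1 "oa 1" 0] h(1) by simp
  have "r 1 * h1 \<in> H (oa (Suc 0)) G" using H_mult[OF r h(1)] by simp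
  then have "r 1 * h1 = r 1 * h1 * i 1 * q 1 + r 1 * h1 * T 1 * a 1 + r 1 * h1 * a 0 * T 0"
    using sdr_assoc(6)[OF SA, of "r 1 * h1" 0 G] by simp
  also have "\<dots> = r 1 * h1 * T 1 * a 1 + p * (u * T 0)"
    by (simp only: rhi u(2) mult.assoc[of p] mult_zero_left add_0_left)
  finally have e2: "r 1 * h1 = r 1 * h1 * T 1 * a 1 + p * (u * T 0)" .
  from e2 have "j 1 * (r 1 * h1) = j 1 * (r 1 * h1 * T 1 * a 1 + p * (u * T 0))" by (rule arg_cong)
  also have "\<dots> = j 1 * r 1 * h1 * T 1 * a 1 + b 0 * (j 0 * (u * T 0))"
    by (simp add: distrib_left sdr_assoc(2)[OF SB, of 0] p_left_comm[of "j _"] mult.assoc)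
  finally have e3: "j 1 * (r 1 * h1) = j 1 * r 1 * h1 * T 1 * a 1 + b 0 * (j 0 * (u * T 0))" .
  have "s1 * a 1 + b 0 * s0 =
      (j 1 * r 1 * h1 * T 1 * a 1 + b 0 * (j 0 * (u * T 0))) + S 1 * (b 1 * h1) + b 0 * (S 0 * h1)"
    unfolding h(3)[symmetric] s0_def s1_def by (simp add: algebra_simps)
  also have "\<dots> = h1" by (simp only: e3[symmetric] e1[symmetric])
  finally have H1: "h1 = s1 * a 1 + b 0 * s0" by simp
  define y where "y = h2 - b 1 * s1"
  have y: "y \<in> H (oa 2) (ob 2)" unfolding y_def by (intro H_diff h H_mult[OF b'(1) s1])
  have "y * a 1 = b 1 * (h1 - s1 * a 1)" by (simp add: y_def h(3)[simplified] algebra_simps)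
  also have "h1 - s1 * a 1 = b 0 * s0" using H1 by (simp add: algebra_simps)
  also have "b 1 * (b 0 * s0) = 0" using complex_zero_assoc[OF angleD(1)[OF B], of 0] by simp
  finally have ya: "y * a 1 = 0" .
  have "p * (y * i 2) = y * a 1 * i 1" using sdr_assoc(1)[OF SA, of 1] two by (simp add: mult.assoc p_left_comm[of y])
  then have "p * (y * i 2) = 0" using ya by simp
  then obtain w where w: "w \<in> H F (ob 2)" "y * i 2 = p * w" using torsion[OF H_mult[OF y i]] by blast
  have "y = y * i 2 * q 2 + y * T 2 * a 2 + y * a 1 * T 1"
    using sdr_assoc(6)[OF SA, of y 1] y two by simp
  also have "\<dots> = w * (p * q 2) + y * T 2 * a 2"
    by (simp only: ya w(2) mult_zero_left add_0_right p_left_comm[of w] mult.assoc[of p])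
  also have "p * q 2 = q 3 * a 2" using sdr_assoc(3)[OF SA, of 2] by (simp add: eval_nat_numeral)
  finally have "y = (w * q 3 + y * T 2) * a 2" by (simp add: distrib_right mult.assoc)
  then have H2: "h2 = (w * q 3 + y * T 2) * a 2 + b 1 * s1" by (simp add: y_def algebra_simps)
  define s where "s k = (if k mod n = 0 then s0 else if k mod n = 1 then s1
    else if k mod n = 2 then w * q 3 + y * T 2 else 0)" for k
  have s012: "s 0 = s0" "s 1 = s1" "s 2 = w * q 3 + y * T 2" using n_ge_3 by (auto simp: s_def)
  have "s k \<in> H (oa (Suc k)) (ob k)" for k
  proof -
    have s2: "w * q 3 + y * T 2 \<in> H (oa 3) (ob 2)" by (intro H_add H_mult[OF w(1) q] H_mult[OF y T'(3)])
    have "oa (Suc k) = oa (Suc (k mod n))" "ob k = ob (k mod n)"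
      using NA(1) NB(1) by (metis mod_Suc_eq periodic_cong mod_mod_trivial)+
    moreover have "0 \<in> H (oa (Suc k)) (ob k)" using H_zero NA(4) NB(4) by blast
    ultimately show ?thesis using s0 s1 s2 by (auto simp: s_def eval_nat_numeral)
  qed
  moreover have "s (k + n) = s k" for k by (simp add: s_def)
  ultimately show ?thesis using H1 H2 s012 by (intro exI[of _ s]) simp
qed

end

section \<open>Mapping cones\<close>

context periodic_sequences
begin

lemma alternating:
  assumes "\<And>k. 1 \<le> k \<Longrightarrow> k \<le> n \<Longrightarrow> p * x (Suc k) = - (p * x k)" "k \<le> n"
  shows "p * x (Suc k) = (if even k then p * x (Suc 0) else - (p * x (Suc 0)))"
  using assms(2)
proof (induction k)
  case (Suc k)
  then show ?case using assms(1)[of "Suc k"] by simp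
qed simp

text \<open>The first summand, with inclusion \<open>U\<close> and projection \<open>P\<close>, is the
  shifted source of \<open>f\<close>; the second one, with \<open>V\<close> and
  \<open>Q\<close>, is its target.\<close>

definition cone :: "(nat \<Rightarrow> 'e) \<Rightarrow> (nat \<Rightarrow> 'e) \<Rightarrow> (nat \<Rightarrow> 'e) \<Rightarrow> (nat \<Rightarrow> 'e) \<Rightarrow> (nat \<Rightarrow> 'e) \<Rightarrow>
    (nat \<Rightarrow> 'e) \<Rightarrow> (nat \<Rightarrow> 'e) \<Rightarrow> nat \<Rightarrow> 'e" where
  "cone a b f U V P Q k =
     U (Suc k) * (- a (Suc k) * P k) + (V (Suc k) * (f (Suc k) * P k) + V (Suc k) * (b k * Q k))"

text \<open>Exactness is the usual diagram chase. As to the monodromy, the homotopy \<open>s\<close> and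
  the retraction turn a chain in the cone of \<open>f\<close> into a chain in the cone of
  \<open>g\<close>, for which \<open>balanced\<close> provides a solution. Its lift along
  \<open>i\<close> and \<open>j\<close> solves the original problem up to terms that the
  homotopies \<open>T\<close> and \<open>S\<close> write as boundaries.\<close>

lemma cone_angle:
  assumes A: "angle oa a" and B: "angle ob b"
    and SA: "sdr oa a (\<lambda>_. F) (\<lambda>_. p * e F) i q T" and SB: "sdr ob b (\<lambda>_. G) (\<lambda>_. p * e G) j r S"
    and qT: "\<And>k. q k * T k = 0"
    and f: "\<And>k. f k \<in> H (oa k) (ob k)" "\<And>k. f (k + n) = f k" "\<And>k. f (Suc k) * a k = b k * f k"
    and fd: "\<And>k. f (Suc k) = j (Suc k) * g (Suc k) * q (Suc k) + (s (Suc k) * a (Suc k) + b k * s k)"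
    and s: "\<And>k. s k \<in> H (oa (Suc k)) (ob k)" "\<And>k. s (k + n) = s k"
    and g: "\<And>k. g k \<in> H F G" and bal: "balanced F G g"
    and bip: "\<And>k. bip (od k) (oa (Suc k)) (ob k) (U k) (V k) (P k) (Q k)"
    and per: "\<And>k. od (k + n) = od k" "\<And>k. U (k + n) = U k" "\<And>k. V (k + n) = V k"
      "\<And>k. P (k + n) = P k" "\<And>k. Q (k + n) = Q k"
  shows "angle od (cone a b f U V P Q)"
proof -
  note DA = sdrD[OF SA] and DB = sdrD[OF SB] and NA = nseqD[OF angleD(3)[OF A]] and NB = nseqD[OF angleD(3)[OF B]]
  note i = DA(1) and q = DA(2) and T = DA(3) and j = DB(1) and r = DB(2) and S = DB(3) and a = NA(3) and b = NB(3)
  note ra = sdr_assoc[OF SA] and rb = sdr_assoc[OF SB]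
  note bD = bipD[OF bip]
  note U = bD(1) and V = bD(2) and P = bD(3) and Q = bD(4)
  define \<delta> where "\<delta> = cone a b f U V P Q"
  have \<delta>_eq: "\<delta> k = U (Suc k) * (- a (Suc k) * P k) + (V (Suc k) * (f (Suc k) * P k) + V (Suc k) * (b k * Q k))" for k
    by (simp add: \<delta>_def cone_def)
  have \<delta>: "\<delta> k \<in> H (od k) (od (Suc k))" for k
    unfolding \<delta>_eq
    by (intro H_add H_mult[OF U] H_mult[OF V] H_mult[OF H_uminus[OF a] P] H_mult[OF f(1) P] H_mult[OF b Q])
  have PU: "P k * (U k * x) = x" if "x \<in> H X (oa (Suc k))" for x X k
    using id_left[OF that] bD(5)[of k] by (simp flip: mult.assoc)
  have QV: "Q k * (V k * x) = x" if "x \<in> H X (ob k)" for x X k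
    using id_left[OF that] bD(6)[of k] by (simp flip: mult.assoc)
  have QU: "Q k * (U k * x) = 0" and PV: "P k * (V k * x) = 0" for k x
    using bD(7,8)[of k] by (simp_all flip: mult.assoc)
  have eq: "x = y" if "x \<in> H X (od k)" "y \<in> H X (od k)" "P k * x = P k * y" "Q k * x = Q k * y" for x y X k
  proof -
    have "z = U k * (P k * z) + V k * (Q k * z)" if "z \<in> H X (od k)" for z
      using id_left[OF that] bD(9)[of k, symmetric] by (simp add: distrib_right mult.assoc)
    from this[OF that(1)] this[OF that(2)] show ?thesis using that(3,4) by simp
  qed
  have P\<delta>: "P (Suc k) * (\<delta> k * z) = - (a (Suc k) * (P k * z))"
    and Q\<delta>: "Q (Suc k) * (\<delta> k * z) = f (Suc k) * (P k * z) + b k * (Q k * z)"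
    if "z \<in> H X (od k)" for k z X
  proof -
    have m: "a (Suc k) * (P k * z) \<in> H X (oa (Suc (Suc k)))" "f (Suc k) * (P k * z) \<in> H X (ob (Suc k))"
      "b k * (Q k * z) \<in> H X (ob (Suc k))"
      using H_mult[OF a H_mult[OF P that]] H_mult[OF f(1) H_mult[OF P that]] H_mult[OF b H_mult[OF Q that]] .
    show "P (Suc k) * (\<delta> k * z) = - (a (Suc k) * (P k * z))"
      "Q (Suc k) * (\<delta> k * z) = f (Suc k) * (P k * z) + b k * (Q k * z)"
      by (simp_all add: \<delta>_eq algebra_simps PU[OF m(1)] QU PV QV[OF m(2)] QV[OF m(3)])
  qed
  have N: "nseq od \<delta>"
    using \<delta> per NA(1,2)[of "Suc _"] NB(2) f(2)[of "Suc _"] per(1-3)[of "Suc _"] by (simp add: nseq_def \<delta>_eq)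
  have cx: "complex od \<delta>"
    unfolding complex_def
  proof (intro conjI N allI)
    fix k
    have E: "e (od k) \<in> H (od k) (od k)" using H_id nseqD(4)[OF N] by blast
    have d1: "\<delta> k \<in> H (od k) (od (Suc k))" by (rule \<delta>)
    have P1: "P (Suc k) * \<delta> k = - (a (Suc k) * P k)" and Q1: "Q (Suc k) * \<delta> k = f (Suc k) * P k + b k * Q k"
      using P\<delta>[OF E] Q\<delta>[OF E] by (simp_all add: id_right[OF \<delta>] id_right[OF P] id_right[OF Q])
    show "\<delta> (Suc k) * \<delta> k = 0"
    proof (rule eq[OF H_mult[OF \<delta> \<delta>] H_zero[OF nseqD(4)[OF N] nseqD(4)[OF N]]])
      show "P (Suc (Suc k)) * (\<delta> (Suc k) * \<delta> k) = P (Suc (Suc k)) * 0"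
        unfolding P\<delta>[OF d1] P1 using complex_zero_assoc[OF angleD(1)[OF A]] by simp
      have "f (Suc (Suc k)) * (a (Suc k) * P k) = b (Suc k) * (f (Suc k) * P k)"
        using f(3)[of "Suc k"] by (simp flip: mult.assoc)
      then show "Q (Suc (Suc k)) * (\<delta> (Suc k) * \<delta> k) = Q (Suc (Suc k)) * 0"
        unfolding Q\<delta>[OF d1] P1 Q1 using complex_zero_assoc[OF angleD(1)[OF B]] by (simp add: distrib_left)
    qed
  qed
  have ex: "exact od \<delta>"
    unfolding exact_def
  proof (intro allI ballI impI)
    fix k X z assume z: "z \<in> H X (od (Suc k))" and 0: "\<delta> (Suc k) * z = 0"
    have "a (Suc (Suc k)) * (P (Suc k) * z) = 0" using P\<delta>[OF z] 0 by simp
    then obtain x where x: "x \<in> H X (oa (Suc k))" "P (Suc k) * z = a (Suc k) * x"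
      using exactD[OF angleD(2)[OF A] H_mult[OF P z]] by blast
    have "f (Suc (Suc k)) * (P (Suc k) * z) + b (Suc k) * (Q (Suc k) * z) = 0" using Q\<delta>[OF z] 0 by simp
    moreover have "f (Suc (Suc k)) * (P (Suc k) * z) = b (Suc k) * (f (Suc k) * x)"
      unfolding x(2) using f(3)[of "Suc k"] by (simp flip: mult.assoc)
    ultimately have "b (Suc k) * (f (Suc k) * x + Q (Suc k) * z) = 0" by (simp add: distrib_left)
    then obtain y where y: "y \<in> H X (ob k)" "f (Suc k) * x + Q (Suc k) * z = b k * y"
      using exactD[OF angleD(2)[OF B] H_add[OF H_mult[OF f(1) x(1)] H_mult[OF Q z]]] by blast
    define w where "w = V k * y - U k * x"
    have w: "w \<in> H X (od k)" unfolding w_def by (intro H_diff H_mult[OF V] H_mult[OF U] x y)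
    have Pw: "P k * w = - x" "Q k * w = y"
      by (simp_all add: w_def right_diff_distrib PU[OF x(1)] PV QU QV[OF y(1)])
    have "z = \<delta> k * w"
    proof (rule eq[OF z H_mult[OF \<delta> w]])
      show "P (Suc k) * z = P (Suc k) * (\<delta> k * w)" unfolding P\<delta>[OF w] Pw x(2) by simp
      have "Q (Suc k) * z = b k * y - f (Suc k) * x" using y(2) by (simp add: algebra_simps)
      then show "Q (Suc k) * z = Q (Suc k) * (\<delta> k * w)" unfolding Q\<delta>[OF w] Pw by simp
    qed
    then show "\<exists>y\<in>H X (od k). z = \<delta> k * y" using w by blast
  qed
  have "trivial_monodromy od \<delta>"
    unfolding trivial_monodromy_def
  proof (intro allI impI, elim conjE)
    fix X z assume z': "\<forall>k. z k \<in> H X (od k)" and ch: "\<forall>k\<in>{1..n}. \<delta> k * z k = p * z (Suc k)"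
    have z: "z k \<in> H X (od k)" for k using z' by blast
    have per1: "oa (Suc (Suc n)) = oa (Suc (Suc 0))" "ob (Suc n) = ob (Suc 0)" "od (Suc n) = od (Suc 0)"
      "ob (Suc (Suc n)) = ob (Suc (Suc 0))"  "oa (Suc (Suc (Suc n))) = oa (Suc (Suc (Suc 0)))"
      "a (Suc (Suc n)) = a (Suc (Suc 0))" "b (Suc n) = b (Suc 0)" "f (Suc (Suc n)) = f (Suc (Suc 0))"
      "P (Suc n) = P (Suc 0)" "Q (Suc n) = Q (Suc 0)"
      "s (Suc n) = s (Suc 0)" "s (Suc (Suc n)) = s (Suc (Suc 0))"
      "q (Suc (Suc n)) = q (Suc (Suc 0))" "r (Suc n) = r (Suc 0)"
      using NA(1,2)[of "Suc (Suc 0)"] NA(1,2)[of "Suc 0"] NB(1,2)[of "Suc 0"] NB(1)[of "Suc (Suc 0)"] per[of "Suc 0"]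
        f(2)[of "Suc (Suc 0)"] s(2)[of "Suc 0"] s(2)[of "Suc (Suc 0)"] DA(5)[of "Suc (Suc 0)"] DB(5)[of "Suc 0"]
        NA(1)[of "Suc (Suc (Suc 0))"]
      by simp_all
    have ch': "\<delta> k * z k = p * z (Suc k)" if "1 \<le> k" "k \<le> n" for k using ch that by simp
    have "\<delta> n * z n = p * z (Suc n)" using ch'[of n] n_ge_3 by simp
    from divisible_next[OF cx z this]
    obtain z2 where z2: "z2 \<in> H X (od (Suc (Suc n)))" "\<delta> (Suc n) * z (Suc n) = p * z2" by blast
    define x where "x k = P k * z k" for k
    define y where "y k = Q k * z k" for k
    have x: "x k \<in> H X (oa (Suc k))" and y: "y k \<in> H X (ob k)" for k
      using H_mult[OF P z] H_mult[OF Q z] by (simp_all add: x_def y_def)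
    define x2 where "x2 = P (Suc (Suc n)) * z2"
    define y2 where "y2 = Q (Suc (Suc n)) * z2"
    have x2: "x2 \<in> H X (oa (Suc (Suc (Suc 0))))" and y2: "y2 \<in> H X (ob (Suc (Suc 0)))"
      using H_mult[OF P z2(1)] H_mult[OF Q z2(1)] by (simp_all add: x2_def y2_def per1)
    have ax: "a (Suc k) * x k = - (p * x (Suc k))" and fx: "f (Suc k) * x k + b k * y k = p * y (Suc k)"
      if "1 \<le> k" "k \<le> n" for k
      using P\<delta>[OF z, of k] Q\<delta>[OF z, of k]
      by (simp_all add: ch'[OF that] x_def y_def p_left_comm[of "P _"] p_left_comm[of "Q _"])
    have ax2: "a (Suc (Suc 0)) * x (Suc n) = - (p * x2)"
      and fx2: "f (Suc (Suc 0)) * x (Suc n) + b (Suc 0) * y (Suc n) = p * y2"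
      using P\<delta>[OF z, of "Suc n"] Q\<delta>[OF z, of "Suc n"]
      by (simp_all add: z2(2) x_def y_def x2_def y2_def p_left_comm[of "P _"] p_left_comm[of "Q _"] per1)
    \<comment> \<open>The homotopy \<open>s\<close> straightens the cone of \<open>f\<close> to the cone of \<open>j g q\<close>.\<close>
    have straight: "j (Suc k) * (g (Suc k) * (q (Suc k) * x0)) + b k * (y0 + s k * x0) = p * (y1 + s (Suc k) * x1)"
      if "a (Suc k) * x0 = - (p * x1)" "f (Suc k) * x0 + b k * y0 = p * y1" for k x0 y0 x1 y1
    proof -
      have "s (Suc k) * (a (Suc k) * x0) = - (p * (s (Suc k) * x1))"
        unfolding that(1) by (simp add: p_left_comm[of "s _"])
      then show ?thesis using that(2) unfolding fd by (simp add: algebra_simps)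
    qed
    define t where "t k = y k + s k * x k" for k
    have t: "t k \<in> H X (ob k)" for k unfolding t_def by (intro H_add y H_mult[OF s(1) x])
    define t2 where "t2 = y2 + s (Suc (Suc 0)) * x2"
    have t2: "t2 \<in> H X (ob (Suc (Suc 0)))" unfolding t2_def by (intro H_add y2 H_mult[OF s(1) x2])
    have tk: "j (Suc k) * (g (Suc k) * (q (Suc k) * x k)) + b k * t k = p * t (Suc k)" if "1 \<le> k" "k \<le> n" for k
      using straight[OF ax[OF that] fx[OF that]] by (simp add: t_def)
    have bt2: "j (Suc (Suc 0)) * (g (Suc (Suc 0)) * (q (Suc (Suc 0)) * x (Suc n))) + b (Suc 0) * t (Suc n) = p * t2"
      using straight[OF ax2 fx2] by (simp add: t_def t2_def per1)
    define x' where "x' k = q (Suc k) * x k" for k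
    define y' where "y' k = r k * t k" for k
    have x': "x' k \<in> H X F" and y': "y' k \<in> H X G" for k
      using H_mult[OF q x] H_mult[OF r t] by (simp_all add: x'_def y'_def)
    have alt: "p * x' (Suc k) = - (p * x' k)" if "1 \<le> k" "k \<le> n" for k
    proof -
      have "p * x' (Suc k) = q (Suc (Suc k)) * (p * x (Suc k))" by (simp add: x'_def p_left_comm[of "q _"])
      also have "p * x (Suc k) = - (a (Suc k) * x k)" using ax[OF that] by simp
      finally show ?thesis by (simp add: ra(4) x'_def)
    qed
    have bal': "g (Suc k) * x' k + p * y' k = p * y' (Suc k)" if "1 \<le> k" "k \<le> n" for k
    proof -
      have "p * y' (Suc k) = r (Suc k) * (p * t (Suc k))" by (simp add: y'_def p_left_comm[of "r _"])
      also have "\<dots> = r (Suc k) * (j (Suc k) * (g (Suc k) * x' k)) + r (Suc k) * (b k * t k)"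
        unfolding tk[OF that, symmetric] x'_def by (simp add: distrib_left)
      finally show ?thesis by (simp add: rb(4) rb(7)[OF H_mult[OF g x']] y'_def)
    qed
    obtain v' w' where v': "v' \<in> H X F" and w': "w' \<in> H X G"
      and yv: "y' (Suc n) - y' (Suc 0) = g (Suc 0) * v' + p * w'"
      using bal x' y' alt bal' unfolding balanced_def by (metis One_nat_def atLeastAtMost_iff)
    define \<xi> where "\<xi> = x (Suc n) - x (Suc 0)"
    have x1: "x (Suc n) \<in> H X (oa (Suc (Suc 0)))" using x[of "Suc n"] by (simp add: per1)
    have \<xi>: "\<xi> \<in> H X (oa (Suc (Suc 0)))" unfolding \<xi>_def by (intro H_diff x x1)
    have "p * x' (Suc n) = p * x' (Suc 0)"
      using alternating[of x' n, OF alt] p_neg[OF _ x', of "Suc 0"] by (auto split: if_splits)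
    then have "p * (q (Suc (Suc 0)) * \<xi>) = 0" by (simp add: \<xi>_def x'_def right_diff_distrib per1)
    then obtain u' where u': "u' \<in> H X F" "q (Suc (Suc 0)) * \<xi> = p * u'" using torsion[OF H_mult[OF q \<xi>]] by blast
    have "a (Suc (Suc 0)) * x (Suc 0) = - (p * x (Suc (Suc 0)))" using ax[of "Suc 0"] n_ge_3 by simp
    then have a\<xi>: "a (Suc (Suc 0)) * \<xi> = p * (x (Suc (Suc 0)) - x2)"
      using ax2 by (simp add: \<xi>_def right_diff_distrib)
    define v where "v = i (Suc 0) * v' - T (Suc 0) * \<xi>"
    have v: "v \<in> H X (oa (Suc 0))" unfolding v_def by (intro H_diff H_mult[OF i v'] H_mult[OF T \<xi>])
    have qv: "q (Suc 0) * v = v'"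
    proof -
      have "q (Suc 0) * (T (Suc 0) * \<xi>) = 0" using qT[of "Suc 0"] by (simp flip: mult.assoc)
      then show ?thesis by (simp add: v_def right_diff_distrib ra(7)[OF v'])
    qed
    define u where "u = i (Suc (Suc 0)) * u' + T (Suc (Suc 0)) * (x (Suc (Suc 0)) - x2) + i (Suc (Suc 0)) * v'"
    have u: "u \<in> H X (oa (Suc (Suc 0)))"
      unfolding u_def by (intro H_add H_mult[OF i] H_mult[OF T] H_diff u' v' x x2)
    have "\<xi> = i (Suc (Suc 0)) * (p * u') + T (Suc (Suc 0)) * (p * (x (Suc (Suc 0)) - x2)) + a (Suc 0) * (T (Suc 0) * \<xi>)"
      using ra(5)[OF \<xi>] unfolding u'(2) a\<xi> .
    also have "\<dots> = p * u - a (Suc 0) * v"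
      by (simp add: u_def v_def distrib_left right_diff_distrib p_left_comm[of "i _"] p_left_comm[of "T _"] ra(2))
    finally have \<xi>_eq: "\<xi> = p * u - a (Suc 0) * v" .
    define Y where "Y = t (Suc n) - t (Suc 0) - j (Suc 0) * (g (Suc 0) * v')"
    have t1: "t (Suc n) \<in> H X (ob (Suc 0))" using t[of "Suc n"] by (simp add: per1)
    have Y: "Y \<in> H X (ob (Suc 0))" unfolding Y_def by (intro H_diff t t1 H_mult[OF j] H_mult[OF g v'])
    have rY: "r (Suc 0) * Y = p * w'"
      using yv by (simp add: Y_def right_diff_distrib rb(7)[OF H_mult[OF g v']] y'_def per1)
    define R where "R = t2 - t (Suc (Suc 0)) - j (Suc (Suc 0)) * (g (Suc 0) * v') - j (Suc (Suc 0)) * (g (Suc (Suc 0)) * u')"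
    have R: "R \<in> H X (ob (Suc (Suc 0)))"
      unfolding R_def by (intro H_diff t t2 H_mult[OF j] H_mult[OF g] v' u')
    have bY: "b (Suc 0) * Y = p * R"
    proof -
      have 1: "b (Suc 0) * t (Suc n) = p * t2 - j (Suc (Suc 0)) * (g (Suc (Suc 0)) * (q (Suc (Suc 0)) * x (Suc n)))"
        using bt2 by (simp add: algebra_simps)
      have 2: "b (Suc 0) * t (Suc 0) = p * t (Suc (Suc 0)) - j (Suc (Suc 0)) * (g (Suc (Suc 0)) * (q (Suc (Suc 0)) * x (Suc 0)))"
        using tk[of "Suc 0"] n_ge_3 by (simp add: algebra_simps)
      have 3: "b (Suc 0) * (j (Suc 0) * (g (Suc 0) * v')) = p * (j (Suc (Suc 0)) * (g (Suc 0) * v'))" by (rule rb(2))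
      have "b (Suc 0) * Y = p * t2 - p * t (Suc (Suc 0)) - p * (j (Suc (Suc 0)) * (g (Suc 0) * v'))
          - j (Suc (Suc 0)) * (g (Suc (Suc 0)) * (q (Suc (Suc 0)) * \<xi>))"
        unfolding Y_def right_diff_distrib 1 2 3 \<xi>_def by (simp add: algebra_simps)
      also have "\<dots> = p * R"
        unfolding u'(2) R_def by (simp add: right_diff_distrib p_left_comm[of "g _"] p_left_comm[of "j _"])
      finally show ?thesis .
    qed
    have Y_eq: "Y = p * (j (Suc 0) * w' + S (Suc 0) * R) + b 0 * (S 0 * Y)"
    proof -
      have "Y = j (Suc 0) * (p * w') + S (Suc 0) * (p * R) + b 0 * (S 0 * Y)"
        using rb(5)[OF Y] unfolding rY bY .
      then show ?thesis by (simp add: distrib_left p_left_comm[of "j _"] p_left_comm[of "S _"])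
    qed
    define w where "w = S 0 * Y - s 0 * v"
    have w: "w \<in> H X (ob 0)" unfolding w_def by (intro H_diff H_mult[OF S Y] H_mult[OF s(1) v])
    define c where "c = j (Suc 0) * w' + S (Suc 0) * R - s (Suc 0) * u"
    have c: "c \<in> H X (ob (Suc 0))"
      unfolding c_def by (intro H_add H_diff H_mult[OF j w'] H_mult[OF S R] H_mult[OF s(1) u])
    have y_eq: "y (Suc n) - y (Suc 0) = p * c + (f (Suc 0) * v + b 0 * w)"
    proof -
      have "y (Suc n) - y (Suc 0) = Y + j (Suc 0) * (g (Suc 0) * v') - s (Suc 0) * \<xi>"
        by (simp add: Y_def t_def \<xi>_def per1 algebra_simps)
      also have "\<dots> = p * (j (Suc 0) * w' + S (Suc 0) * R) + b 0 * (S 0 * Y) + j (Suc 0) * (g (Suc 0) * v') - s (Suc 0) * (p * u - a (Suc 0) * v)"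
        using Y_eq \<xi>_eq by simp
      also have "\<dots> = p * c + (f (Suc 0) * v + b 0 * w)"
        unfolding fd by (simp add: c_def w_def algebra_simps p_left_comm[of "s _"] qv)
      finally show ?thesis .
    qed
    define zu where "zu = U (Suc 0) * u + V (Suc 0) * c"
    define zv where "zv = U 0 * v + V 0 * w"
    have zu: "zu \<in> H X (od (Suc 0))" unfolding zu_def by (intro H_add H_mult[OF U u] H_mult[OF V c])
    have zv: "zv \<in> H X (od 0)" unfolding zv_def by (intro H_add H_mult[OF U v] H_mult[OF V w])
    have Pz: "P (Suc 0) * zu = u" "Q (Suc 0) * zu = c" "P 0 * zv = v" "Q 0 * zv = w"
      by (simp_all add: zu_def zv_def distrib_left PU[OF u] PU[OF v] QV[OF c] QV[OF w] PV QU)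
    have z1: "z (Suc n) \<in> H X (od (Suc 0))" using z[of "Suc n"] by (simp add: per1)
    have "z (Suc n) - z (Suc 0) = p * zu + \<delta> 0 * zv"
    proof (rule eq[OF H_diff[OF z1 z] H_add[OF H_p[OF zu] H_mult[OF \<delta> zv]]])
      show "P (Suc 0) * (z (Suc n) - z (Suc 0)) = P (Suc 0) * (p * zu + \<delta> 0 * zv)"
        using \<xi>_eq by (simp add: distrib_left right_diff_distrib P\<delta>[OF zv] Pz p_left_comm[of "P _"] \<xi>_def x_def per1)
      show "Q (Suc 0) * (z (Suc n) - z (Suc 0)) = Q (Suc 0) * (p * zu + \<delta> 0 * zv)"
        using y_eq by (simp add: distrib_left right_diff_distrib Q\<delta>[OF zv] Pz p_left_comm[of "Q _"] y_def per1)
    qed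
    then show "\<exists>u\<in>H X (od 1). \<exists>v\<in>H X (od 0). z (Suc n) - z 1 = p * u + \<delta> 0 * v"
      using zu zv by auto
  qed
  then show ?thesis using cx ex by (simp add: angle_def \<delta>_def)
qed

text \<open>On the retracts, \<open>f1\<close> and \<open>f2\<close> induce two components that agree
  modulo \<open>p\<close>. These extend to a balanced morphism \<open>g\<close>. The
  difference between \<open>f1\<close>, \<open>f2\<close> and the first two components of
  $jgq$ vanishes on the retracts and extends to a nullhomotopic morphism.\<close>

theorem extension_with_cone:
  assumes A: "angle oa a" and B: "angle ob b"
    and f: "f1 \<in> H (oa 1) (ob 1)" "f2 \<in> H (oa 2) (ob 2)" "f2 * a 1 = b 1 * f1"
  shows "\<exists>f. f 1 = f1 \<and> f 2 = f2 \<and>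
    (\<forall>k. f k \<in> H (oa k) (ob k) \<and> f (k + n) = f k \<and> f (Suc k) * a k = b k * f k) \<and>
    (\<forall>od U V P Q. (\<forall>k. bip (od k) (oa (Suc k)) (ob k) (U k) (V k) (P k) (Q k) \<and> od (k + n) = od k \<and>
       U (k + n) = U k \<and> V (k + n) = V k \<and> P (k + n) = P k \<and> Q (k + n) = Q k) \<longrightarrow>
       angle od (cone a b f U V P Q))"
proof -
  obtain F i q T where SA: "sdr oa a (\<lambda>_. F) (\<lambda>_. p * e F) i q T" and qT: "\<And>k. q k * T k = 0"
    using angle_sdr_multiplication[OF A] by blast
  obtain G j r S where SB: "sdr ob b (\<lambda>_. G) (\<lambda>_. p * e G) j r S"
    using angle_sdr_multiplication[OF B] by blast
  note DA = sdrD[OF SA] and DB = sdrD[OF SB] and NA = nseqD[OF angleD(3)[OF A]] and NB = nseqD[OF angleD(3)[OF B]]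
  note ra = sdr_assoc[OF SA] and rb = sdr_assoc[OF SB]
  have two: "Suc (Suc 0) = 2" by simp
  have a1: "a 1 \<in> H (oa 1) (oa 2)" and b1: "b 1 \<in> H (ob 1) (ob 2)"
    using NA(3)[of 1] NB(3)[of 1] two by simp_all
  have "p * (r 2 * f2 * i 2) = r 2 * f2 * (a 1 * i 1)"
    using ra(1)[of 1] two by (simp add: p_left_comm[of f2] p_left_comm[of "r _"] mult.assoc)
  also have "\<dots> = r 2 * (b 1 * f1) * i 1" unfolding f(3)[symmetric] by (simp add: mult.assoc)
  also have "\<dots> = p * (r 1 * f1 * i 1)" using rb(4)[of 1] two by (simp add: mult.assoc)
  finally have "p * (r 2 * f2 * i 2) = p * (r 1 * f1 * i 1)" .
  from ex_balanced[OF H_mult[OF H_mult[OF DB(2) f(1)] DA(1)] H_mult[OF H_mult[OF DB(2) f(2)] DA(1)] this]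
  obtain g where g: "g 1 = r 1 * f1 * i 1" "\<And>k. g k \<in> H F G" "\<And>k. g (k + n) = g k"
    "\<And>k. p * g k = p * (r 1 * f1 * i 1)" and bal: "balanced F G g" by blast
  define \<phi> where "\<phi> k = j k * g k * q k" for k
  have \<phi>: "\<phi> k \<in> H (oa k) (ob k)" for k unfolding \<phi>_def by (intro H_mult[OF H_mult[OF DB(1) g(2)] DA(2)])
  have \<phi>c: "\<phi> (Suc k) * a k = b k * \<phi> k" for k
  proof -
    have "\<phi> (Suc k) * a k = j (Suc k) * (p * g (Suc k)) * q k"
      by (simp add: \<phi>_def ra(3) p_left_comm[of "g _"] mult.assoc)
    also have "p * g (Suc k) = p * g k" by (simp only: g(4))
    also have "j (Suc k) * (p * g k) * q k = b k * \<phi> k"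
      by (simp add: \<phi>_def rb(2) p_left_comm[of "j _"] mult.assoc)
    finally show ?thesis .
  qed
  have "r 1 * (f1 - \<phi> 1) * i 1 = 0"
  proof -
    have "r 1 * \<phi> 1 * i 1 = (r 1 * j 1) * g 1 * (q 1 * i 1)" by (simp add: \<phi>_def mult.assoc)
    then have "r 1 * \<phi> 1 * i 1 = g 1" unfolding DA(7) DB(7) by (simp only: id_left[OF g(2)] id_right[OF g(2)])
    then show ?thesis using g(1) by (simp add: right_diff_distrib left_diff_distrib mult.assoc)
  qed
  moreover have "(f2 - \<phi> 2) * a 1 = b 1 * (f1 - \<phi> 1)"
    using f(3) \<phi>c[of 1] two by (simp add: left_diff_distrib right_diff_distrib)
  ultimately obtain s where s: "\<And>k. s k \<in> H (oa (Suc k)) (ob k)" "\<And>k. s (k + n) = s k"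
    and s1: "f1 - \<phi> 1 = s 1 * a 1 + b 0 * s 0" and s2: "f2 - \<phi> 2 = s 2 * a 2 + b 1 * s 1"
    using nullhomotopic_extension[OF A B SA SB H_diff[OF f(1) \<phi>] H_diff[OF f(2) \<phi>]] by blast
  \<comment> \<open>Index \<open>k + (n - 1)\<close> stands for \<open>k - 1\<close>.\<close>
  define f where "f k = \<phi> k + (s k * a k + b (k + (n - 1)) * s (k + (n - 1)))" for k
  have bs: "b (Suc k + (n - 1)) * s (Suc k + (n - 1)) = b k * s k" for k
    using NB(2)[of k] s(2)[of k] n_ge_3 by simp
  have fS: "f (Suc k) = \<phi> (Suc k) + (s (Suc k) * a (Suc k) + b k * s k)" for k
    unfolding f_def bs ..
  have fS': "f k = \<phi> k + (s k * a k + b l * s l)" if "k = Suc l" for k l using fS that by simp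
  have "f 1 = f1" "f 2 = f2"
    using fS'[of 1 0] fS'[of 2 1] s1[symmetric] s2[symmetric] by (simp_all add: numeral_2_eq_2)
  moreover have fH: "f k \<in> H (oa k) (ob k)" for k
  proof -
    have "s (k + (n - 1)) \<in> H (oa k) (ob (k + (n - 1)))" "b (k + (n - 1)) \<in> H (ob (k + (n - 1))) (ob k)"
      using s(1)[of "k + (n - 1)"] NB(3)[of "k + (n - 1)"] NA(1)[of k] NB(1)[of k] n_ge_3 by simp_all
    then show ?thesis unfolding f_def by (intro H_add \<phi> H_mult[OF s(1) NA(3)] H_mult)
  qed
  moreover have fper: "f (k + n) = f k" for k
  proof -
    have "b (k + n + (n - 1)) = b (k + (n - 1))" "s (k + n + (n - 1)) = s (k + (n - 1))"
      using NB(2)[of "k + (n - 1)"] s(2)[of "k + (n - 1)"] by (simp_all add: ac_simps)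
    then show ?thesis using NA(2) s(2) g(3) DA(5) DB(4) by (simp add: f_def \<phi>_def)
  qed
  moreover have fc: "f (Suc k) * a k = b k * f k" for k
  proof -
    have "b k * (b (k + (n - 1)) * x) = 0" for x
      using complex_zero_assoc[OF angleD(1)[OF B], of "k + (n - 1)"] NB(2)[of k] n_ge_3 by simp
    then show ?thesis unfolding fS
      using \<phi>c[of k] complexD(2)[OF angleD(1)[OF A]] by (simp add: f_def algebra_simps)
  qed
  moreover have "f (Suc k) = j (Suc k) * g (Suc k) * q (Suc k) + (s (Suc k) * a (Suc k) + b k * s k)" for k
    using fS by (simp add: \<phi>_def)
  note cone = cone_angle[OF A B SA SB qT fH fper fc this s g(2) bal]
  ultimately show ?thesis by (intro exI[of _ f]) (auto intro!: cone)
qed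

end

section \<open>Decomposition of angles and first morphisms\<close>

context periodic_sequences
begin

text \<open>The retract has a complement in every degree. The differential respects this splitting, and
  the homotopy compressed to the complements contracts them.\<close>

theorem angle_decomposition:
  assumes A: "angle oa a"
  shows "\<exists>F K \<kappa> L u i r q. F \<in> Ob \<and> complex K \<kappa> \<and> (\<forall>k.
    bip (oa k) (K k) F (u k) (i k) (r k) (q k) \<and>
    u (k + n) = u k \<and> i (k + n) = i k \<and> r (k + n) = r k \<and> q (k + n) = q k \<and> L (k + n) = L k \<and>
    L k \<in> H (K (Suc k)) (K k) \<and> e (K (Suc k)) = L (Suc k) * \<kappa> (Suc k) + \<kappa> k * L k \<and>
    a k = u (Suc k) * (\<kappa> k * r k) + i (Suc k) * (p * e F * q k))"
proof -
  obtain F i q T where F: "F \<in> Ob" and SA: "sdr oa a (\<lambda>_. F) (\<lambda>_. p * e F) i q T"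
    using angle_sdr_multiplication[OF A] by blast
  note D = sdrD[OF SA] and N = nseqD[OF angleD(3)[OF A]] and ra = sdr_assoc[OF SA]
  have "\<exists>K u r. bip (oa k) K F u (i k) r (q k)" for k
    using complement[OF D(1,2,7)] by blast
  then obtain K0 u0 r0 where bip0: "\<And>k. bip (oa k) (K0 k) F (u0 k) (i k) (r0 k) (q k)" by metis
  define K where "K k = K0 (k mod n)" for k
  define u where "u k = u0 (k mod n)" for k
  define r where "r k = r0 (k mod n)" for k
  have bip: "bip (oa k) (K k) F (u k) (i k) (r k) (q k)" for k
    using bip0[of "k mod n"] periodic_mod[of oa, OF N(1)] periodic_mod[of i, OF D(4)] periodic_mod[of q, OF D(5)]
    by (simp add: K_def u_def r_def)
  have per: "K (k + n) = K k" "u (k + n) = u k" "r (k + n) = r k" for k by (simp_all add: K_def u_def r_def)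
  note b = bipD[OF bip]
  define \<kappa> where "\<kappa> k = r (Suc k) * a k * u k" for k
  define L where "L k = r k * T k * u (Suc k)" for k
  have qa: "q (Suc k) * (a k * (u k * x)) = 0" for k x
  proof -
    have "q k * (u k * x) = 0" using b(7)[of k] by (simp flip: mult.assoc)
    then show ?thesis by (simp add: ra(4))
  qed
  have rai: "r (Suc k) * (a k * (i k * x)) = 0" for k x
  proof -
    have "r (Suc k) * (i (Suc k) * x) = 0" using b(8)[of "Suc k"] by (simp flip: mult.assoc)
    then show ?thesis by (simp add: ra(2) p_left_comm[of "r _"])
  qed
  have ur: "x = u k * (r k * x) + i k * (q k * x)" if "x \<in> H X (oa k)" for x X k
    using id_left[OF that] b(9)[of k, symmetric] by (simp add: distrib_right mult.assoc)
  have au: "a k * u k = u (Suc k) * \<kappa> k" for k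
    using ur[OF H_mult[OF N(3) b(1)], of k] qa[of k "e (K k)"] by (simp add: \<kappa>_def mult.assoc id_right[OF b(1)])
  have aux: "u (Suc k) * (\<kappa> k * x) = a k * (u k * x)" for k x by (simp add: au flip: mult.assoc)
  have ra': "r (Suc k) * a k = \<kappa> k * r k" for k
  proof -
    have "r (Suc k) * a k = r (Suc k) * (a k * (u k * r k + i k * q k))"
      using b(9)[of k] by (simp add: id_right[OF N(3)])
    also have "\<dots> = \<kappa> k * r k" using rai[of k "q k"] by (simp add: \<kappa>_def distrib_left mult.assoc)
    finally show ?thesis .
  qed
  have \<kappa>: "\<kappa> k \<in> H (K k) (K (Suc k))" for k
    unfolding \<kappa>_def by (intro H_mult[OF H_mult[OF b(3) N(3)] b(1)])
  have L: "L k \<in> H (K (Suc k)) (K k)" for k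
    unfolding L_def by (intro H_mult[OF H_mult[OF b(3) D(3)] b(1)])
  have ru: "r k * (u k * x) = x" if "x \<in> H X (K k)" for x X k
    using id_left[OF that] b(5)[of k] by (simp flip: mult.assoc)
  have "\<kappa> (Suc k) * \<kappa> k = 0" for k
  proof -
    have "\<kappa> (Suc k) * \<kappa> k = r (Suc (Suc k)) * (a (Suc k) * (u (Suc k) * \<kappa> k))" by (simp add: \<kappa>_def mult.assoc)
    also have "\<dots> = 0" unfolding au[symmetric] using complex_zero_assoc[OF angleD(1)[OF A]] by simp
    finally show ?thesis .
  qed
  moreover have "\<kappa> (k + n) = \<kappa> k" for k
    using per N(2)[of k] per(3)[of "Suc k"] by (simp add: \<kappa>_def)
  ultimately have cx: "complex K \<kappa>" using \<kappa> per by (simp add: complex_def nseq_def)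
  have Lper: "L (k + n) = L k" for k using per D(6)[of k] per(2)[of "Suc k"] by (simp add: L_def)
  have hom: "e (K (Suc k)) = L (Suc k) * \<kappa> (Suc k) + \<kappa> k * L k" for k
  proof -
    let ?u = "u (Suc k)" and ?r = "r (Suc k)"
    have ru0: "?r * (i (Suc k) * x) = 0" for x using b(8)[of "Suc k"] by (simp flip: mult.assoc)
    have "e (K (Suc k)) = ?r * ?u" using b(5) by simp
    also have "?u = i (Suc k) * (q (Suc k) * ?u) + T (Suc k) * (a (Suc k) * ?u) + a k * (T k * ?u)"
      by (rule ra(5)[OF b(1)])
    also have "?r * \<dots> = ?r * (T (Suc k) * (a (Suc k) * ?u)) + ?r * (a k * (T k * ?u))"
      by (simp add: distrib_left ru0)
    also have "?r * (T (Suc k) * (a (Suc k) * ?u)) = L (Suc k) * \<kappa> (Suc k)"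
      by (simp add: L_def au mult.assoc)
    also have "?r * (a k * (T k * ?u)) = \<kappa> k * L k"
    proof -
      have "?r * (a k * (T k * ?u)) = ?r * a k * (T k * ?u)" by (simp add: mult.assoc)
      also have "\<dots> = \<kappa> k * L k" unfolding ra' by (simp add: L_def mult.assoc)
      finally show ?thesis .
    qed
    finally show ?thesis .
  qed
  have a_eq: "a k = u (Suc k) * (\<kappa> k * r k) + i (Suc k) * (p * e F * q k)" for k
  proof -
    have "a k = u (Suc k) * (r (Suc k) * a k) + i (Suc k) * (q (Suc k) * a k)" by (rule ur[OF N(3)])
    also have "\<dots> = u (Suc k) * (\<kappa> k * r k) + i (Suc k) * (p * e F * q k)"
      by (simp only: ra' ra(3) mult.assoc[of p] id_left[OF D(2)])
    finally show ?thesis .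
  qed
  show ?thesis
    by (rule exI[of _ F], rule exI[of _ K], rule exI[of _ \<kappa>], rule exI[of _ L], rule exI[of _ u], rule exI[of _ i],
      rule exI[of _ r], rule exI[of _ q]) (intro conjI allI F cx bip per D(4,5) Lper L hom a_eq)
qed

definition first :: "'o \<Rightarrow> 'o \<Rightarrow> 'e \<Rightarrow> bool" where
  "first A B f \<longleftrightarrow> (\<exists>ob a. angle ob a \<and> ob 1 = A \<and> ob 2 = B \<and> a 1 = f)"

lemma firstI: "angle ob a \<Longrightarrow> ob 1 = A \<Longrightarrow> ob 2 = B \<Longrightarrow> a 1 = f \<Longrightarrow> first A B f"
  unfolding first_def by blast

lemma first_sum:
  assumes 1: "first A1 B1 f1" and 2: "first A2 B2 f2"
    and A: "bip A A1 A2 uA vA qA rA" and B: "bip B B1 B2 uB vB qB rB"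
  shows "first A B (uB * f1 * qA + vB * f2 * rA)"
proof -
  obtain oa a where a: "angle oa a" "oa 1 = A1" "oa 2 = B1" "a 1 = f1" using 1 unfolding first_def by blast
  obtain ob b where b: "angle ob b" "ob 1 = A2" "ob 2 = B2" "b 1 = f2" using 2 unfolding first_def by blast
  note NA = nseqD[OF angleD(3)[OF a(1)]] and NB = nseqD[OF angleD(3)[OF b(1)]]
  have "\<exists>S u v q r. bip S (oa k) (ob k) u v q r \<and> (k = 1 \<longrightarrow> S = A \<and> u = uA \<and> v = vA \<and> q = qA \<and> r = rA)
      \<and> (k = 2 \<longrightarrow> S = B \<and> u = uB \<and> v = vB \<and> q = qB \<and> r = rB)" for k
    using A B a b ex_bip[OF NA(4) NB(4), of k k] by (cases "k = 1"; cases "k = 2") auto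
  then obtain S u v q r where S: "\<And>k. bip (S k) (oa k) (ob k) (u k) (v k) (q k) (r k)"
    and S1: "S 1 = A" "u 1 = uA" "v 1 = vA" "q 1 = qA" "r 1 = rA"
    and S2: "S 2 = B" "u 2 = uB" "v 2 = vB" "q 2 = qB" "r 2 = rB" by metis
  let ?m = "\<lambda>f k. f (k mod n)"
  have S': "bip (?m S k) (oa k) (ob k) (?m u k) (?m v k) (?m q k) (?m r k)" for k
    using S[of "k mod n"] periodic_mod[of oa, OF NA(1)] periodic_mod[of ob, OF NB(1)] by simp
  note D = bipD[OF S']
  define s where "s k = ?m u (Suc k) * a k * ?m q k + ?m v (Suc k) * b k * ?m r k" for k
  have Suc_per: "Suc (k + n) mod n = Suc k mod n" for k by (metis add_Suc mod_add_self2)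
  have "nseq (?m S) s"
    unfolding nseq_def
  proof (intro allI conjI)
    fix k
    show "?m S (k + n) = ?m S k" by simp
    show "s (k + n) = s k" using NA(2) NB(2) by (simp add: s_def Suc_per)
    show "s k \<in> H (?m S k) (?m S (Suc k))"
      unfolding s_def by (intro H_add H_mult[OF H_mult[OF D(1) NA(3)] D(3)] H_mult[OF H_mult[OF D(2) NB(3)] D(4)])
  qed
  then have "angle (?m S) s"
    using angle_sum[OF a(1) b(1) _ S' _ _ s_def] Suc_per[of 0] by simp
  moreover have m: "1 mod n = 1" "2 mod n = 2" "Suc 1 mod n = 2" using n_ge_3 by auto
  have "s 1 = uB * f1 * qA + vB * f2 * rA" by (simp only: s_def m S1 S2 a b)
  moreover have "?m S 1 = A" "?m S 2 = B" by (simp_all only: m S1 S2)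
  ultimately show ?thesis unfolding first_def by blast
qed

text \<open>The identity of \<open>X\<close> between the positions \<open>m\<close> and
  \<open>m + 1\<close> is its own contraction.\<close>

lemma elementary_angle:
  assumes X: "X \<in> Ob" and Z: "Z \<in> Ob" "e Z = 0" and m: "m < n"
  shows "angle (\<lambda>k. if k mod n = m \<or> k mod n = Suc m mod n then X else Z) (\<lambda>k. if k mod n = m then e X else 0)"
    (is "angle ?ob ?a")
proof -
  have Q: "Suc k mod n = Suc m mod n \<longleftrightarrow> k mod n = m" for k
    using m by (auto simp: mod_Suc split: if_splits)
  have PQ: "Suc m mod n \<noteq> m" using m n_ge_3 by (auto simp: mod_Suc)
  have Suc_per: "Suc (k + n) mod n = Suc k mod n" for k by (metis add_Suc mod_add_self2)
  have E: "e X \<in> H X X" "e X * e X = e X" using H_id[OF X] id_left by auto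
  have ob: "?ob k \<in> Ob" for k using X Z by simp
  have "?a k \<in> H (?ob k) (?ob (Suc k))" for k
    using E Q[of k] H_zero[OF ob ob, of k "Suc k"] by auto
  moreover have "?a (Suc k) * ?a k = 0" for k using Q[of k] PQ by auto
  ultimately have "complex ?ob ?a" by (simp add: complex_def nseq_def Suc_per)
  moreover have "?a k \<in> H (?ob (Suc k)) (?ob k)" for k
    using E Q[of k] H_zero[OF ob ob, of "Suc k" k] by auto
  moreover have "e (?ob (Suc k)) = ?a (Suc k) * ?a (Suc k) + ?a k * ?a k" for k
    using Q[of k] PQ E Z by auto
  ultimately show ?thesis by (rule contractible_angle)
qed

lemma first_id:
  assumes "X \<in> Ob"
  shows "first X X (e X)"
proof -
  obtain Z where "Z \<in> Ob" "e Z = 0" using ex_zero by blast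
  then show ?thesis
    using n_ge_3 by (intro firstI[OF elementary_angle[OF assms, of _ 1]]) auto
qed

lemma first_zero:
  assumes "A \<in> Ob" "B \<in> Ob"
  shows "first A B 0"
proof -
  obtain Z where Z: "Z \<in> Ob" "e Z = 0" using ex_zero by blast
  have "first A Z 0"
    using n_ge_3 Z by (intro firstI[OF elementary_angle[OF assms(1) Z, of 0]]) (auto simp: mod_Suc)
  moreover have "3 mod n \<noteq> 1" using n_ge_3 by (cases "n = 3") auto
  then have "first Z B 0"
    using n_ge_3 Z by (intro firstI[OF elementary_angle[OF assms(2) Z, of 2]]) auto
  moreover have "bip A A Z (e A) 0 (e A) 0" "bip B Z B 0 (e B) 0 (e B)"
    using assms Z H_id id_left[OF H_id] H_zero by (simp_all add: bip_def)
  ultimately show ?thesis using first_sum by fastforce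
qed

lemma first_multiplication:
  assumes "F \<in> Ob"
  shows "first F F (p * e F)"
  by (rule firstI[OF multiplication_angle[OF assms]]) auto

text \<open>Elimination in \<open>f\<close> and then in the cofactor of \<open>p\<close> brings
  \<open>f\<close> into the form $1 \oplus p \oplus 0$. The three blocks begin a contractible
  sequence, a multiplication sequence, and a sum of two contractible sequences.\<close>

theorem every_morphism_first:
  assumes f: "f \<in> H A B"
  shows "first A B f"
proof -
  obtain X A' B' u u' q q' v v' r r' g where A: "bip A X A' u u' q q'" and B: "bip B X B' v v' r r'"
    and g: "g \<in> H A' B'" and f_eq: "f = v * q + p * (v' * g * q')"
    by (rule eliminate[OF f])
  obtain Y A2 B2 w w' s s' z z' t t' h where A': "bip A' Y A2 w w' s s'" and B': "bip B' Y B2 z z' t t'"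
    and h: "h \<in> H A2 B2" and g_eq: "g = z * s + p * (z' * h * s')"
    by (rule eliminate[OF g])
  have ob: "X \<in> Ob" "Y \<in> Ob" "A2 \<in> Ob" "B2 \<in> Ob" using bip_obj A A' B' by blast+
  have "p * g = z * (p * e Y) * s + z' * 0 * s'"
    using bipD(3)[OF A'] by (simp add: g_eq distrib_left p_square_left p_left_comm[of z] mult.assoc id_left)
  then have "first A' B' (p * g)"
    using first_sum[OF first_multiplication[OF ob(2)] first_zero[OF ob(3,4)] A' B'] by simp
  from first_sum[OF first_id[OF ob(1)] this A B]
  have "first A B (v * e X * q + v' * (p * g) * q')" .
  moreover have "v * e X * q + v' * (p * g) * q' = f"
    using bipD(1)[OF B] by (simp add: f_eq id_right p_left_comm[of v'] mult.assoc)
  ultimately show ?thesis by simp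
qed

end

section \<open>A ring that contains every preadditive category\<close>

context category
begin

lemma homs_obj: "f \<in> homs C A B \<Longrightarrow> A \<in> obj C \<and> B \<in> obj C"
  using src_obj tgt_obj by (auto simp: homs_def)

end

context preadditive_category
begin

lemma hadd_cancel:
  assumes "f \<in> homs C A B" "hadd C f f = f"
  shows "f = hzero C A B"
proof -
  have "hadd C (hadd C f f) (hneg C f) = hadd C f (hadd C f (hneg C f))"
    by (rule hadd_assoc[OF assms(1) assms(1) hneg_hom[OF assms(1)]])
  then show ?thesis using assms hadd_neg hadd_zero by simp
qed

lemma cmp_zero_right:
  assumes "g \<in> homs C B D" "A \<in> obj C"
  shows "cmp C g (hzero C A B) = hzero C A D"
proof (rule hadd_cancel)
  have z: "hzero C A B \<in> homs C A B" using assms homs_obj hzero_hom by blast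
  then show "cmp C g (hzero C A B) \<in> homs C A D" using assms cmp_hom by blast
  show "hadd C (cmp C g (hzero C A B)) (cmp C g (hzero C A B)) = cmp C g (hzero C A B)"
    using cmp_hadd_right[OF z z assms(1)] hadd_zero[OF z] by simp
qed

lemma cmp_zero_left:
  assumes "f \<in> homs C A B" "D \<in> obj C"
  shows "cmp C (hzero C B D) f = hzero C A D"
proof (rule hadd_cancel)
  have z: "hzero C B D \<in> homs C B D" using assms homs_obj hzero_hom by blast
  then show "cmp C (hzero C B D) f \<in> homs C A D" using assms cmp_hom by blast
  show "hadd C (cmp C (hzero C B D) f) (cmp C (hzero C B D) f) = cmp C (hzero C B D) f"
    using cmp_hadd_left[OF assms(1) z z] hadd_zero[OF z] by simp
qed

end

text \<open>In other words, \<open>z\<close> is an element of square zero of the centre of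
  \<open>C\<close>.\<close>

definition central_square_zero :: "('o, 'a) addcat \<Rightarrow> ('o \<Rightarrow> 'a) \<Rightarrow> bool" where
  "central_square_zero C z \<longleftrightarrow> preadditive_category C \<and>
     (\<forall>A\<in>obj C. z A \<in> homs C A A \<and> cmp C (z A) (z A) = hzero C A A) \<and>
     (\<forall>A B. \<forall>f\<in>homs C A B. cmp C (z B) f = cmp C f (z A))"

definition yoneda_dom :: "('o, 'a) addcat \<Rightarrow> ('o \<Rightarrow> 'a) \<Rightarrow> 'o \<Rightarrow> 'o \<Rightarrow> bool" where
  "yoneda_dom C z X A \<longleftrightarrow> central_square_zero C z \<and> X \<in> obj C \<and> A \<in> obj C"

lemma yoneda_domD:
  assumes "yoneda_dom C z X A"
  shows "preadditive_category C" "category C" "X \<in> obj C" "A \<in> obj C" "z A \<in> homs C A A"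
  using assms by (auto simp: yoneda_dom_def central_square_zero_def preadditive_category_def)

text \<open>The common representation space: an element chooses a morphism from \<open>X\<close> to
  \<open>A\<close> for all objects of all categories \<open>C\<close> at once. A morphism from
  \<open>A\<close> to \<open>B\<close> acts by composition on the components at
  \<open>A\<close>, and this action is faithful because it can be tested on the identity. As a
  type cannot depend on a category, all pairs of a category and a central element
  \<open>z\<close> have to be treated simultaneously.\<close>

typedef ('o, 'a) yoneda = "{v :: ('o, 'a) addcat \<Rightarrow> ('o \<Rightarrow> 'a) \<Rightarrow> 'o \<Rightarrow> 'o \<Rightarrow> 'a.
    \<forall>C z X A. if yoneda_dom C z X A then v C z X A \<in> homs C X A else v C z X A = undefined}"
proof
  show "(\<lambda>C z X A. if yoneda_dom C z X A then hzero C X A else undefined) \<in>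
     {v. \<forall>C z X A. if yoneda_dom C z X A then v C z X A \<in> homs C X A else v C z X A = undefined}"
    by (auto dest: yoneda_domD intro: preadditive_category.hzero_hom)
qed

setup_lifting type_definition_yoneda

lemma yoneda_eqI:
  fixes u v :: "('o, 'a) yoneda"
  assumes "\<And>C z X A. yoneda_dom C z X A \<Longrightarrow> Rep_yoneda u C z X A = Rep_yoneda v C z X A"
  shows "u = v"
proof -
  have "Rep_yoneda u C z X A = Rep_yoneda v C z X A" for C z X A
    using assms[of C z X A] Rep_yoneda[of u] Rep_yoneda[of v] by (cases "yoneda_dom C z X A") auto
  then show ?thesis by (simp add: Rep_yoneda_inject[symmetric] fun_eq_iff)
qed

lemma Rep_yoneda_hom: "yoneda_dom C z X A \<Longrightarrow> Rep_yoneda v C z X A \<in> homs C X A"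
  using Rep_yoneda[of v] by auto

instantiation yoneda :: (type, type) ab_group_add
begin

lift_definition zero_yoneda :: "('a, 'b) yoneda"
  is "\<lambda>C z X A. if yoneda_dom C z X A then hzero C X A else undefined"
  by (auto dest: yoneda_domD intro: preadditive_category.hzero_hom)

lift_definition plus_yoneda :: "('a, 'b) yoneda \<Rightarrow> ('a, 'b) yoneda \<Rightarrow> ('a, 'b) yoneda"
  is "\<lambda>u v C z X A. if yoneda_dom C z X A then hadd C (u C z X A) (v C z X A) else undefined"
  by (auto dest: yoneda_domD intro: preadditive_category.hadd_hom)

lift_definition uminus_yoneda :: "('a, 'b) yoneda \<Rightarrow> ('a, 'b) yoneda"
  is "\<lambda>v C z X A. if yoneda_dom C z X A then hneg C (v C z X A) else undefined"
  by (auto dest: yoneda_domD intro: preadditive_category.hneg_hom)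

definition minus_yoneda :: "('a, 'b) yoneda \<Rightarrow> ('a, 'b) yoneda \<Rightarrow> ('a, 'b) yoneda" where
  "minus_yoneda u v = u + - v"

instance
proof
  fix u v w :: "('a, 'b) yoneda"
  note simps = plus_yoneda.rep_eq zero_yoneda.rep_eq uminus_yoneda.rep_eq
  note laws = preadditive_category.hadd_assoc preadditive_category.hadd_commute
     preadditive_category.hadd_zero preadditive_category.hadd_neg preadditive_category.hzero_hom
     preadditive_category.hneg_hom
  show "u + v + w = u + (v + w)"
    by (rule yoneda_eqI) (simp add: simps laws(1)[OF yoneda_domD(1) Rep_yoneda_hom Rep_yoneda_hom Rep_yoneda_hom])
  show comm: "u + v = v + u" for u v :: "('a, 'b) yoneda"
    by (rule yoneda_eqI) (simp add: simps laws(2)[OF yoneda_domD(1) Rep_yoneda_hom Rep_yoneda_hom])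
  have "v + 0 = v"
    by (rule yoneda_eqI) (simp add: simps laws(3)[OF yoneda_domD(1) Rep_yoneda_hom])
  then show "0 + v = v" by (simp add: comm)
  have "v + - v = 0"
    by (rule yoneda_eqI) (simp add: simps laws(4)[OF yoneda_domD(1) Rep_yoneda_hom])
  then show "- v + v = 0" by (simp add: comm)
  show "u - v = u + - v" by (simp add: minus_yoneda_def)
qed

end

lemma yoneda_dom_scale: "yoneda_dom C z X A \<Longrightarrow> f \<in> homs C X A \<Longrightarrow> cmp C (z A) f \<in> homs C X A"
  by (meson category.cmp_hom yoneda_domD(2,5))

lemma Rep_Abs_yoneda:
  assumes "\<And>C z X A. yoneda_dom C z X A \<Longrightarrow> v C z X A \<in> homs C X A"
  shows "Rep_yoneda (Abs_yoneda (\<lambda>C z X A. if yoneda_dom C z X A then v C z X A else undefined)) =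
    (\<lambda>C z X A. if yoneda_dom C z X A then v C z X A else undefined)"
  by (rule Abs_yoneda_inverse) (use assms in simp)

definition yoneda_scale :: "('o, 'a) yoneda \<Rightarrow> ('o, 'a) yoneda" where
  "yoneda_scale v = Abs_yoneda (\<lambda>C z X A.
     if yoneda_dom C z X A then cmp C (z A) (Rep_yoneda v C z X A) else undefined)"

lemma Rep_yoneda_scale:
  "yoneda_dom C z X A \<Longrightarrow> Rep_yoneda (yoneda_scale v) C z X A = cmp C (z A) (Rep_yoneda v C z X A)"
  unfolding yoneda_scale_def by (subst Rep_Abs_yoneda) (auto intro: yoneda_dom_scale Rep_yoneda_hom)

definition yoneda_act :: "('o, 'a) addcat \<Rightarrow> ('o \<Rightarrow> 'a) \<Rightarrow> 'a \<Rightarrow> ('o, 'a) yoneda \<Rightarrow> ('o, 'a) yoneda" where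
  "yoneda_act C z f v = Abs_yoneda (\<lambda>C' z' X A. if yoneda_dom C' z' X A
     then (if C' = C \<and> z' = z \<and> f \<in> arr C \<and> tgt C f = A then cmp C f (Rep_yoneda v C z X (src C f)) else hzero C' X A)
     else undefined)"

lemma Rep_yoneda_act:
  assumes "yoneda_dom C' z' X A"
  shows "Rep_yoneda (yoneda_act C z f v) C' z' X A =
    (if C' = C \<and> z' = z \<and> f \<in> arr C \<and> tgt C f = A then cmp C f (Rep_yoneda v C z X (src C f)) else hzero C' X A)"
proof -
  have act: "cmp C f (Rep_yoneda v C z X (src C f)) \<in> homs C X (tgt C f)"
    if d: "yoneda_dom C z X (tgt C f)" "f \<in> arr C" for X
  proof -
    have "src C f \<in> obj C" by (rule category.src_obj[OF yoneda_domD(2)[OF d(1)] d(2)])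
    then have "yoneda_dom C z X (src C f)" using d(1) by (simp add: yoneda_dom_def)
    then have "Rep_yoneda v C z X (src C f) \<in> homs C X (src C f)" by (rule Rep_yoneda_hom)
    moreover have "f \<in> homs C (src C f) (tgt C f)" using d by (simp add: homs_def)
    ultimately show ?thesis by (rule category.cmp_hom[OF yoneda_domD(2)[OF d(1)]])
  qed
  have zero: "hzero C' X A \<in> homs C' X A" if "yoneda_dom C' z' X A" for C' :: "('a, 'b) addcat" and z' X A
    using preadditive_category.hzero_hom[OF yoneda_domD(1,3,4)[OF that]] .
  define w where "w C' z' X A = (if C' = C \<and> z' = z \<and> f \<in> arr C \<and> tgt C f = A
    then cmp C f (Rep_yoneda v C z X (src C f)) else hzero C' X A)" for C' z' X A
  have "w C' z' X A \<in> homs C' X A" if d: "yoneda_dom C' z' X A" for C' z' X A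
  proof (cases "C' = C \<and> z' = z \<and> f \<in> arr C \<and> tgt C f = A")
    case True
    then show ?thesis using act[of X] d by (simp add: w_def)
  next
    case False
    then show ?thesis using zero[OF d] unfolding w_def by (simp only: if_False)
  qed
  from Rep_Abs_yoneda[of w, OF this] show ?thesis
    using assms unfolding yoneda_act_def w_def by simp
qed

text \<open>Only endomorphisms that commute with \<open>z\<close> are admitted, so that \<open>z\<close>
  becomes a single central element of the ring.\<close>

typedef ('o, 'a) yoneda_end = "{T :: ('o, 'a) yoneda \<Rightarrow> ('o, 'a) yoneda.
    (\<forall>u v. T (u + v) = T u + T v) \<and> (\<forall>v. T (yoneda_scale v) = yoneda_scale (T v))}"
  by (rule exI[of _ "\<lambda>v. v"]) simp

setup_lifting type_definition_yoneda_end

lemma yoneda_scale_add: "yoneda_scale (u + v) = yoneda_scale u + yoneda_scale v"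
  by (rule yoneda_eqI)
    (simp add: Rep_yoneda_scale plus_yoneda.rep_eq
      preadditive_category.cmp_hadd_right[OF yoneda_domD(1) Rep_yoneda_hom Rep_yoneda_hom yoneda_domD(5)])

lemma additive_zero_uminus:
  fixes T :: "'v::ab_group_add \<Rightarrow> 'w::ab_group_add"
  assumes "\<And>u v. T (u + v) = T u + T v"
  shows "T 0 = 0" "T (- v) = - T v" "T (u - v) = T u - T v"
proof -
  show 0: "T 0 = 0" using assms[of 0 0] by simp
  then show 1: "T (- v) = - T v" for v using assms[of "- v" v] by (simp add: eq_neg_iff_add_eq_0)
  show "T (u - v) = T u - T v" using assms[of u "- v"] 1 by simp
qed

lemmas yoneda_scale_zero_uminus = additive_zero_uminus[of yoneda_scale, OF yoneda_scale_add]

instantiation yoneda_end :: (type, type) ring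
begin

lift_definition zero_yoneda_end :: "('a, 'b) yoneda_end" is "\<lambda>_. 0"
  by (simp add: yoneda_scale_zero_uminus)
lift_definition plus_yoneda_end :: "('a, 'b) yoneda_end \<Rightarrow> ('a, 'b) yoneda_end \<Rightarrow> ('a, 'b) yoneda_end"
  is "\<lambda>S T v. S v + T v" by (simp add: yoneda_scale_add algebra_simps)
lift_definition uminus_yoneda_end :: "('a, 'b) yoneda_end \<Rightarrow> ('a, 'b) yoneda_end"
  is "\<lambda>T v. - T v" by (simp add: yoneda_scale_zero_uminus)
lift_definition minus_yoneda_end :: "('a, 'b) yoneda_end \<Rightarrow> ('a, 'b) yoneda_end \<Rightarrow> ('a, 'b) yoneda_end"
  is "\<lambda>S T v. S v - T v" by (simp add: yoneda_scale_add yoneda_scale_zero_uminus algebra_simps)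
lift_definition times_yoneda_end :: "('a, 'b) yoneda_end \<Rightarrow> ('a, 'b) yoneda_end \<Rightarrow> ('a, 'b) yoneda_end"
  is "\<lambda>S T v. S (T v)" by simp

instance
  by standard (transfer; simp add: algebra_simps fun_eq_iff)+

end

lift_definition central :: "('o, 'a) yoneda_end" is yoneda_scale
  by (simp add: yoneda_scale_add)

lemma central_commutes: "central * x = x * central"
  by transfer (simp add: fun_eq_iff)

lemma central_square: "(central :: ('o, 'a) yoneda_end) * central = 0"
proof -
  have "(\<lambda>v :: ('o, 'a) yoneda. yoneda_scale (yoneda_scale v)) = (\<lambda>_. 0)"
  proof (intro ext yoneda_eqI)
    fix v :: "('o, 'a) yoneda" and C :: "('o, 'a) addcat" and z X A assume d: "yoneda_dom C z X A"
    interpret preadditive_category C by (rule yoneda_domD[OF d])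
    note v = Rep_yoneda_hom[OF d, of v]
    have z: "z A \<in> homs C A A" "cmp C (z A) (z A) = hzero C A A"
      using d by (auto simp: yoneda_dom_def central_square_zero_def)
    have "cmp C (z A) (cmp C (z A) (Rep_yoneda v C z X A)) = hzero C X A"
      using cmp_assoc[OF v z(1) z(1)] z(2) cmp_zero_left[OF v] yoneda_domD[OF d] by simp
    then show "Rep_yoneda (yoneda_scale (yoneda_scale v)) C z X A = Rep_yoneda 0 C z X A"
      using d by (simp add: Rep_yoneda_scale zero_yoneda.rep_eq)
  qed
  then show ?thesis
    unfolding Rep_yoneda_end_inject[symmetric] times_yoneda_end.rep_eq central.rep_eq zero_yoneda_end.rep_eq .
qed

lift_definition rep :: "('o, 'a) addcat \<Rightarrow> ('o \<Rightarrow> 'a) \<Rightarrow> 'a \<Rightarrow> ('o, 'a) yoneda_end" is yoneda_act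
proof (intro conjI allI yoneda_eqI)
  fix C :: "('o, 'a) addcat" and z and f :: 'a and u v and C' :: "('o, 'a) addcat" and z' X A assume d: "yoneda_dom C' z' X A"
  interpret preadditive_category C' by (rule yoneda_domD[OF d])
  have f: "f \<in> homs C' (src C' f) A" "yoneda_dom C' z' X (src C' f)" if "f \<in> arr C'" "tgt C' f = A"
    using that d src_obj by (auto simp: homs_def yoneda_dom_def)
  have zero: "hadd C' (hzero C' X A) (hzero C' X A) = hzero C' X A" "cmp C' (z' A) (hzero C' X A) = hzero C' X A"
    using hadd_zero hzero_hom cmp_zero_right yoneda_domD[OF d] by auto
  show "Rep_yoneda (yoneda_act C z f (u + v)) C' z' X A = Rep_yoneda (yoneda_act C z f u + yoneda_act C z f v) C' z' X A"
    using d f zero cmp_hadd_right[OF Rep_yoneda_hom Rep_yoneda_hom]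
    by (auto simp: Rep_yoneda_act plus_yoneda.rep_eq)
  show "Rep_yoneda (yoneda_act C z f (yoneda_scale v)) C' z' X A = Rep_yoneda (yoneda_scale (yoneda_act C z f v)) C' z' X A"
  proof -
    have "cmp C' f (cmp C' (z' (src C' f)) (Rep_yoneda v C' z' X (src C' f))) =
       cmp C' (z' A) (cmp C' f (Rep_yoneda v C' z' X (src C' f)))" if "f \<in> arr C'" "tgt C' f = A"
    proof -
      note f = f[OF that]
      have "cmp C' (z' A) f = cmp C' f (z' (src C' f))"
        using d f by (auto simp: yoneda_dom_def central_square_zero_def)
      then show ?thesis
        using cmp_assoc[OF Rep_yoneda_hom[OF f(2)] f(1) yoneda_domD(5)[OF d]]
          cmp_assoc[OF Rep_yoneda_hom[OF f(2)] yoneda_domD(5)[OF f(2)] f(1)] by simp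
    qed
    then show ?thesis using d f zero by (auto simp: Rep_yoneda_act Rep_yoneda_scale)
  qed
qed

locale central_category = preadditive_category C for C :: "('o, 'a) addcat" +
  fixes z :: "'o \<Rightarrow> 'a"
  assumes csz: "central_square_zero C z"
begin

lemma dom_iff: "yoneda_dom C z X A \<longleftrightarrow> X \<in> obj C \<and> A \<in> obj C"
  using csz by (simp add: yoneda_dom_def)

lemma yoneda_end_eqI:
  fixes S T :: "('o, 'a) yoneda_end"
  assumes "\<And>v C z X A. yoneda_dom C z X A \<Longrightarrow> Rep_yoneda (Rep_yoneda_end S v) C z X A = Rep_yoneda (Rep_yoneda_end T v) C z X A"
  shows "S = T"
  unfolding Rep_yoneda_end_inject[symmetric] by (intro ext yoneda_eqI assms)

lemma Rep_rep:
  assumes "yoneda_dom C' z' X D" "f \<in> homs C A B"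
  shows "Rep_yoneda (Rep_yoneda_end (rep C z f) v) C' z' X D =
    (if C' = C \<and> z' = z \<and> D = B then cmp C f (Rep_yoneda v C z X A) else hzero C' X D)"
  using assms by (auto simp: rep.rep_eq Rep_yoneda_act homs_def)

lemma Rep_hom: "X \<in> obj C \<Longrightarrow> A \<in> obj C \<Longrightarrow> Rep_yoneda v C z X A \<in> homs C X A"
  by (rule Rep_yoneda_hom) (simp add: dom_iff)

lemma rep_cmp:
  assumes "f \<in> homs C A B" "g \<in> homs C B D"
  shows "rep C z (cmp C g f) = rep C z g * rep C z f"
proof (rule yoneda_end_eqI)
  fix v and C' :: "('o, 'a) addcat" and z' and X Y :: 'o assume d: "yoneda_dom C' z' X Y"
  interpret C': preadditive_category C' by (rule yoneda_domD[OF d])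
  have "cmp C (cmp C g f) (Rep_yoneda v C z X A) = cmp C g (cmp C f (Rep_yoneda v C z X A))" if "X \<in> obj C"
    using cmp_assoc[OF Rep_hom assms] that homs_obj assms by simp
  then show "Rep_yoneda (Rep_yoneda_end (rep C z (cmp C g f)) v) C' z' X Y
      = Rep_yoneda (Rep_yoneda_end (rep C z g * rep C z f) v) C' z' X Y"
    using d Rep_rep[OF d cmp_hom[OF assms]] Rep_rep[OF d assms(2)] Rep_rep[OF _ assms(1), of C z X B] homs_obj[OF assms(1)]
    by (auto simp: times_yoneda_end.rep_eq dom_iff)
qed

lemma rep_hadd:
  assumes "f \<in> homs C A B" "g \<in> homs C A B"
  shows "rep C z (hadd C f g) = rep C z f + rep C z g"
proof (rule yoneda_end_eqI)
  fix v and C' :: "('o, 'a) addcat" and z' and X Y :: 'o assume d: "yoneda_dom C' z' X Y"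
  interpret C': preadditive_category C' by (rule yoneda_domD[OF d])
  have "hadd C' (hzero C' X Y) (hzero C' X Y) = hzero C' X Y"
    using C'.hadd_zero C'.hzero_hom yoneda_domD[OF d] by auto
  moreover have "cmp C (hadd C f g) (Rep_yoneda v C z X A) = hadd C (cmp C f (Rep_yoneda v C z X A)) (cmp C g (Rep_yoneda v C z X A))"
    if "X \<in> obj C"
    using cmp_hadd_left[OF Rep_hom assms] that homs_obj assms by simp
  ultimately show "Rep_yoneda (Rep_yoneda_end (rep C z (hadd C f g)) v) C' z' X Y
      = Rep_yoneda (Rep_yoneda_end (rep C z f + rep C z g) v) C' z' X Y"
    using d Rep_rep[OF d hadd_hom[OF assms]] Rep_rep[OF d assms(1)] Rep_rep[OF d assms(2)]
    by (auto simp: plus_yoneda_end.rep_eq plus_yoneda.rep_eq dom_iff)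
qed

lemma rep_hzero:
  assumes "A \<in> obj C" "B \<in> obj C"
  shows "rep C z (hzero C A B) = 0"
  using rep_hadd[OF hzero_hom hzero_hom, OF assms assms] hadd_zero[OF hzero_hom, OF assms] by simp

lemma rep_hneg:
  assumes "f \<in> homs C A B"
  shows "rep C z (hneg C f) = - rep C z f"
  using rep_hadd[OF assms hneg_hom[OF assms]] hadd_neg[OF assms] rep_hzero homs_obj[OF assms]
  by (simp add: eq_neg_iff_add_eq_0 add.commute)

lemma rep_central:
  assumes "f \<in> homs C A B"
  shows "rep C z (cmp C (z B) f) = central * rep C z f"
proof (rule yoneda_end_eqI)
  fix v and C' :: "('o, 'a) addcat" and z' and X Y :: 'o assume d: "yoneda_dom C' z' X Y"
  interpret C': preadditive_category C' by (rule yoneda_domD[OF d])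
  have z: "z B \<in> homs C B B" using csz homs_obj[OF assms] by (auto simp: central_square_zero_def)
  have "cmp C' (z' Y) (hzero C' X Y) = hzero C' X Y" using C'.cmp_zero_right yoneda_domD[OF d] by auto
  moreover have "cmp C (cmp C (z B) f) (Rep_yoneda v C z X A) = cmp C (z B) (cmp C f (Rep_yoneda v C z X A))" if "X \<in> obj C"
    using cmp_assoc[OF Rep_hom assms z] that homs_obj assms by simp
  ultimately show "Rep_yoneda (Rep_yoneda_end (rep C z (cmp C (z B) f)) v) C' z' X Y
      = Rep_yoneda (Rep_yoneda_end (central * rep C z f) v) C' z' X Y"
    using d Rep_rep[OF d cmp_hom[OF assms z]] Rep_rep[OF d assms]
    by (auto simp: times_yoneda_end.rep_eq central.rep_eq Rep_yoneda_scale dom_iff)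
qed

text \<open>Both sides are applied to the family that is the identity at \<open>A\<close> and zero
  elsewhere.\<close>

lemma rep_inject:
  assumes f: "f \<in> homs C A B" and g: "g \<in> homs C A B" and eq: "rep C z f = rep C z g"
  shows "f = g"
proof -
  define w where "w C' z' X D = (if yoneda_dom C' z' X D then
    if C' = C \<and> z' = z \<and> X = A \<and> D = A then ide C A else hzero C' X D else undefined)" for C' z' X D
  have A: "A \<in> obj C" "B \<in> obj C" using homs_obj f by auto
  have "w \<in> {v. \<forall>C z X A. if yoneda_dom C z X A then v C z X A \<in> homs C X A else v C z X A = undefined}"
    using ide_hom A by (auto simp: w_def intro: preadditive_category.hzero_hom[OF yoneda_domD(1,3,4)])
  then have w: "Rep_yoneda (Abs_yoneda w) = w" by (rule Abs_yoneda_inverse)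
  have d: "yoneda_dom C z A B" "yoneda_dom C z A A" using A by (auto simp: dom_iff)
  have "cmp C h (ide C A) = Rep_yoneda (Rep_yoneda_end (rep C z h) (Abs_yoneda w)) C z A B" if "h \<in> homs C A B" for h
    using Rep_rep[OF d(1) that] w d by (simp add: w_def)
  then show ?thesis using f g eq ide_right by metis
qed

abbreviation "RH A B \<equiv> rep C z ` homs C A B"

lemma RH_I: "f \<in> homs C A B \<Longrightarrow> rep C z f = x \<Longrightarrow> x \<in> RH A B"
  by blast

lemma ring_category_rep: "ring_category central (obj C) (\<lambda>A. rep C z (ide C A)) RH"
proof
  fix x y :: "('o, 'a) yoneda_end" and A B D
  have z: "z B \<in> homs C B B" if "B \<in> obj C" for B using csz that by (auto simp: central_square_zero_def)
  show "central * x = x * central" by (rule central_commutes)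
  show "central * central = (0 :: ('o, 'a) yoneda_end)" by (rule central_square)
  show "A \<in> obj C" "B \<in> obj C" if "x \<in> RH A B" using that homs_obj by blast+
  show "rep C z (ide C A) \<in> RH A A" if "A \<in> obj C" using that ide_hom by blast
  show "rep C z (ide C B) * x = x" "x * rep C z (ide C A) = x" if x: "x \<in> RH A B"
  proof -
    obtain f where f: "f \<in> homs C A B" "x = rep C z f" using x by blast
    then show "rep C z (ide C B) * x = x" "x * rep C z (ide C A) = x"
      using rep_cmp[OF f(1) ide_hom[of B]] rep_cmp[OF ide_hom[of A] f(1)] ide_left ide_right homs_obj[OF f(1)] by auto
  qed
  show "0 \<in> RH A B" if "A \<in> obj C" "B \<in> obj C"
    using rep_hzero[OF that] hzero_hom[OF that] by (metis image_eqI)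
  show "x + y \<in> RH A B" if x: "x \<in> RH A B" "y \<in> RH A B"
  proof -
    obtain f g where "f \<in> homs C A B" "x = rep C z f" "g \<in> homs C A B" "y = rep C z g" using x by blast
    then show ?thesis using rep_hadd[of f A B g] hadd_hom[of f A B g] RH_I by simp
  qed
  show "- x \<in> RH A B" if x: "x \<in> RH A B"
  proof -
    obtain f where "f \<in> homs C A B" "x = rep C z f" using x by blast
    then show ?thesis using rep_hneg[of f A B] hneg_hom[of f A B] RH_I by simp
  qed
  show "y * x \<in> RH A D" if x: "y \<in> RH B D" "x \<in> RH A B"
  proof -
    obtain f g where "f \<in> homs C A B" "x = rep C z f" "g \<in> homs C B D" "y = rep C z g" using x by blast
    then show ?thesis using rep_cmp[of f A B g D] cmp_hom[of f A B g D] RH_I by simp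
  qed
  show "central * x \<in> RH A B" if x: "x \<in> RH A B"
  proof -
    obtain f where f: "f \<in> homs C A B" "x = rep C z f" using x by blast
    then show ?thesis using rep_central[OF f(1)] cmp_hom[OF f(1) z] homs_obj[OF f(1)] RH_I f(2) by simp
  qed
qed

end

section \<open>Homomorphisms of free modules and their bases\<close>

lemma fg_free_module: "is_fg_free R M \<Longrightarrow> module R M"
  by (simp add: is_fg_free_def)

lemma mod_ops [simp]:
  "ide (fg_free_modules R) M = (M, \<lambda>x\<in>carrier M. x, M)"
  "cmp (fg_free_modules R) (N, g, L) (M, f, N') = (M, compose (carrier M) g f, L)"
  "hadd (fg_free_modules R) (M, f, N) (M', g, N') = (M, \<lambda>x\<in>carrier M. f x \<oplus>\<^bsub>N\<^esub> g x, N)"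
  "hzero (fg_free_modules R) M N = (M, \<lambda>x\<in>carrier M. \<zero>\<^bsub>N\<^esub>, N)"
  "hneg (fg_free_modules R) (M, f, N) = (M, \<lambda>x\<in>carrier M. \<ominus>\<^bsub>N\<^esub> f x, N)"
  "obj (fg_free_modules R) = {M. is_fg_free R M}"
  by (simp_all add: fg_free_modules_def)

lemma mod_homs_iff:
  "F \<in> homs (fg_free_modules R) M N \<longleftrightarrow>
     (\<exists>f. F = (M, f, N) \<and> is_fg_free R M \<and> is_fg_free R N \<and> f \<in> module_homs R M N)"
  by (auto simp: homs_def fg_free_modules_def)

lemma module_homsI:
  assumes "module R M"
    and "\<And>x. x \<in> carrier M \<Longrightarrow> f x \<in> carrier N"
    and "\<And>x y. x \<in> carrier M \<Longrightarrow> y \<in> carrier M \<Longrightarrow> f (x \<oplus>\<^bsub>M\<^esub> y) = f x \<oplus>\<^bsub>N\<^esub> f y"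
    and "\<And>r x. r \<in> carrier R \<Longrightarrow> x \<in> carrier M \<Longrightarrow> f (r \<odot>\<^bsub>M\<^esub> x) = r \<odot>\<^bsub>N\<^esub> f x"
  shows "(\<lambda>x\<in>carrier M. f x) \<in> module_homs R M N"
proof -
  interpret module R M by (rule assms)
  show ?thesis using assms(2-4) by (auto simp: module_homs_def)
qed

lemma module_homsD:
  assumes "f \<in> module_homs R M N"
  shows "x \<in> carrier M \<Longrightarrow> f x \<in> carrier N"
    and "x \<in> carrier M \<Longrightarrow> y \<in> carrier M \<Longrightarrow> f (x \<oplus>\<^bsub>M\<^esub> y) = f x \<oplus>\<^bsub>N\<^esub> f y"
    and "r \<in> carrier R \<Longrightarrow> x \<in> carrier M \<Longrightarrow> f (r \<odot>\<^bsub>M\<^esub> x) = r \<odot>\<^bsub>N\<^esub> f x"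
    and "x \<notin> carrier M \<Longrightarrow> f x = undefined"
  using assms by (auto simp: module_homs_def PiE_def extensional_def)

lemma restrict_eqI:
  assumes "f \<in> module_homs R M N" "\<And>x. x \<in> carrier M \<Longrightarrow> g x = f x"
  shows "(\<lambda>x\<in>carrier M. g x) = f"
  using assms module_homsD(4)[OF assms(1)] by (auto simp: restrict_def fun_eq_iff)

lemma compose_module_homs:
  assumes "module R M" "f \<in> module_homs R M N" "g \<in> module_homs R N L"
  shows "compose (carrier M) g f \<in> module_homs R M L"
  unfolding compose_def using module_homsD(1-3)[OF assms(2)] module_homsD(1-3)[OF assms(3)]
  by (intro module_homsI assms) simp_all

theorem preadditive_fg_free_modules:
  "preadditive_category (fg_free_modules R :: (('r, 'u) module, ('r, 'u) module_arrow) addcat)" (is "preadditive_category ?C")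
proof
  fix A B D E :: "('r, 'u) module" and f g h f' g' :: "('r, 'u) module_arrow"
  note defs = mod_homs_iff
  note fgm = fg_free_module
  show "src ?C f \<in> obj ?C" "tgt ?C f \<in> obj ?C" if "f \<in> arr ?C"
    using that by (auto simp: fg_free_modules_def)
  show "ide ?C A \<in> homs ?C A A" if "A \<in> obj ?C"
    using that by (auto simp: defs intro!: module_homsI fgm)
  show "cmp ?C g f \<in> homs ?C A D" if "f \<in> homs ?C A B" "g \<in> homs ?C B D"
    using that by (auto simp: defs intro!: compose_module_homs fgm)
  show "cmp ?C (ide ?C B) f = f" if "f \<in> homs ?C A B"
    using that by (auto simp: defs compose_def module_homsD(1) intro!: restrict_eqI)
  show "cmp ?C f (ide ?C A) = f" if "f \<in> homs ?C A B"
    using that by (auto simp: defs compose_def intro!: restrict_eqI)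
  show "cmp ?C h (cmp ?C g f) = cmp ?C (cmp ?C h g) f"
    if "f \<in> homs ?C A B" "g \<in> homs ?C B D" "h \<in> homs ?C D E"
    using that by (auto simp: defs compose_def restrict_def fun_eq_iff simp: module_homsD(1))
  show "hzero ?C A B \<in> homs ?C A B" if "A \<in> obj ?C" "B \<in> obj ?C"
  proof -
    have "is_fg_free R B" using that by simp
    then interpret B: module R B by (rule fgm)
    show ?thesis using that by (auto simp: defs intro!: module_homsI fgm)
  qed
  show "hadd ?C f g \<in> homs ?C A B" if "f \<in> homs ?C A B" "g \<in> homs ?C A B"
  proof -
    obtain a b where f: "f = (A, a, B)" "g = (A, b, B)" and o: "is_fg_free R A" "is_fg_free R B"
      and a: "a \<in> module_homs R A B" and b: "b \<in> module_homs R A B" using \<open>f \<in> _\<close> \<open>g \<in> _\<close> by (auto simp: defs)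
    interpret B: module R B by (rule fgm[OF o(2)])
    show ?thesis using f o module_homsD(1-3)[OF a] module_homsD(1-3)[OF b]
      by (auto simp: defs B.M.a_ac B.smult_r_distr intro!: module_homsI fgm)
  qed
  show "hneg ?C f \<in> homs ?C A B" if "f \<in> homs ?C A B"
  proof -
    obtain a where f: "f = (A, a, B)" and o: "is_fg_free R A" "is_fg_free R B"
      and a: "a \<in> module_homs R A B" using \<open>f \<in> _\<close> by (auto simp: defs)
    interpret B: module R B by (rule fgm[OF o(2)])
    show ?thesis using f o module_homsD(1-3)[OF a]
      by (auto simp: defs B.M.minus_add B.smult_r_minus intro!: module_homsI fgm)
  qed
  show "hadd ?C (hadd ?C f g) h = hadd ?C f (hadd ?C g h)"
    if "f \<in> homs ?C A B" "g \<in> homs ?C A B" "h \<in> homs ?C A B"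
  proof -
    have "is_fg_free R B" using that by (auto simp: defs)
    then interpret B: module R B by (rule fgm)
    show ?thesis using that by (auto simp: defs restrict_def fun_eq_iff B.M.a_assoc simp: module_homsD(1))
  qed
  show "hadd ?C f g = hadd ?C g f" if "f \<in> homs ?C A B" "g \<in> homs ?C A B"
  proof -
    have "is_fg_free R B" using that by (auto simp: defs)
    then interpret B: module R B by (rule fgm)
    show ?thesis using that by (auto simp: defs restrict_def fun_eq_iff B.M.a_comm simp: module_homsD(1))
  qed
  show "hadd ?C f (hzero ?C A B) = f" if "f \<in> homs ?C A B"
  proof -
    have "is_fg_free R B" using that by (auto simp: defs)
    then interpret B: module R B by (rule fgm)
    show ?thesis using that by (auto simp: defs intro!: restrict_eqI simp: module_homsD(1))
  qed
  show "hadd ?C f (hneg ?C f) = hzero ?C A B" if "f \<in> homs ?C A B"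
  proof -
    have "is_fg_free R B" using that by (auto simp: defs)
    then interpret B: module R B by (rule fgm)
    show ?thesis using that by (auto simp: defs restrict_def fun_eq_iff B.M.r_neg simp: module_homsD(1))
  qed
  show "cmp ?C (hadd ?C g g') f = hadd ?C (cmp ?C g f) (cmp ?C g' f)"
    if "f \<in> homs ?C A B" "g \<in> homs ?C B D" "g' \<in> homs ?C B D"
    using that by (auto simp: defs compose_def restrict_def fun_eq_iff simp: module_homsD(1))
  show "cmp ?C g (hadd ?C f f') = hadd ?C (cmp ?C g f) (cmp ?C g f')"
    if "f \<in> homs ?C A B" "f' \<in> homs ?C A B" "g \<in> homs ?C B D"
    using that by (auto simp: defs compose_def restrict_def fun_eq_iff module_homsD)
qed

definition mult_arrow :: "'r \<Rightarrow> ('r, 'u) module \<Rightarrow> ('r, 'u) module_arrow" where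
  "mult_arrow r M = (M, \<lambda>x\<in>carrier M. r \<odot>\<^bsub>M\<^esub> x, M)"

lemma mult_arrow_hom:
  assumes "is_fg_free R M" "r \<in> carrier R"
  shows "mult_arrow r M \<in> homs (fg_free_modules R) M M"
proof -
  interpret module R M by (rule fg_free_module[OF assms(1)])
  have "r \<odot>\<^bsub>M\<^esub> (s \<odot>\<^bsub>M\<^esub> x) = s \<odot>\<^bsub>M\<^esub> (r \<odot>\<^bsub>M\<^esub> x)" if "s \<in> carrier R" "x \<in> carrier M" for s x
    using that assms by (metis smult_assoc1 R.m_comm)
  then show ?thesis using assms
    by (auto simp: mod_homs_iff mult_arrow_def smult_r_distr intro!: module_homsI fg_free_module)
qed

lemma mult_arrow_central:
  assumes "F \<in> homs (fg_free_modules R) M N" "r \<in> carrier R"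
  shows "cmp (fg_free_modules R) (mult_arrow r N) F = cmp (fg_free_modules R) F (mult_arrow r M)"
proof -
  have "is_fg_free R M" using assms by (auto simp: mod_homs_iff)
  then interpret module R M by (rule fg_free_module)
  show ?thesis using assms
    by (auto simp: mod_homs_iff mult_arrow_def compose_def restrict_def fun_eq_iff module_homsD)
qed

lemma mult_arrow_central_square_zero:
  assumes "p \<in> carrier R" "p \<otimes>\<^bsub>R\<^esub> p = \<zero>\<^bsub>R\<^esub>"
  shows "central_square_zero (fg_free_modules R) (mult_arrow p)"
  unfolding central_square_zero_def
proof (intro conjI preadditive_fg_free_modules ballI allI mult_arrow_central assms(1))
  fix M assume M: "M \<in> obj (fg_free_modules R)"
  then show "mult_arrow p M \<in> homs (fg_free_modules R) M M" using mult_arrow_hom assms by simp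
  from M have "is_fg_free R M" by simp
  then interpret module R M by (rule fg_free_module)
  have "p \<odot>\<^bsub>M\<^esub> (p \<odot>\<^bsub>M\<^esub> x) = \<zero>\<^bsub>M\<^esub>" if "x \<in> carrier M" for x
    using assms that smult_assoc1[of p p x] by simp
  then show "cmp (fg_free_modules R) (mult_arrow p M) (mult_arrow p M) = hzero (fg_free_modules R) M M"
    using assms by (auto simp: mult_arrow_def compose_def restrict_def fun_eq_iff)
qed

text \<open>Bases as families, with which coordinates can be summed over an initial segment of the natural
  numbers.\<close>

definition indexed_basis :: "('r, 'x) ring_scheme \<Rightarrow> ('r, 'u) module \<Rightarrow> nat \<Rightarrow> (nat \<Rightarrow> 'u) \<Rightarrow> bool" where
  "indexed_basis R M m b \<longleftrightarrow> (\<forall>j<m. b j \<in> carrier M) \<and>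
     (\<forall>x\<in>carrier M. \<exists>!c. c \<in> {..<m} \<rightarrow>\<^sub>E carrier R \<and> x = (\<Oplus>\<^bsub>M\<^esub>j\<in>{..<m}. c j \<odot>\<^bsub>M\<^esub> b j))"

lemma ex1_bij:
  assumes T: "bij_betw T A B" and PQ: "\<And>c. c \<in> A \<Longrightarrow> P c \<longleftrightarrow> Q (T c)"
  shows "(\<exists>!c. c \<in> A \<and> P c) \<longleftrightarrow> (\<exists>!d. d \<in> B \<and> Q d)"
proof -
  have "B = T ` A" and "inj_on T A" using T by (auto simp: bij_betw_def)
  note B = \<open>B = T ` A\<close> and inj = inj_onD[OF \<open>inj_on T A\<close>]
  show ?thesis
  proof
    assume "\<exists>!c. c \<in> A \<and> P c"
    then obtain c where c: "c \<in> A" "P c" and u: "\<forall>c'. c' \<in> A \<and> P c' \<longrightarrow> c' = c"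
      by (elim ex1E conjE) (rule that)
    show "\<exists>!d. d \<in> B \<and> Q d"
    proof (rule ex1I[of _ "T c"])
      show "T c \<in> B \<and> Q (T c)" using B PQ c by simp
      show "d = T c" if d: "d \<in> B \<and> Q d" for d
      proof -
        obtain c' where "c' \<in> A" "d = T c'" using d B by blast
        then have "c' = c" using u PQ d by blast
        then show ?thesis using \<open>d = T c'\<close> by simp
      qed
    qed
  next
    assume "\<exists>!d. d \<in> B \<and> Q d"
    then obtain d where d: "d \<in> B" "Q d" and u: "\<forall>d'. d' \<in> B \<and> Q d' \<longrightarrow> d' = d"
      by (elim ex1E conjE) (rule that)
    then obtain c where c: "c \<in> A" "d = T c" using B by blast
    show "\<exists>!c. c \<in> A \<and> P c"
    proof (rule ex1I[of _ c])
      show "c \<in> A \<and> P c" using c d PQ by simp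
      show "c' = c" if "c' \<in> A \<and> P c'" for c'
      proof (rule inj)
        have "T c' \<in> B" "Q (T c')" using that B PQ by auto
        then show "T c' = T c" using u c by blast
      qed (use that c in auto)
    qed
  qed
qed

lemma basis_reindex:
  assumes M: "module R M" and inj: "inj_on b {..<m}" and img: "b ` {..<m} \<subseteq> carrier M"
  shows "(\<exists>!c. c \<in> b ` {..<m} \<rightarrow>\<^sub>E carrier R \<and> x = (\<Oplus>\<^bsub>M\<^esub>v\<in>b ` {..<m}. c v \<odot>\<^bsub>M\<^esub> v)) \<longleftrightarrow>
    (\<exists>!c. c \<in> {..<m} \<rightarrow>\<^sub>E carrier R \<and> x = (\<Oplus>\<^bsub>M\<^esub>j\<in>{..<m}. c j \<odot>\<^bsub>M\<^esub> b j))"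
proof (rule ex1_bij)
  interpret module R M by (rule M)
  have b: "b j \<in> carrier M" if "j < m" for j using that img by auto
  let ?T = "\<lambda>c. \<lambda>j\<in>{..<m}. c (b j)" and ?S = "\<lambda>d. \<lambda>v\<in>b ` {..<m}. d (inv_into {..<m} b v)"
  show "bij_betw ?T (b ` {..<m} \<rightarrow>\<^sub>E carrier R) ({..<m} \<rightarrow>\<^sub>E carrier R)"
  proof (rule bij_betw_byWitness[of _ ?S])
    show "\<forall>c\<in>b ` {..<m} \<rightarrow>\<^sub>E carrier R. ?S (?T c) = c"
    proof (intro ballI ext)
      fix c v assume c: "c \<in> b ` {..<m} \<rightarrow>\<^sub>E carrier R"
      show "?S (?T c) v = c v"
        using PiE_arb[OF c] inv_into_f_f[OF inj] by (auto simp: restrict_def)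
    qed
    show "\<forall>d\<in>{..<m} \<rightarrow>\<^sub>E carrier R. ?T (?S d) = d"
    proof (intro ballI ext)
      fix d j assume d: "d \<in> {..<m} \<rightarrow>\<^sub>E carrier R"
      show "?T (?S d) j = d j"
        using PiE_arb[OF d] inv_into_f_f[OF inj] by (auto simp: restrict_def)
    qed
    show "?T ` (b ` {..<m} \<rightarrow>\<^sub>E carrier R) \<subseteq> {..<m} \<rightarrow>\<^sub>E carrier R"
      by (auto simp: PiE_def Pi_def)
    show "?S ` ({..<m} \<rightarrow>\<^sub>E carrier R) \<subseteq> b ` {..<m} \<rightarrow>\<^sub>E carrier R"
      by (auto simp: PiE_def Pi_def inv_into_f_f[OF inj])
  qed
  fix c assume c: "c \<in> b ` {..<m} \<rightarrow>\<^sub>E carrier R"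
  have "(\<lambda>v. c v \<odot>\<^bsub>M\<^esub> v) \<in> b ` {..<m} \<rightarrow> carrier M" using c b by (auto simp: PiE_def Pi_def)
  from M.finsum_reindex[OF this inj]
  have "(\<Oplus>\<^bsub>M\<^esub>v\<in>b ` {..<m}. c v \<odot>\<^bsub>M\<^esub> v) = (\<Oplus>\<^bsub>M\<^esub>j\<in>{..<m}. c (b j) \<odot>\<^bsub>M\<^esub> b j)" .
  also have "\<dots> = (\<Oplus>\<^bsub>M\<^esub>j\<in>{..<m}. ?T c j \<odot>\<^bsub>M\<^esub> b j)"
    using c b by (intro M.finsum_cong') (auto simp: PiE_def Pi_def)
  finally show "x = (\<Oplus>\<^bsub>M\<^esub>v\<in>b ` {..<m}. c v \<odot>\<^bsub>M\<^esub> v) \<longleftrightarrow> x = (\<Oplus>\<^bsub>M\<^esub>j\<in>{..<m}. ?T c j \<odot>\<^bsub>M\<^esub> b j)"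
    by simp
qed

lemma ex_indexed_basis:
  assumes "is_fg_free R M"
  shows "\<exists>m b. indexed_basis R M m b"
proof -
  obtain B where B: "is_basis R M B" and M: "module R M" using assms by (auto simp: is_fg_free_def)
  then have "finite B" by (simp add: is_basis_def)
  then obtain b m where "bij_betw b {..<m::nat} B" using ex_bij_betw_nat_finite by (metis lessThan_atLeast0)
  then have inj: "inj_on b {..<m}" and img: "B = b ` {..<m}" by (auto simp: bij_betw_def)
  have mem: "b ` {..<m} \<subseteq> carrier M" using B img by (simp add: is_basis_def)
  have "\<forall>x\<in>carrier M. \<exists>!c. c \<in> b ` {..<m} \<rightarrow>\<^sub>E carrier R \<and> x = (\<Oplus>\<^bsub>M\<^esub>v\<in>b ` {..<m}. c v \<odot>\<^bsub>M\<^esub> v)"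
    using B unfolding is_basis_def img by (elim conjE)
  then have "\<exists>!c. c \<in> {..<m} \<rightarrow>\<^sub>E carrier R \<and> x = (\<Oplus>\<^bsub>M\<^esub>j\<in>{..<m}. c j \<odot>\<^bsub>M\<^esub> b j)"
    if "x \<in> carrier M" for x
    by (rule iffD1[OF basis_reindex[OF M inj mem] bspec[OF _ that]])
  then have "indexed_basis R M m b"
    unfolding indexed_basis_def using mem by (intro conjI) auto
  then show ?thesis by (intro exI)
qed

locale based_module = module R M for R :: "('r, 'x) ring_scheme" (structure) and M :: "('r, 'u) module" (structure) +
  fixes m :: nat and b :: "nat \<Rightarrow> 'u"
  assumes basis: "indexed_basis R M m b"
begin

definition crd :: "'u \<Rightarrow> nat \<Rightarrow> 'r" where
  "crd x = (THE c. c \<in> {..<m} \<rightarrow>\<^sub>E carrier R \<and> x = (\<Oplus>\<^bsub>M\<^esub>j\<in>{..<m}. c j \<odot>\<^bsub>M\<^esub> b j))"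

lemma b_closed: "j < m \<Longrightarrow> b j \<in> carrier M"
  using basis by (auto simp: indexed_basis_def)

lemma crd:
  assumes "x \<in> carrier M"
  shows "crd x \<in> {..<m} \<rightarrow>\<^sub>E carrier R" "x = (\<Oplus>\<^bsub>M\<^esub>j\<in>{..<m}. crd x j \<odot>\<^bsub>M\<^esub> b j)"
proof -
  have "\<exists>!c. c \<in> {..<m} \<rightarrow>\<^sub>E carrier R \<and> x = (\<Oplus>\<^bsub>M\<^esub>j\<in>{..<m}. c j \<odot>\<^bsub>M\<^esub> b j)"
    using basis assms unfolding indexed_basis_def by blast
  from theI'[OF this] show "crd x \<in> {..<m} \<rightarrow>\<^sub>E carrier R" "x = (\<Oplus>\<^bsub>M\<^esub>j\<in>{..<m}. crd x j \<odot>\<^bsub>M\<^esub> b j)"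
    unfolding crd_def by auto
qed

lemma crd_closed: "x \<in> carrier M \<Longrightarrow> j < m \<Longrightarrow> crd x j \<in> carrier R"
  using crd(1) by (auto simp: PiE_def Pi_def)

lemma crd_unique:
  assumes c: "\<And>j. j < m \<Longrightarrow> c j \<in> carrier R" and x: "x = (\<Oplus>\<^bsub>M\<^esub>j\<in>{..<m}. c j \<odot>\<^bsub>M\<^esub> b j)" and j: "j < m"
  shows "crd x j = c j"
proof -
  have xM: "x \<in> carrier M" unfolding x using c b_closed by (intro M.finsum_closed) auto
  have "(\<lambda>j\<in>{..<m}. c j) \<in> {..<m} \<rightarrow>\<^sub>E carrier R" using c by auto
  moreover have "x = (\<Oplus>\<^bsub>M\<^esub>j\<in>{..<m}. (\<lambda>j\<in>{..<m}. c j) j \<odot>\<^bsub>M\<^esub> b j)"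
    unfolding x using c b_closed by (intro M.finsum_cong') auto
  moreover have "\<exists>!c. c \<in> {..<m} \<rightarrow>\<^sub>E carrier R \<and> x = (\<Oplus>\<^bsub>M\<^esub>j\<in>{..<m}. c j \<odot>\<^bsub>M\<^esub> b j)"
    using basis xM unfolding indexed_basis_def by blast
  ultimately have "crd x = (\<lambda>j\<in>{..<m}. c j)" using crd[OF xM] by blast
  then show ?thesis using j by simp
qed

lemma crd_add: "x \<in> carrier M \<Longrightarrow> y \<in> carrier M \<Longrightarrow> j < m \<Longrightarrow> crd (x \<oplus>\<^bsub>M\<^esub> y) j = crd x j \<oplus> crd y j"
proof (rule crd_unique)
  assume x: "x \<in> carrier M" "y \<in> carrier M"
  have "x \<oplus>\<^bsub>M\<^esub> y = (\<Oplus>\<^bsub>M\<^esub>j\<in>{..<m}. crd x j \<odot>\<^bsub>M\<^esub> b j) \<oplus>\<^bsub>M\<^esub> (\<Oplus>\<^bsub>M\<^esub>j\<in>{..<m}. crd y j \<odot>\<^bsub>M\<^esub> b j)"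
    using crd(2) x by simp
  also have "\<dots> = (\<Oplus>\<^bsub>M\<^esub>j\<in>{..<m}. crd x j \<odot>\<^bsub>M\<^esub> b j \<oplus>\<^bsub>M\<^esub> crd y j \<odot>\<^bsub>M\<^esub> b j)"
    using x crd_closed b_closed by (intro M.finsum_addf[symmetric]) auto
  also have "\<dots> = (\<Oplus>\<^bsub>M\<^esub>j\<in>{..<m}. (crd x j \<oplus> crd y j) \<odot>\<^bsub>M\<^esub> b j)"
    using x crd_closed b_closed by (intro M.finsum_cong') (auto simp: smult_l_distr)
  finally show "x \<oplus>\<^bsub>M\<^esub> y = (\<Oplus>\<^bsub>M\<^esub>j\<in>{..<m}. (crd x j \<oplus> crd y j) \<odot>\<^bsub>M\<^esub> b j)" .
qed (auto intro: crd_closed)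

lemma crd_smult: "r \<in> carrier R \<Longrightarrow> x \<in> carrier M \<Longrightarrow> j < m \<Longrightarrow> crd (r \<odot>\<^bsub>M\<^esub> x) j = r \<otimes> crd x j"
proof (rule crd_unique)
  assume x: "r \<in> carrier R" "x \<in> carrier M"
  have "r \<odot>\<^bsub>M\<^esub> x = r \<odot>\<^bsub>M\<^esub> (\<Oplus>\<^bsub>M\<^esub>j\<in>{..<m}. crd x j \<odot>\<^bsub>M\<^esub> b j)"
    using crd(2) x by simp
  also have "\<dots> = (\<Oplus>\<^bsub>M\<^esub>j\<in>{..<m}. r \<odot>\<^bsub>M\<^esub> (crd x j \<odot>\<^bsub>M\<^esub> b j))"
    using x crd_closed b_closed by (intro finsum_smult_ldistr) auto
  also have "\<dots> = (\<Oplus>\<^bsub>M\<^esub>j\<in>{..<m}. (r \<otimes> crd x j) \<odot>\<^bsub>M\<^esub> b j)"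
    using x crd_closed b_closed by (intro M.finsum_cong') (auto simp: smult_assoc1)
  finally show "r \<odot>\<^bsub>M\<^esub> x = (\<Oplus>\<^bsub>M\<^esub>j\<in>{..<m}. (r \<otimes> crd x j) \<odot>\<^bsub>M\<^esub> b j)" .
qed (auto intro: crd_closed)

lemma crd_basis:
  assumes "i < m" "j < m"
  shows "crd (b i) j = (if i = j then \<one> else \<zero>)"
proof (rule crd_unique[OF _ _ assms(2)])
  have "(\<Oplus>\<^bsub>M\<^esub>j\<in>{..<m}. (if i = j then \<one> else \<zero>) \<odot>\<^bsub>M\<^esub> b j) = (\<Oplus>\<^bsub>M\<^esub>j\<in>{..<m}. if i = j then b j else \<zero>\<^bsub>M\<^esub>)"
    using b_closed by (intro M.finsum_cong') auto
  also have "\<dots> = b i" using assms b_closed by (intro M.finsum_singleton) auto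
  finally show "b i = (\<Oplus>\<^bsub>M\<^esub>j\<in>{..<m}. (if i = j then \<one> else \<zero>) \<odot>\<^bsub>M\<^esub> b j)" by simp
qed simp

lemma basis_fg_free:
  assumes "\<one> \<noteq> \<zero>"
  shows "is_fg_free R M"
proof -
  have inj: "inj_on b {..<m}"
  proof (rule inj_onI)
    fix i j assume "i \<in> {..<m}" "j \<in> {..<m}" "b i = b j"
    then have "(if j = i then \<one> else \<zero>) = \<one>" using crd_basis[of i i] crd_basis[of j i] by simp
    then show "i = j" using assms by (auto split: if_splits)
  qed
  have "\<forall>x\<in>carrier M. \<exists>!c. c \<in> b ` {..<m} \<rightarrow>\<^sub>E carrier R \<and> x = (\<Oplus>\<^bsub>M\<^esub>v\<in>b ` {..<m}. c v \<odot>\<^bsub>M\<^esub> v)"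
  proof
    have img: "b ` {..<m} \<subseteq> carrier M" using b_closed by auto
    fix x assume "x \<in> carrier M"
    then have "\<exists>!c. c \<in> {..<m} \<rightarrow>\<^sub>E carrier R \<and> x = (\<Oplus>\<^bsub>M\<^esub>j\<in>{..<m}. c j \<odot>\<^bsub>M\<^esub> b j)"
      using basis unfolding indexed_basis_def by (elim conjE) (rule bspec)
    then show "\<exists>!c. c \<in> b ` {..<m} \<rightarrow>\<^sub>E carrier R \<and> x = (\<Oplus>\<^bsub>M\<^esub>v\<in>b ` {..<m}. c v \<odot>\<^bsub>M\<^esub> v)"
      by (rule iffD2[OF basis_reindex[OF module_axioms inj img]])
  qed
  then have "is_basis R M (b ` {..<m})"
    unfolding is_basis_def using b_closed by (intro conjI) auto
  then show ?thesis unfolding is_fg_free_def using module_axioms by blast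
qed

end

section \<open>Modules of every rank and the endomorphisms of a module of rank one\<close>

text \<open>The injection \<open>enc\<close> makes the universe large enough for modules of every finite
  rank. The conditions on \<open>p\<close> say that $(p)$ is its own annihilator and that
  everything outside $(p)$ is a unit.\<close>

locale square_zero_ring =
  fixes R :: "('r, 'x) ring_scheme" (structure) and p :: 'r and enc :: "'r list \<Rightarrow> 'u"
  assumes cring: "cring R" and p: "p \<in> carrier R" "p \<otimes> p = \<zero>" and nontrivial: "\<one> \<noteq> \<zero>"
    and annihilator: "r \<in> carrier R \<Longrightarrow> p \<otimes> r = \<zero> \<Longrightarrow> \<exists>s\<in>carrier R. r = p \<otimes> s"
    and divisible_or_unit: "r \<in> carrier R \<Longrightarrow> (\<exists>s\<in>carrier R. r = p \<otimes> s) \<or> (\<exists>s\<in>carrier R. r \<otimes> s = \<one>)"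
    and enc: "inj_on enc (lists (carrier R))"
begin

sublocale R: cring R by (rule cring)

definition mk :: "nat \<Rightarrow> (nat \<Rightarrow> 'r) \<Rightarrow> 'u" where
  "mk m f = enc (map f [0..<m])"

definition ix :: "'u \<Rightarrow> nat \<Rightarrow> 'r" where
  "ix u j = inv_into (lists (carrier R)) enc u ! j"

lemma ix_mk: "(\<And>i. i < m \<Longrightarrow> f i \<in> carrier R) \<Longrightarrow> j < m \<Longrightarrow> ix (mk m f) j = f j"
  unfolding ix_def mk_def by (subst inv_into_f_f[OF enc]) auto

lemma mk_cong: "(\<And>i. i < m \<Longrightarrow> f i = g i) \<Longrightarrow> mk m f = mk m g"
  unfolding mk_def by (intro arg_cong[of _ _ enc] map_cong) auto

text \<open>The module $R^m$, whose vectors are encoded as elements of the universe by way of their lists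
  of entries.\<close>

definition std :: "nat \<Rightarrow> ('r, 'u) module" where
  "std m = \<lparr>carrier = mk m ` ({..<m} \<rightarrow> carrier R), mult = (\<lambda>_ _. undefined), one = undefined,
     zero = mk m (\<lambda>_. \<zero>), add = (\<lambda>u v. mk m (\<lambda>j. ix u j \<oplus> ix v j)),
     smult = (\<lambda>r u. mk m (\<lambda>j. r \<otimes> ix u j))\<rparr>"

lemma std_simps:
  "u \<oplus>\<^bsub>std m\<^esub> v = mk m (\<lambda>j. ix u j \<oplus> ix v j)" "\<zero>\<^bsub>std m\<^esub> = mk m (\<lambda>_. \<zero>)"
  "r \<odot>\<^bsub>std m\<^esub> u = mk m (\<lambda>j. r \<otimes> ix u j)"
  by (simp_all add: std_def)

lemma mk_closed: "(\<And>i. i < m \<Longrightarrow> f i \<in> carrier R) \<Longrightarrow> mk m f \<in> carrier (std m)"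
  by (auto simp: std_def)

lemma ix_closed: "u \<in> carrier (std m) \<Longrightarrow> j < m \<Longrightarrow> ix u j \<in> carrier R"
  by (auto simp: std_def ix_mk Pi_def)

lemma std_eqI:
  assumes "u \<in> carrier (std m)" "v \<in> carrier (std m)" "\<And>j. j < m \<Longrightarrow> ix u j = ix v j"
  shows "u = v"
proof -
  have "w = mk m (ix w)" if w: "w \<in> carrier (std m)" for w
  proof -
    obtain f where "w = mk m f" "f \<in> {..<m} \<rightarrow> carrier R" using w by (auto simp: std_def)
    then show ?thesis by (auto intro!: mk_cong simp: ix_mk Pi_def)
  qed
  from this[OF assms(1)] this[OF assms(2)] show ?thesis using mk_cong assms(3) by metis
qed

lemma std_closed:
  "u \<in> carrier (std m) \<Longrightarrow> v \<in> carrier (std m) \<Longrightarrow> u \<oplus>\<^bsub>std m\<^esub> v \<in> carrier (std m)"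
  "\<zero>\<^bsub>std m\<^esub> \<in> carrier (std m)"
  "r \<in> carrier R \<Longrightarrow> u \<in> carrier (std m) \<Longrightarrow> r \<odot>\<^bsub>std m\<^esub> u \<in> carrier (std m)"
  unfolding std_simps by (auto intro!: mk_closed ix_closed)

lemma ix_std:
  "u \<in> carrier (std m) \<Longrightarrow> v \<in> carrier (std m) \<Longrightarrow> j < m \<Longrightarrow> ix (u \<oplus>\<^bsub>std m\<^esub> v) j = ix u j \<oplus> ix v j"
  "j < m \<Longrightarrow> ix \<zero>\<^bsub>std m\<^esub> j = \<zero>"
  "r \<in> carrier R \<Longrightarrow> u \<in> carrier (std m) \<Longrightarrow> j < m \<Longrightarrow> ix (r \<odot>\<^bsub>std m\<^esub> u) j = r \<otimes> ix u j"
  unfolding std_simps by (auto simp: ix_mk ix_closed)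

lemma std_module: "module R (std m)"
proof (rule moduleI[OF cring])
  show "abelian_group (std m)"
  proof (rule abelian_groupI)
    fix u assume u: "u \<in> carrier (std m)"
    let ?v = "mk m (\<lambda>j. \<ominus> ix u j)"
    have v: "?v \<in> carrier (std m)" using u ix_closed by (intro mk_closed) auto
    have "?v \<oplus>\<^bsub>std m\<^esub> u = \<zero>\<^bsub>std m\<^esub>"
      by (rule std_eqI[of _ m]) (use u v ix_closed in \<open>auto simp: ix_std ix_mk std_closed R.l_neg\<close>)
    then show "\<exists>v\<in>carrier (std m). v \<oplus>\<^bsub>std m\<^esub> u = \<zero>\<^bsub>std m\<^esub>" using v by blast
  qed (auto intro!: std_eqI[of _ m] simp: std_closed ix_std ix_closed R.a_ac)
qed (auto intro!: std_eqI[of _ m] simp: std_closed ix_std ix_closed R.l_distr R.r_distr R.m_assoc)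

lemma ix_finsum:
  assumes "finite S" "\<And>i. i \<in> S \<Longrightarrow> f i \<in> carrier (std m)" "j < m"
  shows "ix (\<Oplus>\<^bsub>std m\<^esub>i\<in>S. f i) j = (\<Oplus>i\<in>S. ix (f i) j)"
  using assms
proof (induction S)
  case empty
  interpret M: module R "std m" by (rule std_module)
  show ?case using ix_std(2) empty by simp
next
  case (insert a S)
  interpret M: module R "std m" by (rule std_module)
  have f: "f \<in> S \<rightarrow> carrier (std m)" "f a \<in> carrier (std m)" using insert by auto
  have g: "(\<lambda>i. ix (f i) j) \<in> S \<rightarrow> carrier R" "ix (f a) j \<in> carrier R"
    using f insert.prems ix_closed by (auto simp: Pi_def)
  have "ix (\<Oplus>\<^bsub>std m\<^esub>i\<in>insert a S. f i) j = ix (f a) j \<oplus> ix (\<Oplus>\<^bsub>std m\<^esub>i\<in>S. f i) j"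
    using M.M.finsum_insert[OF insert.hyps f] ix_std(1) f M.M.finsum_closed insert.prems by simp
  then show ?case
    using insert R.finsum_insert[OF insert.hyps g] by simp
qed

lemma std_indexed_basis: "indexed_basis R (std m) m (\<lambda>i. mk m (\<lambda>j. if j = i then \<one> else \<zero>))"
  (is "indexed_basis R _ _ ?b")
  unfolding indexed_basis_def
proof (intro conjI allI impI ballI)
  interpret M: module R "std m" by (rule std_module)
  show b: "?b i \<in> carrier (std m)" for i by (rule mk_closed) auto
  have sum: "ix (\<Oplus>\<^bsub>std m\<^esub>i\<in>{..<m}. c i \<odot>\<^bsub>std m\<^esub> ?b i) j = c j"
    if c: "c \<in> {..<m} \<rightarrow>\<^sub>E carrier R" and j: "j < m" for c j
  proof -
    have cc: "c i \<in> carrier R" if "i < m" for i using c that by auto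
    have "ix (\<Oplus>\<^bsub>std m\<^esub>i\<in>{..<m}. c i \<odot>\<^bsub>std m\<^esub> ?b i) j = (\<Oplus>i\<in>{..<m}. ix (c i \<odot>\<^bsub>std m\<^esub> ?b i) j)"
      using b cc j by (intro ix_finsum) auto
    also have "\<dots> = (\<Oplus>i\<in>{..<m}. if j = i then c i else \<zero>)"
      using b cc j by (intro R.finsum_cong') (auto simp: ix_std(3) ix_mk)
    also have "\<dots> = c j" using cc j by (intro R.finsum_singleton) auto
    finally show ?thesis .
  qed
  fix x assume x: "x \<in> carrier (std m)"
  show "\<exists>!c. c \<in> {..<m} \<rightarrow>\<^sub>E carrier R \<and> x = (\<Oplus>\<^bsub>std m\<^esub>i\<in>{..<m}. c i \<odot>\<^bsub>std m\<^esub> ?b i)"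
  proof (rule ex1I)
    let ?c = "\<lambda>j\<in>{..<m}. ix x j"
    have c: "?c \<in> {..<m} \<rightarrow>\<^sub>E carrier R" using x ix_closed by auto
    have "(\<Oplus>\<^bsub>std m\<^esub>i\<in>{..<m}. ?c i \<odot>\<^bsub>std m\<^esub> ?b i) \<in> carrier (std m)"
      using c b by (intro M.M.finsum_closed) (auto simp: PiE_def Pi_def)
    then have "x = (\<Oplus>\<^bsub>std m\<^esub>i\<in>{..<m}. ?c i \<odot>\<^bsub>std m\<^esub> ?b i)"
      using sum[OF c] by (intro std_eqI[OF x]) auto
    then show "?c \<in> {..<m} \<rightarrow>\<^sub>E carrier R \<and> x = (\<Oplus>\<^bsub>std m\<^esub>i\<in>{..<m}. ?c i \<odot>\<^bsub>std m\<^esub> ?b i)" using c by blast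
    fix d assume d: "d \<in> {..<m} \<rightarrow>\<^sub>E carrier R \<and> x = (\<Oplus>\<^bsub>std m\<^esub>i\<in>{..<m}. d i \<odot>\<^bsub>std m\<^esub> ?b i)"
    then have "ix x j = d j" if "j < m" for j using sum[of d j] that by simp
    then show "d = ?c" using d by (intro PiE_ext[of d "{..<m}" "\<lambda>_. carrier R"] c) auto
  qed
qed

lemma ex_free_of_rank: "\<exists>M :: ('r, 'u) module. \<exists>b. is_fg_free R M \<and> indexed_basis R M m b"
proof -
  interpret based_module R "std m" m "\<lambda>i. mk m (\<lambda>j. if j = i then \<one> else \<zero>)"
    by (intro based_module.intro std_module based_module_axioms.intro std_indexed_basis)
  show ?thesis using basis_fg_free nontrivial std_indexed_basis by blast
qed

abbreviation "modR \<equiv> fg_free_modules R :: (('r, 'u) module, ('r, 'u) module_arrow) addcat"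

interpretation cc: central_category modR "mult_arrow p"
  by (intro central_category.intro preadditive_fg_free_modules central_category_axioms.intro
      mult_arrow_central_square_zero p)

interpretation rc: ring_category central "obj modR" "\<lambda>A. rep modR (mult_arrow p) (ide modR A)" cc.RH
  by (rule cc.ring_category_rep)

abbreviation "rp \<equiv> rep modR (mult_arrow p)"

lemma mult_arrow_simps:
  assumes "is_fg_free R M" "r \<in> carrier R" "s \<in> carrier R"
  shows "cmp (fg_free_modules R) (mult_arrow r M) (mult_arrow s M) = mult_arrow (r \<otimes> s) M"
    "mult_arrow \<one> M = ide (fg_free_modules R) M"
proof -
  interpret module R M by (rule fg_free_module[OF assms(1)])
  show "cmp (fg_free_modules R) (mult_arrow r M) (mult_arrow s M) = mult_arrow (r \<otimes> s) M"
    "mult_arrow \<one> M = ide (fg_free_modules R) M"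
    using assms by (auto simp: mult_arrow_def compose_def fun_eq_iff smult_assoc1)
qed

context
  fixes I :: "('r, 'u) module" and bI
  assumes I: "is_fg_free R I" and bI: "indexed_basis R I (Suc 0) bI"
begin

interpretation I: based_module R I "Suc 0" bI
  by (intro based_module.intro based_module_axioms.intro fg_free_module I bI)

lemma I_expand:
  assumes "x \<in> carrier I"
  shows "x = I.crd x 0 \<odot>\<^bsub>I\<^esub> bI 0"
proof -
  have c: "I.crd x 0 \<odot>\<^bsub>I\<^esub> bI 0 \<in> carrier I" using I.crd_closed[OF assms] I.b_closed by simp
  have "x = (\<Oplus>\<^bsub>I\<^esub>j\<in>{..<Suc 0}. I.crd x j \<odot>\<^bsub>I\<^esub> bI j)" by (rule I.crd(2)[OF assms])
  also have "{..<Suc 0} = {0}" by auto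
  also have "(\<Oplus>\<^bsub>I\<^esub>j\<in>{0}. I.crd x j \<odot>\<^bsub>I\<^esub> bI j) = I.crd x 0 \<odot>\<^bsub>I\<^esub> bI 0"
    using c by (subst I.M.finsum_insert) auto
  finally show ?thesis .
qed

text \<open>The image of the basis vector is a multiple of it, and it determines the endomorphism.\<close>

lemma end_I:
  assumes "f \<in> homs modR I I"
  shows "\<exists>r\<in>carrier R. f = mult_arrow r I"
proof -
  obtain g where g: "f = (I, g, I)" "g \<in> module_homs R I I" using assms by (auto simp: mod_homs_iff)
  note gD = module_homsD[OF g(2)]
  have b0: "bI 0 \<in> carrier I" using I.b_closed by simp
  define r where "r = I.crd (g (bI 0)) 0"
  have r: "r \<in> carrier R" using I.crd_closed gD(1)[OF b0] by (simp add: r_def)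
  have "g x = r \<odot>\<^bsub>I\<^esub> x" if x: "x \<in> carrier I" for x
  proof -
    have c: "I.crd x 0 \<in> carrier R" using I.crd_closed[OF x] by simp
    have "g x = I.crd x 0 \<odot>\<^bsub>I\<^esub> g (bI 0)" using gD(3)[OF c b0] I_expand[OF x] by simp
    also have "g (bI 0) = r \<odot>\<^bsub>I\<^esub> bI 0" using I_expand[OF gD(1)[OF b0]] by (simp add: r_def)
    also have "I.crd x 0 \<odot>\<^bsub>I\<^esub> (r \<odot>\<^bsub>I\<^esub> bI 0) = r \<odot>\<^bsub>I\<^esub> (I.crd x 0 \<odot>\<^bsub>I\<^esub> bI 0)"
      using c r b0 R.m_comm by (simp flip: I.smult_assoc1)
    also have "\<dots> = r \<odot>\<^bsub>I\<^esub> x" using I_expand[OF x] by simp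
    finally show ?thesis .
  qed
  then have "f = mult_arrow r I" using restrict_eqI[OF g(2)] by (auto simp: g(1) mult_arrow_def)
  then show ?thesis using r by blast
qed

lemma mult_arrow_I_zero:
  assumes "r \<in> carrier R" "mult_arrow r I = hzero modR I I"
  shows "r = \<zero>"
proof -
  have b0: "bI 0 \<in> carrier I" using I.b_closed by simp
  have "r \<odot>\<^bsub>I\<^esub> bI 0 = \<zero>\<^bsub>I\<^esub>" using assms(2) b0 by (auto simp: mult_arrow_def fun_eq_iff restrict_def split: if_splits)
  then have "r \<otimes> I.crd (bI 0) 0 = I.crd (\<zero> \<odot>\<^bsub>I\<^esub> bI 0) 0"
    using I.crd_smult[OF assms(1) b0, of 0] b0 by simp
  then show ?thesis using I.crd_smult[of \<zero> "bI 0" 0] I.crd_basis[of 0 0] b0 assms(1) by simp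
qed

text \<open>The inclusions send the basis vector of \<open>I\<close> to those of \<open>M\<close>, the
  projections are the coordinate functions.\<close>

lemma ex_module_coords:
  assumes M: "is_fg_free R M" and b: "indexed_basis R M m b"
  shows "\<exists>w c. rc.coords I M m w c"
proof -
  interpret M: based_module R M m b
    by (intro based_module.intro based_module_axioms.intro fg_free_module M b)
  have b0: "bI 0 \<in> carrier I" using I.b_closed by simp
  define w where "w j = (I, \<lambda>x\<in>carrier I. I.crd x 0 \<odot>\<^bsub>M\<^esub> b j, M)" for j
  define c where "c j = (M, \<lambda>x\<in>carrier M. M.crd x j \<odot>\<^bsub>I\<^esub> bI 0, I)" for j
  have w: "w j \<in> homs modR I M" if "j < m" for j
    unfolding w_def mod_homs_iff using that I M M.b_closed I.crd_closed I.crd_add I.crd_smult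
    by (auto intro!: module_homsI fg_free_module simp: M.smult_l_distr M.smult_assoc1)
  have c: "c j \<in> homs modR M I" if "j < m" for j
    unfolding c_def mod_homs_iff using that I M b0 M.crd_closed M.crd_add M.crd_smult
    by (auto intro!: module_homsI fg_free_module simp: I.smult_l_distr I.smult_assoc1)
  have crdI: "I.crd (r \<odot>\<^bsub>I\<^esub> bI 0) 0 = r" if "r \<in> carrier R" for r
    using I.crd_smult[OF that b0, of 0] I.crd_basis[of 0 0] that by simp
  have wc: "cmp modR (w j) (c j) = (M, \<lambda>x\<in>carrier M. M.crd x j \<odot>\<^bsub>M\<^esub> b j, M)" if "j < m" for j
    using that b0 M.crd_closed by (auto simp: w_def c_def compose_def fun_eq_iff crdI)
  have cw: "cmp modR (c i) (w j) = (if i = j then ide modR I else hzero modR I I)" if "i < m" "j < m" for i j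
  proof -
    have "M.crd (r \<odot>\<^bsub>M\<^esub> b j) i = (if i = j then r else \<zero>)" if "r \<in> carrier R" for r
      using M.crd_smult[OF that M.b_closed \<open>i < m\<close>] M.crd_basis \<open>i < m\<close> \<open>j < m\<close> that by auto
    then show ?thesis using I.crd_closed M.b_closed[OF \<open>j < m\<close>] b0 I_expand
      by (auto simp: w_def c_def compose_def fun_eq_iff restrict_def)
  qed
  define part where "part k = (M, \<lambda>x\<in>carrier M. \<Oplus>\<^bsub>M\<^esub>j\<in>{..<k}. M.crd x j \<odot>\<^bsub>M\<^esub> b j, M)" for k
  have partial: "part k \<in> homs modR M M \<and>
      (\<Sum>j<k. rp (w j) * rp (c j)) = rp (part k)"
    (is "?P k") if "k \<le> m" for k
    using that
  proof (induction k)
    case 0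
    have "part 0 = hzero modR M M" by (simp add: part_def)
    then show ?case using cc.hzero_hom[of M M] cc.rep_hzero[of M M] M by simp
  next
    case (Suc k)
    have "(\<Oplus>\<^bsub>M\<^esub>j\<in>{..<Suc k}. M.crd x j \<odot>\<^bsub>M\<^esub> b j) = (\<Oplus>\<^bsub>M\<^esub>j\<in>{..<k}. M.crd x j \<odot>\<^bsub>M\<^esub> b j) \<oplus>\<^bsub>M\<^esub> M.crd x k \<odot>\<^bsub>M\<^esub> b k"
      if "x \<in> carrier M" for x
    proof -
      have cl: "M.crd x j \<odot>\<^bsub>M\<^esub> b j \<in> carrier M" if "j < m" for j
        using that \<open>x \<in> carrier M\<close> M.crd_closed M.b_closed by simp
      have fk: "(\<lambda>j. M.crd x j \<odot>\<^bsub>M\<^esub> b j) \<in> {..<k} \<rightarrow> carrier M" using cl Suc.prems by auto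
      from M.M.finsum_insert[OF _ _ fk, of k] show ?thesis
        using cl[of k] Suc.prems M.M.finsum_closed[OF fk] by (simp add: lessThan_Suc M.M.a_comm)
    qed
    then have eq: "part (Suc k) =
        hadd modR (part k) (cmp modR (w k) (c k))"
      using Suc.prems by (simp add: part_def wc fun_eq_iff restrict_def)
    have IH: "?P k" using Suc by simp
    have k: "k < m" using Suc.prems by simp
    show ?case
      unfolding eq using IH cc.hadd_hom[OF conjunct1[OF IH] cc.cmp_hom[OF c[OF k] w[OF k]]]
        cc.rep_hadd[OF conjunct1[OF IH] cc.cmp_hom[OF c[OF k] w[OF k]]] cc.rep_cmp[OF c[OF k] w[OF k]] by simp
  qed
  have "(\<Sum>j<m. rp (w j) * rp (c j)) = rp (ide modR M)"
  proof -
    have "part m = ide modR M"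
      using M.crd(2) by (auto simp: part_def fun_eq_iff restrict_def)
    then show ?thesis using partial[of m] by simp
  qed
  moreover have "rp (c i) * rp (w j) = (if i = j then rp (ide modR I) else 0)" if "i < m" "j < m" for i j
    using cc.rep_cmp[OF w[OF that(2)] c[OF that(1)]] cw[OF that] cc.rep_hzero[of I I] I by auto
  moreover have "M \<in> obj modR" using M by simp
  ultimately have "rc.coords I M m (\<lambda>j. rp (w j)) (\<lambda>j. rp (c j))"
    unfolding rc.coords_def using w c by blast
  then show ?thesis by blast
qed

theorem free_ring_category_modules:
  "free_ring_category central (obj modR) (\<lambda>A. rp (ide modR A)) cc.RH I"
proof (intro free_ring_category.intro rc.ring_category_axioms free_ring_category_axioms.intro)
  have elem: "\<exists>r\<in>carrier R. x = rp (mult_arrow r I)" if x: "x \<in> cc.RH I I" for x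
  proof -
    obtain f where f: "f \<in> homs modR I I" "x = rp f" using x by (elim imageE) simp
    then show ?thesis using end_I[OF f(1)] by auto
  qed
  show "I \<in> obj modR" using I by simp
  have h: "mult_arrow r I \<in> homs modR I I" if "r \<in> carrier R" for r using mult_arrow_hom[OF I that] .
  have II: "hzero modR I I \<in> homs modR I I" using cc.hzero_hom I by simp
  have cent: "central * rp (mult_arrow r I) = rp (mult_arrow (p \<otimes> r) I)" if "r \<in> carrier R" for r
    using cc.rep_central[OF h[OF that]] mult_arrow_simps(1)[OF I p(1) that] by simp
  have mul: "rp (mult_arrow r I) * rp (mult_arrow s I) = rp (mult_arrow (r \<otimes> s) I)"
    if "r \<in> carrier R" "s \<in> carrier R" for r s
    using cc.rep_cmp[OF h[OF that(2)] h[OF that(1)]] mult_arrow_simps(1)[OF I that] by simp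
  have zero: "r = \<zero>" if "r \<in> carrier R" "rp (mult_arrow r I) = 0" for r
  proof -
    have "rp (mult_arrow r I) = rp (hzero modR I I)" using cc.rep_hzero[of I I] I that by simp
    then show ?thesis using cc.rep_inject[OF h[OF that(1)] II] mult_arrow_I_zero that by blast
  qed
  have one: "rp (ide modR I) = rp (mult_arrow \<one> I)" using mult_arrow_simps(2)[OF I p(1) p(1)] by simp
  show "rp (ide modR I) \<noteq> 0" using zero[of \<one>] nontrivial one by auto
  show "\<exists>y\<in>cc.RH I I. x = central * y" if x: "x \<in> cc.RH I I" "central * x = 0" for x
  proof -
    obtain r where r: "r \<in> carrier R" "x = rp (mult_arrow r I)" using elem[OF x(1)] by (elim bexE) simp
    then have "p \<otimes> r = \<zero>" using x(2) cent zero p by simp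
    then obtain s where s: "s \<in> carrier R" "r = p \<otimes> s" using annihilator[OF r(1)] by auto
    then show ?thesis using cent[OF s(1)] h[OF s(1)] r(2) by (intro bexI[of _ "rp (mult_arrow s I)"]) auto
  qed
  show "(\<exists>y\<in>cc.RH I I. x = central * y) \<or> (\<exists>y\<in>cc.RH I I. x * y = rp (ide modR I) \<and> y * x = rp (ide modR I))"
    if x: "x \<in> cc.RH I I" for x
  proof -
    obtain r where r: "r \<in> carrier R" "x = rp (mult_arrow r I)" using elem[OF x(1)] by (elim bexE) simp
    from divisible_or_unit[OF r(1)] show ?thesis
    proof
      assume "\<exists>s\<in>carrier R. r = p \<otimes> s"
      then obtain s where s: "s \<in> carrier R" "r = p \<otimes> s" by (elim bexE) simp
      then show ?thesis using cent[OF s(1)] h[OF s(1)] r(2)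
        by (intro disjI1 bexI[of _ "rp (mult_arrow s I)"]) auto
    next
      assume "\<exists>s\<in>carrier R. r \<otimes> s = \<one>"
      then obtain s where s: "s \<in> carrier R" "r \<otimes> s = \<one>" by (elim bexE) simp
      then have "s \<otimes> r = \<one>" using r R.m_comm by simp
      then have "x * rp (mult_arrow s I) = rp (ide modR I)" "rp (mult_arrow s I) * x = rp (ide modR I)"
        using mul r s one by auto
      then show ?thesis using h[OF s(1)] by (intro disjI2 bexI[of _ "rp (mult_arrow s I)"]) auto
    qed
  qed
  show "\<exists>m w c. rc.coords I A m w c" if ob: "A \<in> obj modR" for A
  proof -
    have A: "is_fg_free R A" using ob by simp
    obtain m b where "indexed_basis R A m b" using ex_indexed_basis[OF A] by (elim exE) simp
    from ex_module_coords[OF A this] show ?thesis by (elim exE) (intro exI)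
  qed
  show "\<exists>A w c. rc.coords I A m w c" for m
  proof -
    obtain A :: "('r, 'u) module" and b where "is_fg_free R A" "indexed_basis R A m b"
      using ex_free_of_rank[of m] by (elim exE conjE)
    from ex_module_coords[OF this] show ?thesis by (elim exE) (intro exI)
  qed
qed

end

end

section \<open>From the ring to $n$-angulations\<close>

locale free_category = central_category C z for C :: "('o, 'a) addcat" and z +
  fixes I :: 'o and n :: nat
  assumes free: "free_ring_category central (obj C) (\<lambda>A. rep C z (ide C A)) RH I"
    and n3: "n \<ge> 3"
    and par: "even n \<or> (\<forall>A B. \<forall>x\<in>RH A B. central * x + central * x = 0)"
begin

sublocale ps: periodic_sequences central "obj C" "\<lambda>A. rep C z (ide C A)" RH I n
  by (intro periodic_sequences.intro free periodic_sequences_axioms.intro n3 par)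

abbreviation "rp \<equiv> rep C z"
abbreviation "Idf \<equiv> identity_functor :: ('o, 'a) endofun"

definition lift :: "'o \<Rightarrow> 'o \<Rightarrow> ('o, 'a) yoneda_end \<Rightarrow> 'a" where
  "lift A B x = inv_into (homs C A B) rp x"

lemma lift: "x \<in> RH A B \<Longrightarrow> lift A B x \<in> homs C A B" "x \<in> RH A B \<Longrightarrow> rp (lift A B x) = x"
  unfolding lift_def by (rule inv_into_into, assumption) (rule f_inv_into_f)

lemma RH: "f \<in> homs C A B \<Longrightarrow> rp f \<in> RH A B" by simp

lemma homs_eqI: "f \<in> homs C A B \<Longrightarrow> g \<in> homs C A B \<Longrightarrow> rp f = rp g \<Longrightarrow> f = g"
  by (rule rep_inject)

text \<open>The place between 1 and \<open>n\<close> at which the periodic continuation of a sequence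
  takes its entry with index \<open>k\<close>.\<close>

definition idx :: "nat \<Rightarrow> nat" where
  "idx k = (if k mod n = 0 then n else k mod n)"

lemma idx_range: "idx k \<in> {1..n}"
  using n3 by (auto simp: idx_def intro: less_imp_le)

lemma idx_id: "i \<in> {1..n} \<Longrightarrow> idx i = i"
  by (cases "i = n") (auto simp: idx_def)

lemma idx_mod: "idx k mod n = k mod n"
  by (simp add: idx_def)

lemma idx_cong: "k mod n = l mod n \<Longrightarrow> idx k = idx l"
  by (simp add: idx_def)

lemma idx_Suc_idx: "idx (Suc (idx k)) = idx (Suc k)"
  by (intro idx_cong) (metis idx_mod mod_Suc_eq)

lemma idx_add: "idx (k + n) = idx k" "idx (Suc (k + n)) = idx (Suc k)"
  by (simp add: idx_def) (metis idx_def add_Suc mod_add_self2)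

lemma idx_eq_n: "idx k = n \<longleftrightarrow> k mod n = 0"
proof -
  have "k mod n < n" using n3 by simp
  then show ?thesis using less_imp_neq by (auto simp: idx_def)
qed

lemma idx_numeral: "idx 1 = 1" "idx (Suc 0) = 1" "idx 2 = 2" "idx (Suc 1) = 2" "idx n = n" "idx 0 = n"
  using n3 by (auto simp: idx_id) (simp_all add: idx_def)

lemma idx_all: "(\<forall>i\<in>{1..n}. Q i) \<longleftrightarrow> (\<forall>k. Q (idx k))"
  using idx_range idx_id by metis

lemma ext_id:
  assumes "\<And>x. F x = x" "1 \<le> i" "i \<le> n + n"
  shows "ext F n x i = x (idx i)"
proof (cases "i \<le> n")
  case True
  then show ?thesis using assms by (simp add: ext_def idx_id)
next
  case False
  then have "idx i = idx (i - n)" by (intro idx_cong) (simp add: le_mod_geq)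
  also have "\<dots> = i - n" using False assms by (intro idx_id) auto
  finally show ?thesis using False assms by (simp add: ext_def)
qed

lemma fbip_id: "fbip Idf D = D"
  by (simp add: fbip_def identity_functor_def)

lemma Id_simps [simp]: "fob Idf A = A" "far Idf f = f"
  by (simp_all add: identity_functor_def)

lemma ext_Suc:
  "ext (fob Idf) n x (idx k + 1) = x (idx (Suc k))" "ext (far Idf) n y (idx k + 1) = y (idx (Suc k))"
  "ext (fbip Idf) n w (idx k + 1) = w (idx (Suc k))"
  "ext (fob Idf) n x (idx k + 2) = x (idx (Suc (Suc k)))" 
proof -
  have 1: "1 \<le> idx k + 1" "idx k + 1 \<le> n + n" "1 \<le> idx k + 2" "idx k + 2 \<le> n + n"
    using idx_range[of k] n3 by auto
  have 2: "idx (idx k + 1) = idx (Suc k)" "idx (idx k + 2) = idx (Suc (Suc k))"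
    using idx_Suc_idx[of k] by simp (metis idx_Suc_idx add_2_eq_Suc' idx_cong idx_mod mod_Suc_eq)
  show "ext (fob Idf) n x (idx k + 1) = x (idx (Suc k))" "ext (far Idf) n y (idx k + 1) = y (idx (Suc k))"
    "ext (fbip Idf) n w (idx k + 1) = w (idx (Suc k))" "ext (fob Idf) n x (idx k + 2) = x (idx (Suc (Suc k)))"
    using 1 2 fbip_id by (simp_all add: ext_id)
qed

definition obs :: "('o, 'a) nseq \<Rightarrow> nat \<Rightarrow> 'o" where
  "obs A k = sob A (idx k)"

definition ars :: "('o, 'a) nseq \<Rightarrow> nat \<Rightarrow> ('o, 'a) yoneda_end" where
  "ars A k = rp (sar A (idx k))"

lemma is_nseq_iff:
  "is_nseq C Idf n A \<longleftrightarrow> (\<forall>k. obs A k \<in> obj C \<and> sar A (idx k) \<in> homs C (obs A k) (obs A (Suc k)))"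
  unfolding is_nseq_def idx_all by (simp only: ext_Suc obs_def)

lemma sar_hom: "is_nseq C Idf n A \<Longrightarrow> sar A (idx k) \<in> homs C (obs A k) (obs A (Suc k))"
  and sob_obj: "is_nseq C Idf n A \<Longrightarrow> obs A k \<in> obj C"
  by (simp_all add: is_nseq_iff)

lemma nseq: "is_nseq C Idf n A \<Longrightarrow> ps.nseq (obs A) (ars A)"
  by (auto simp: ps.nseq_def ars_def sar_hom) (simp_all add: obs_def idx_add)

lemma candidate_iff: "is_candidate C Idf n A \<longleftrightarrow> is_nseq C Idf n A \<and> ps.complex (obs A) (ars A)"
proof (cases "is_nseq C Idf n A")
  case True
  note h = sar_hom[OF True]
  have "cmp C (sar A (idx (Suc k))) (sar A (idx k)) = hzero C (obs A k) (obs A (Suc (Suc k))) \<longleftrightarrow>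
      ars A (Suc k) * ars A k = 0" for k
  proof -
    have "rp (cmp C (sar A (idx (Suc k))) (sar A (idx k))) = ars A (Suc k) * ars A k"
      using rep_cmp[OF h h] by (simp add: ars_def)
    moreover have "rp (hzero C (obs A k) (obs A (Suc (Suc k)))) = 0" using rep_hzero sob_obj[OF True] by simp
    ultimately show ?thesis
      using homs_eqI[OF cmp_hom[OF h h] hzero_hom[OF sob_obj[OF True] sob_obj[OF True]]] by metis
  qed
  then show ?thesis
    using True nseq[OF True] unfolding is_candidate_def ps.complex_def idx_all ext_Suc by (simp add: obs_def)
qed (simp add: is_candidate_def)

text \<open>Elements of the ring that lie in the image of a set of morphisms are turned back into
  morphisms.\<close>

lemma realize:
  assumes "ps.nseq ob a"
  shows "\<exists>A. is_nseq C Idf n A \<and> obs A = ob \<and> ars A = a"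
proof -
  note N = ps.nseqD[OF assms]
  define A where "A = \<lparr>sob = ob, sar = (\<lambda>k. lift (ob k) (ob (Suc k)) (a k))\<rparr>"
  have per: "ob (idx k) = ob k" "ob (Suc (idx k)) = ob (Suc k)" "a (idx k) = a k" for k
    using ps.periodic_cong[of ob, OF N(1)] ps.periodic_cong[of a, OF N(2)] idx_mod by (metis mod_Suc_eq)+
  have "obs A = ob" by (simp add: fun_eq_iff obs_def A_def per)
  moreover have "ars A = a" using lift(2)[OF N(3)] by (simp add: fun_eq_iff ars_def A_def per)
  moreover have "is_nseq C Idf n A"
    unfolding is_nseq_iff \<open>obs A = ob\<close> using lift(1)[OF N(3)] N(4) by (simp add: A_def per)
  ultimately show ?thesis by blast
qed

lemma bip_rep:
  assumes "is_biproduct C A B D"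
  shows "ps.bip (bobj D) A B (rp (in1 D)) (rp (in2 D)) (rp (pr1 D)) (rp (pr2 D))"
proof -
  have D: "A \<in> obj C" "B \<in> obj C" "bobj D \<in> obj C" "in1 D \<in> homs C A (bobj D)" "in2 D \<in> homs C B (bobj D)"
    "pr1 D \<in> homs C (bobj D) A" "pr2 D \<in> homs C (bobj D) B"
    "cmp C (pr1 D) (in1 D) = ide C A" "cmp C (pr2 D) (in2 D) = ide C B"
    "cmp C (pr2 D) (in1 D) = hzero C A B" "cmp C (pr1 D) (in2 D) = hzero C B A"
    "hadd C (cmp C (in1 D) (pr1 D)) (cmp C (in2 D) (pr2 D)) = ide C (bobj D)"
    using assms unfolding is_biproduct_def by auto
  show ?thesis unfolding ps.bip_def
    using D rep_cmp[OF D(4,6)] rep_cmp[OF D(5,7)] rep_cmp[OF D(4,7)] rep_cmp[OF D(5,6)]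
      rep_cmp[OF D(6,4)] rep_cmp[OF D(7,5)] rep_hadd[OF cmp_hom[OF D(6,4)] cmp_hom[OF D(7,5)]]
      rep_hzero[OF D(1,2)] rep_hzero[OF D(2,1)] by simp
qed

lemma bip_lift:
  assumes "ps.bip S A B u v q r"
  shows "is_biproduct C A B \<lparr>bobj = S, in1 = lift A S u, in2 = lift B S v, pr1 = lift S A q, pr2 = lift S B r\<rparr>"
proof -
  note D = ps.bipD[OF assms] and ob = ps.bip_obj[OF assms]
  note L = lift(1)[OF D(1)] lift(1)[OF D(2)] lift(1)[OF D(3)] lift(1)[OF D(4)]
  note R = lift(2)[OF D(1)] lift(2)[OF D(2)] lift(2)[OF D(3)] lift(2)[OF D(4)]
  have ob: "S \<in> obj C" "A \<in> obj C" "B \<in> obj C" using ob by auto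
  have "cmp C (lift S A q) (lift A S u) = ide C A"
    by (rule homs_eqI[OF cmp_hom[OF L(1,3)] ide_hom[OF ob(2)]]) (simp add: rep_cmp[OF L(1,3)] R D)
  moreover have "cmp C (lift S B r) (lift B S v) = ide C B"
    by (rule homs_eqI[OF cmp_hom[OF L(2,4)] ide_hom[OF ob(3)]]) (simp add: rep_cmp[OF L(2,4)] R D)
  moreover have "cmp C (lift S B r) (lift A S u) = hzero C A B"
    by (rule homs_eqI[OF cmp_hom[OF L(1,4)] hzero_hom[OF ob(2,3)]]) (simp add: rep_cmp[OF L(1,4)] R D rep_hzero ob)
  moreover have "cmp C (lift S A q) (lift B S v) = hzero C B A"
    by (rule homs_eqI[OF cmp_hom[OF L(2,3)] hzero_hom[OF ob(3,2)]]) (simp add: rep_cmp[OF L(2,3)] R D rep_hzero ob)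
  moreover have "hadd C (cmp C (lift A S u) (lift S A q)) (cmp C (lift B S v) (lift S B r)) = ide C S"
    by (rule homs_eqI[OF hadd_hom[OF cmp_hom[OF L(3,1)] cmp_hom[OF L(4,2)]] ide_hom[OF ob(1)]])
      (simp add: rep_hadd[OF cmp_hom[OF L(3,1)] cmp_hom[OF L(4,2)]] rep_cmp[OF L(3,1)] rep_cmp[OF L(4,2)] R D)
  ultimately show ?thesis using L ob by (simp add: is_biproduct_def)
qed

lemma bimat:
  assumes D: "is_biproduct C X1 X2 D" and E: "is_biproduct C Y1 Y2 E"
    and h: "a \<in> homs C X1 Y1" "b \<in> homs C X2 Y1" "c \<in> homs C X1 Y2" "d \<in> homs C X2 Y2"
  shows "bimat C D E a b c d \<in> homs C (bobj D) (bobj E)"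
    and "rp (bimat C D E a b c d) = rp (in1 E) * (rp a * rp (pr1 D)) + rp (in1 E) * (rp b * rp (pr2 D))
      + (rp (in2 E) * (rp c * rp (pr1 D)) + rp (in2 E) * (rp d * rp (pr2 D)))"
proof -
  have pr: "pr1 D \<in> homs C (bobj D) X1" "pr2 D \<in> homs C (bobj D) X2" "in1 E \<in> homs C Y1 (bobj E)"
    "in2 E \<in> homs C Y2 (bobj E)" using D E by (auto simp: is_biproduct_def)
  note A = cmp_hom[OF pr(1) h(1)] and B = cmp_hom[OF pr(2) h(2)] and C = cmp_hom[OF pr(1) h(3)] and F = cmp_hom[OF pr(2) h(4)]
  note A' = cmp_hom[OF A pr(3)] and B' = cmp_hom[OF B pr(3)] and C' = cmp_hom[OF C pr(4)] and F' = cmp_hom[OF F pr(4)]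
  show "bimat C D E a b c d \<in> homs C (bobj D) (bobj E)"
    unfolding bimat_def by (intro hadd_hom A' B' C' F')
  show "rp (bimat C D E a b c d) = rp (in1 E) * (rp a * rp (pr1 D)) + rp (in1 E) * (rp b * rp (pr2 D))
      + (rp (in2 E) * (rp c * rp (pr1 D)) + rp (in2 E) * (rp d * rp (pr2 D)))"
    unfolding bimat_def
    by (simp add: rep_hadd[OF hadd_hom[OF A' B'] hadd_hom[OF C' F']] rep_hadd[OF A' B'] rep_hadd[OF C' F']
      rep_cmp[OF A pr(3)] rep_cmp[OF B pr(3)] rep_cmp[OF C pr(4)] rep_cmp[OF F pr(4)]
      rep_cmp[OF pr(1) h(1)] rep_cmp[OF pr(2) h(2)] rep_cmp[OF pr(1) h(3)] rep_cmp[OF pr(2) h(4)])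
qed

lemma direct_sum:
  assumes S: "is_direct_sum C Idf n S A B" and A: "is_nseq C Idf n A" and B: "is_nseq C Idf n B"
  shows "is_nseq C Idf n S \<and> (\<exists>u v q r. (\<forall>k. ps.bip (obs S k) (obs A k) (obs B k) (u k) (v k) (q k) (r k) \<and>
    u (k + n) = u k \<and> v (k + n) = v k \<and> q (k + n) = q k \<and> r (k + n) = r k \<and>
    ars S k = u (Suc k) * ars A k * q k + v (Suc k) * ars B k * r k))"
proof -
  obtain D where "\<forall>i\<in>{1..n}. is_biproduct C (sob A i) (sob B i) (D i) \<and> sob S i = bobj (D i) \<and>
        sar S i = bimat C (D i) (ext (fbip Idf) n D (i + 1))
          (sar A i) (hzero C (sob B i) (xob Idf n A (i + 1)))
          (hzero C (sob A i) (xob Idf n B (i + 1))) (sar B i)"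
    using S unfolding is_direct_sum_def by (elim exE)
  then have D: "is_biproduct C (obs A k) (obs B k) (D (idx k))" "obs S k = bobj (D (idx k))"
    "sar S (idx k) = bimat C (D (idx k)) (D (idx (Suc k))) (sar A (idx k)) (hzero C (obs B k) (obs A (Suc k)))
          (hzero C (obs A k) (obs B (Suc k))) (sar B (idx k))" for k
    unfolding idx_all ext_Suc by (simp_all add: obs_def)
  note z = hzero_hom[OF sob_obj[OF B] sob_obj[OF A]] hzero_hom[OF sob_obj[OF A] sob_obj[OF B]]
  note bm = bimat[OF D(1) D(1) sar_hom[OF A] z sar_hom[OF B]]
  have "is_nseq C Idf n S"
    unfolding is_nseq_iff D(2,3) using bm(1) D(1) by (auto simp: is_biproduct_def)
  moreover have "ars S k = rp (in1 (D (idx (Suc k)))) * ars A k * rp (pr1 (D (idx k))) +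
     rp (in2 (D (idx (Suc k)))) * ars B k * rp (pr2 (D (idx k)))" for k
    using bm(2)[of k] unfolding ars_def D(3)
    by (simp add: rep_hzero[OF sob_obj[OF B] sob_obj[OF A]] rep_hzero[OF sob_obj[OF A] sob_obj[OF B]] mult.assoc)
  ultimately show ?thesis
    using bip_rep[OF D(1)] D(2)
    by (intro conjI exI[of _ "\<lambda>k. rp (in1 (D (idx k)))"] exI[of _ "\<lambda>k. rp (in2 (D (idx k)))"]
      exI[of _ "\<lambda>k. rp (pr1 (D (idx k)))"] exI[of _ "\<lambda>k. rp (pr2 (D (idx k)))"]) (simp_all add: idx_add)
qed

definition angles :: "('o, 'a) nseq set" where
  "angles = {A. is_nseq C Idf n A \<and> ps.angle (obs A) (ars A)}"

lemma direct_sum_angles: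
  assumes "A \<in> angles" "B \<in> angles" "is_direct_sum C Idf n S A B"
  shows "S \<in> angles"
proof -
  have A: "is_nseq C Idf n A" "ps.angle (obs A) (ars A)" and B: "is_nseq C Idf n B" "ps.angle (obs B) (ars B)"
    using assms by (auto simp: angles_def)
  from direct_sum[OF assms(3) A(1) B(1)] obtain u v q r where S: "is_nseq C Idf n S"
    and all: "\<forall>k. ps.bip (obs S k) (obs A k) (obs B k) (u k) (v k) (q k) (r k) \<and>
      u (k + n) = u k \<and> v (k + n) = v k \<and> q (k + n) = q k \<and> r (k + n) = r k \<and>
      ars S k = u (Suc k) * ars A k * q k + v (Suc k) * ars B k * r k"
    by (elim exE conjE)
  have D: "ps.bip (obs S k) (obs A k) (obs B k) (u k) (v k) (q k) (r k)"
    "q (k + n) = q k" "r (k + n) = r k"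
    "ars S k = u (Suc k) * ars A k * q k + v (Suc k) * ars B k * r k" for k using all by blast+
  have "ps.angle (obs S) (ars S)"
    using D(2)[of 1] D(3)[of 1] by (intro ps.angle_sum[OF A(2) B(2) nseq[OF S] D(1) _ _ D(4)]) simp_all
  then show ?thesis using S by (simp add: angles_def)
qed

lemma summand_angles:
  assumes S: "S \<in> angles" and A: "is_nseq C Idf n A" and B: "is_nseq C Idf n B" and ds: "is_direct_sum C Idf n S A B"
  shows "A \<in> angles \<and> B \<in> angles"
proof -
  from direct_sum[OF ds A B] obtain u v q r where all: "\<forall>k. ps.bip (obs S k) (obs A k) (obs B k) (u k) (v k) (q k) (r k) \<and>
      u (k + n) = u k \<and> v (k + n) = v k \<and> q (k + n) = q k \<and> r (k + n) = r k \<and>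
      ars S k = u (Suc k) * ars A k * q k + v (Suc k) * ars B k * r k"
    by (elim exE conjE)
  have D: "ps.bip (obs S k) (obs A k) (obs B k) (u k) (v k) (q k) (r k)"
    and per: "u (k + n) = u k" "v (k + n) = v k"
    and s: "ars S k = u (Suc k) * ars A k * q k + v (Suc k) * ars B k * r k" for k using all by blast+
  have ang: "ps.angle (obs S) (ars S)" using S by (simp add: angles_def)
  note b = ps.bipD[OF D] and NA = ps.nseqD(3)[OF nseq[OF A]] and NB = ps.nseqD(3)[OF nseq[OF B]]
  have r: "q k * (u k * x) = rp (ide C (obs A k)) * x" "r k * (v k * x) = rp (ide C (obs B k)) * x"
    "q k * (v k * x) = 0" "r k * (u k * x) = 0" for k x
    by (simp_all add: b flip: mult.assoc)
  have "ps.angle (obs A) (ars A)"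
    using per(1)[of 1] by (intro ps.angle_retract[OF ang nseq[OF A] b(1) b(3)])
      (simp_all add: b s algebra_simps r ps.id_right[OF NA] ps.id_left_assoc[OF NA])
  moreover have "ps.angle (obs B) (ars B)"
    using per(2)[of 1] by (intro ps.angle_retract[OF ang nseq[OF B] b(2) b(4)])
      (simp_all add: b s algebra_simps r ps.id_right[OF NB] ps.id_left_assoc[OF NB])
  ultimately show ?thesis using A B by (simp add: angles_def)
qed

lemma isomorphic_angle_iff:
  assumes A: "is_nseq C Idf n A" and B: "is_nseq C Idf n B" and iso: "isomorphic_nseqs C Idf n A B"
  shows "ps.angle (obs A) (ars A) \<longleftrightarrow> ps.angle (obs B) (ars B)"
proof -
  obtain \<phi> where m: "is_nseq_morphism C Idf n A B \<phi>" and i: "\<forall>i\<in>{1..n}. is_iso C (\<phi> i)"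
    using iso unfolding isomorphic_nseqs_def by (elim exE conjE)
  have \<phi>: "\<phi> (idx k) \<in> homs C (obs A k) (obs B k)"
    and c: "cmp C (\<phi> (idx (Suc k))) (sar A (idx k)) = cmp C (sar B (idx k)) (\<phi> (idx k))" for k
    using m unfolding is_nseq_morphism_def idx_all ext_Suc by (simp_all add: obs_def)
  define f where "f k = rp (\<phi> (idx k))" for k
  have f: "f k \<in> RH (obs A k) (obs B k)" for k using \<phi> by (simp add: f_def)
  have fc: "f (Suc k) * ars A k = ars B k * f k" for k
    using arg_cong[OF c[of k], of rp] rep_cmp[OF sar_hom[OF A] \<phi>] rep_cmp[OF \<phi> sar_hom[OF B]]
    by (simp add: f_def ars_def)
  have "\<exists>g. g \<in> RH (obs B k) (obs A k) \<and> g * f k = rp (ide C (obs A k)) \<and> f k * g = rp (ide C (obs B k))" for k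
  proof -
    have "is_iso C (\<phi> (idx k))" using i idx_range by blast
    then obtain g where g: "g \<in> homs C (obs B k) (obs A k)" "cmp C g (\<phi> (idx k)) = ide C (obs A k)"
      "cmp C (\<phi> (idx k)) g = ide C (obs B k)"
      using \<phi>[of k] by (auto simp: is_iso_def homs_def)
    then show ?thesis using rep_cmp[OF \<phi> g(1)] rep_cmp[OF g(1) \<phi>] by (intro exI[of _ "rp g"]) (simp add: f_def)
  qed
  then obtain g0 where g0: "\<And>k. g0 k \<in> RH (obs B k) (obs A k)" "\<And>k. g0 k * f k = rp (ide C (obs A k))"
    "\<And>k. f k * g0 k = rp (ide C (obs B k))" by metis
  define g where "g k = g0 (idx k)" for k
  have idx2: "obs A (idx k) = obs A k" "obs B (idx k) = obs B k" "f (idx k) = f k" for k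
    by (simp_all add: obs_def f_def idx_id[OF idx_range])
  have g: "g k \<in> RH (obs B k) (obs A k)" and gf: "g k * f k = rp (ide C (obs A k))"
    and fg: "f k * g k = rp (ide C (obs B k))" for k
    using g0[of "idx k"] idx2 by (simp_all add: g_def)
  have gc: "g (Suc k) * ars B k = ars A k * g k" for k
  proof -
    note NA = ps.nseqD(3)[OF nseq[OF A], of k] and NB = ps.nseqD(3)[OF nseq[OF B], of k]
    have "g (Suc k) * ars B k = g (Suc k) * (ars B k * (f k * g k))" using fg ps.id_right[OF NB] by simp
    also have "\<dots> = g (Suc k) * (ars B k * f k) * g k" by (simp add: mult.assoc)
    also have "ars B k * f k = f (Suc k) * ars A k" by (simp add: fc)
    also have "g (Suc k) * (f (Suc k) * ars A k) * g k = (g (Suc k) * f (Suc k)) * ars A k * g k" by (simp add: mult.assoc)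
    finally show ?thesis using gf ps.id_left[OF NA] by simp
  qed
  have per: "f (Suc n) = f 1" "g (Suc n) = g 1" using idx_add(2)[of 0] by (simp_all add: f_def g_def)
  show ?thesis
    using ps.angle_retract[OF _ nseq[OF B] g f per(2) fg gc fc] ps.angle_retract[OF _ nseq[OF A] f g per(1) gf fc gc] by blast
qed

lemma zero_object_iff:
  assumes "Z \<in> obj C"
  shows "is_zero_object C Z \<longleftrightarrow> rp (ide C Z) = 0"
proof
  assume "is_zero_object C Z"
  then have "\<exists>!f. f \<in> homs C Z Z" using assms by (auto simp: is_zero_object_def)
  then have "ide C Z = hzero C Z Z" using ide_hom[OF assms] hzero_hom[OF assms assms] by blast
  then show "rp (ide C Z) = 0" using rep_hzero[OF assms assms] by simp
next
  assume 0: "rp (ide C Z) = 0"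
  show "is_zero_object C Z"
    unfolding is_zero_object_def
  proof (intro conjI assms ballI)
    fix A assume A: "A \<in> obj C"
    note z = hzero_hom[OF A assms] hzero_hom[OF assms A]
    have "f = hzero C A Z" if f: "f \<in> homs C A Z" for f
      by (rule homs_eqI[OF f z(1)]) (use ps.id_left[OF RH[OF f]] 0 rep_hzero[OF A assms] in simp)
    then show "\<exists>!f. f \<in> homs C A Z" using z by blast
    have "f = hzero C Z A" if f: "f \<in> homs C Z A" for f
      by (rule homs_eqI[OF f z(2)]) (use ps.id_right[OF RH[OF f]] 0 rep_hzero[OF assms A] in simp)
    then show "\<exists>!f. f \<in> homs C Z A" using z by blast
  qed
qed

lemma additive: "additive_category C"
proof
  obtain Z where "Z \<in> obj C" "rp (ide C Z) = 0" using ps.ex_zero by (elim bexE)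
  then show "\<exists>Z. is_zero_object C Z" using zero_object_iff by blast
  fix A B assume AB: "A \<in> obj C" "B \<in> obj C"
  from ps.ex_bip[OF AB] obtain S u v q r where "ps.bip S A B u v q r" by (elim exE)
  then show "\<exists>D. is_biproduct C A B D" using bip_lift by blast
qed

lemma trivial_angles:
  assumes X: "X \<in> obj C" and Z: "is_zero_object C Z"
  shows "trivial_nseq C Idf n X Z \<in> angles"
proof -
  let ?A = "trivial_nseq C Idf n X Z"
  have Zo: "Z \<in> obj C" "rp (ide C Z) = 0" using Z zero_object_iff by (auto simp: is_zero_object_def)
  have two: "idx k \<le> 2 \<longleftrightarrow> k mod n = 1 \<or> k mod n = Suc 1 mod n" for k
    using n3 by (auto simp: idx_def)
  have one: "idx k = 1 \<longleftrightarrow> k mod n = 1" for k using n3 by (auto simp: idx_def)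
  have o: "obs ?A = (\<lambda>k. if k mod n = 1 \<or> k mod n = Suc 1 mod n then X else Z)"
    by (simp add: fun_eq_iff obs_def trivial_nseq_def Let_def two)
  have sar: "sar ?A (idx k) = (if k mod n = 1 then ide C X else hzero C (obs ?A k) (obs ?A (Suc k)))" for k
    unfolding obs_def trivial_nseq_def Let_def using ext_Suc(1)[of "\<lambda>i. if i \<le> 2 then X else Z" k] by (simp add: one[simplified])
  have oo: "obs ?A k \<in> obj C" for k using X Zo by (simp add: o)
  have a: "ars ?A = (\<lambda>k. if k mod n = 1 then rp (ide C X) else 0)"
    using rep_hzero[OF oo oo] by (simp add: fun_eq_iff ars_def sar)
  have "sar ?A (idx k) \<in> homs C (obs ?A k) (obs ?A (Suc k))" for k
  proof (cases "k mod n = 1")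
    case True
    then have "Suc k mod n = Suc 1 mod n" by (metis mod_Suc_eq)
    then show ?thesis using True ide_hom[OF X] by (simp add: sar o)
  next
    case False
    then show ?thesis using hzero_hom[OF oo oo] by (simp add: sar)
  qed
  then have "is_nseq C Idf n ?A" using oo by (simp add: is_nseq_iff)
  moreover have "ps.angle (obs ?A) (ars ?A)" unfolding o a using n3 by (intro ps.elementary_angle X Zo) simp
  ultimately show ?thesis by (simp add: angles_def)
qed

lemma first_angles:
  assumes "f \<in> arr C"
  shows "\<exists>A\<in>angles. sar A 1 = f"
proof -
  have f: "f \<in> homs C (src C f) (tgt C f)" using assms by (simp add: homs_def)
  obtain ob a where a: "ps.angle ob a" "ob 1 = src C f" "ob 2 = tgt C f" "a 1 = rp f"
    using ps.every_morphism_first[OF RH[OF f]] unfolding ps.first_def by (elim exE conjE)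
  obtain A where A: "is_nseq C Idf n A" "obs A = ob" "ars A = a"
    using realize[OF ps.angleD(3)[OF a(1)]] by (elim exE conjE)
  have "sar A 1 \<in> homs C (src C f) (tgt C f)"
    using sar_hom[OF A(1), of 1] a A(2) by (simp add: idx_numeral numeral_2_eq_2)
  moreover have "rp (sar A 1) = rp f" using A(3) a(4) by (auto simp: ars_def idx_numeral fun_eq_iff dest: spec[of _ 1])
  ultimately have "sar A 1 = f" by (rule homs_eqI[OF _ f])
  then show ?thesis using A a by (auto simp: angles_def)
qed

text \<open>The monodromies at two neighbouring positions are conjugate under the connecting homomorphism
  between them. The sign of the rotation multiplies the monodromy by $(-1)^n$, which is 1
  modulo \<open>p\<close>: for odd \<open>n\<close> by the assumption $2p = 0$.\<close>

lemma rotation_angles: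
  assumes A: "is_nseq C Idf n A"
  shows "A \<in> angles \<longleftrightarrow> left_rotation C Idf n A \<in> angles"
proof -
  let ?L = "left_rotation C Idf n A"
  have o: "obs ?L = (\<lambda>k. obs A (Suc k))"
    by (simp add: fun_eq_iff obs_def left_rotation_def ext_Suc(1)[simplified])
  have s1: "sar A 1 \<in> homs C (obs A (Suc k)) (obs A (Suc (Suc k)))" if "k mod n = 0" for k
  proof -
    have "idx (Suc k) = 1" using that n3 by (metis idx_cong idx_numeral(2) mod_0 mod_Suc_eq)
    then show ?thesis using sar_hom[OF A, of "Suc k"] by simp
  qed
  have sar: "sar ?L (idx k) = (if k mod n = 0 then if even n then sar A 1 else hneg C (sar A 1) else sar A (idx (Suc k)))" for k
  proof (cases "k mod n = 0")
    case True
    then show ?thesis using idx_eq_n[of k] by (simp add: left_rotation_def)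
  next
    case False
    then have "idx k \<noteq> n" using idx_eq_n by simp
    then have "idx (Suc k) = idx k + 1" using idx_range[of k] by (subst idx_Suc_idx[symmetric], subst idx_id) auto
    then show ?thesis using False \<open>idx k \<noteq> n\<close> by (simp add: left_rotation_def)
  qed
  have "is_nseq C Idf n ?L"
    unfolding is_nseq_iff o sar using sob_obj[OF A] s1 hneg_hom[OF s1] sar_hom[OF A, of "Suc _"] by auto
  moreover have "ars ?L = ps.rot (ars A)"
  proof
    fix k
    have "idx (Suc k) = 1" if "k mod n = 0" using that n3 by (metis idx_cong idx_numeral(2) mod_0 mod_Suc_eq)
    then show "ars ?L k = ps.rot (ars A) k"
      using rep_hneg[OF s1[of k]] by (auto simp: ars_def sar ps.rot_def)
  qed
  ultimately show ?thesis
    using A ps.rotation_angle[OF nseq[OF A]] by (simp add: angles_def o)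
qed

lemma extension_angles:
  assumes A: "A \<in> angles" and B: "B \<in> angles"
    and f: "f1 \<in> homs C (sob A 1) (sob B 1)" "f2 \<in> homs C (sob A 2) (sob B 2)"
    and c: "cmp C f2 (sar A 1) = cmp C (sar B 1) f1"
  shows "\<exists>\<phi>. \<phi> 1 = f1 \<and> \<phi> 2 = f2 \<and> is_nseq_morphism C Idf n A B \<phi> \<and>
        (\<forall>D. (\<forall>i\<in>{1..n}. is_biproduct C (xob Idf n A (i + 1)) (sob B i) (D i)) \<longrightarrow>
           mapping_cone C Idf n A B \<phi> D \<in> angles)"
proof -
  have A: "is_nseq C Idf n A" "ps.angle (obs A) (ars A)" and B: "is_nseq C Idf n B" "ps.angle (obs B) (ars B)"
    using A B by (auto simp: angles_def)
  have o12: "obs A 1 = sob A 1" "obs A 2 = sob A 2" "obs B 1 = sob B 1" "obs B 2 = sob B 2"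
    "ars A 1 = rp (sar A 1)" "ars B 1 = rp (sar B 1)"
    by (simp_all only: obs_def ars_def idx_numeral)
  have h1: "sar A 1 \<in> homs C (sob A 1) (sob A 2)" "sar B 1 \<in> homs C (sob B 1) (sob B 2)"
    using sar_hom[OF A(1), of 1] sar_hom[OF B(1), of 1] unfolding obs_def idx_numeral by simp_all
  have "rp f1 \<in> RH (obs A 1) (obs B 1)" "rp f2 \<in> RH (obs A 2) (obs B 2)" "rp f2 * ars A 1 = ars B 1 * rp f1"
    using f c rep_cmp[OF h1(1) f(2)] rep_cmp[OF f(1) h1(2)] unfolding o12 by auto
  from ps.extension_with_cone[OF A(2) B(2) this] obtain g where g12: "g 1 = rp f1" "g 2 = rp f2"
    and g': "\<forall>k. g k \<in> RH (obs A k) (obs B k) \<and> g (k + n) = g k \<and> g (Suc k) * ars A k = ars B k * g k"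
    and cone: "\<forall>od U V P Q. (\<forall>k. ps.bip (od k) (obs A (Suc k)) (obs B k) (U k) (V k) (P k) (Q k) \<and> od (k + n) = od k \<and>
       U (k + n) = U k \<and> V (k + n) = V k \<and> P (k + n) = P k \<and> Q (k + n) = Q k) \<longrightarrow>
       ps.angle od (ps.cone (ars A) (ars B) g U V P Q)"
    by (elim exE conjE)
  have g: "g k \<in> RH (obs A k) (obs B k)" "g (k + n) = g k" "g (Suc k) * ars A k = ars B k * g k" for k
    using g' by auto
  define \<phi> where "\<phi> k = lift (obs A k) (obs B k) (g k)" for k
  have gi: "g (idx k) = g k" for k using ps.periodic_cong[of g, OF g(2) idx_mod] .
  have \<phi>: "\<phi> (idx k) \<in> homs C (obs A k) (obs B k)" and r\<phi>: "rp (\<phi> (idx k)) = g k" for k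
    using lift[OF g(1)[of "idx k"]] gi[of k] by (simp_all add: \<phi>_def obs_def idx_id[OF idx_range])
  have "\<phi> 1 = f1" using homs_eqI[OF \<phi>[of 1, unfolded o12] f(1)] r\<phi>[of 1] g12 unfolding idx_numeral by simp
  moreover have "\<phi> 2 = f2" using homs_eqI[OF \<phi>[of 2, unfolded o12] f(2)] r\<phi>[of 2] g12 unfolding idx_numeral by simp
  moreover have "is_nseq_morphism C Idf n A B \<phi>"
    unfolding is_nseq_morphism_def idx_all ext_Suc
  proof (intro allI conjI)
    fix k
    show "\<phi> (idx k) \<in> homs C (sob A (idx k)) (sob B (idx k))" using \<phi>[of k] by (simp add: obs_def)
    show "cmp C (\<phi> (idx (Suc k))) (sar A (idx k)) = cmp C (sar B (idx k)) (\<phi> (idx k))"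
      by (rule homs_eqI[OF cmp_hom[OF sar_hom[OF A(1)] \<phi>] cmp_hom[OF \<phi> sar_hom[OF B(1)]]])
        (use g(3)[of k] in \<open>simp add: rep_cmp[OF sar_hom[OF A(1)] \<phi>] rep_cmp[OF \<phi> sar_hom[OF B(1)]] r\<phi> ars_def\<close>)
  qed
  moreover have "mapping_cone C Idf n A B \<phi> D \<in> angles"
    if "\<forall>i\<in>{1..n}. is_biproduct C (xob Idf n A (i + 1)) (sob B i) (D i)" for D
  proof -
    let ?M = "mapping_cone C Idf n A B \<phi> D"
    have D: "is_biproduct C (obs A (Suc k)) (obs B k) (D (idx k))" for k
      using that unfolding idx_all ext_Suc by (simp add: obs_def)
    have o: "obs ?M k = bobj (D (idx k))" for k by (simp add: obs_def mapping_cone_def)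
    have sar: "sar ?M (idx k) = bimat C (D (idx k)) (D (idx (Suc k))) (hneg C (sar A (idx (Suc k))))
        (hzero C (obs B k) (obs A (Suc (Suc k)))) (\<phi> (idx (Suc k))) (sar B (idx k))" for k
      unfolding mapping_cone_def nseq.simps ext_Suc obs_def ..
    note bm = bimat[OF D D hneg_hom[OF sar_hom[OF A(1)]] hzero_hom[OF sob_obj[OF B(1)] sob_obj[OF A(1)]] \<phi> sar_hom[OF B(1)]]
    have "is_nseq C Idf n ?M"
      unfolding is_nseq_iff o sar using bm(1) D by (auto simp: is_biproduct_def)
    moreover have "ars ?M = ps.cone (ars A) (ars B) g (\<lambda>k. rp (in1 (D (idx k)))) (\<lambda>k. rp (in2 (D (idx k))))
      (\<lambda>k. rp (pr1 (D (idx k)))) (\<lambda>k. rp (pr2 (D (idx k))))"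
      unfolding fun_eq_iff ars_def sar bm(2) ps.cone_def r\<phi>
      by (simp add: rep_hneg[OF sar_hom[OF A(1)]] rep_hzero[OF sob_obj[OF B(1)] sob_obj[OF A(1)]])
    moreover have "ps.angle (obs ?M) (ps.cone (ars A) (ars B) g (\<lambda>k. rp (in1 (D (idx k)))) (\<lambda>k. rp (in2 (D (idx k))))
      (\<lambda>k. rp (pr1 (D (idx k)))) (\<lambda>k. rp (pr2 (D (idx k)))))"
      using bip_rep[OF D] by (intro cone[rule_format]) (simp add: o idx_add)
    ultimately show ?thesis by (simp add: angles_def)
  qed
  ultimately show ?thesis by (intro exI[of _ \<phi>]) simp
qed

lemma contractible_iff:
  assumes K: "is_nseq C Idf n K"
  shows "is_contractible C Idf n K \<longleftrightarrow> (\<exists>\<Theta>. \<forall>k. \<Theta> (idx k) \<in> homs C (obs K (Suc k)) (obs K k) \<and>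
    ide C (obs K (Suc k)) = hadd C (cmp C (\<Theta> (idx (Suc k))) (sar K (idx (Suc k)))) (cmp C (sar K (idx k)) (\<Theta> (idx k))))"
proof -
  have "(\<forall>i\<in>{2..n}. ide C (sob K i) = hadd C (cmp C (\<Theta> i) (sar K i)) (cmp C (sar K (i - 1)) (\<Theta> (i - 1)))) \<and>
      ide C (sob K 1) = hadd C (cmp C (\<Theta> 1) (sar K 1)) (cmp C (sar K n) (\<Theta> n)) \<longleftrightarrow>
    (\<forall>k. ide C (obs K (Suc k)) = hadd C (cmp C (\<Theta> (idx (Suc k))) (sar K (idx (Suc k)))) (cmp C (sar K (idx k)) (\<Theta> (idx k))))"
    (is "?L \<and> ?M \<longleftrightarrow> (\<forall>k. ?R k)") for \<Theta>
  proof (intro iffI conjI allI)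
    fix k assume LM: "?L \<and> ?M"
    show "?R k"
    proof (cases "idx k = n")
      case True
      then have "idx (Suc k) = 1" using idx_Suc_idx[of k] idx_Suc_idx[of 0] idx_numeral by simp
      then show ?thesis using LM True by (simp add: obs_def)
    next
      case False
      then have S: "idx (Suc k) = Suc (idx k)" using idx_range[of k] by (subst idx_Suc_idx[symmetric], subst idx_id) auto
      have "Suc (idx k) \<in> {2..n}" using False idx_range[of k] by auto
      with LM have "ide C (sob K (Suc (idx k))) = hadd C (cmp C (\<Theta> (Suc (idx k))) (sar K (Suc (idx k)))) (cmp C (sar K (Suc (idx k) - 1)) (\<Theta> (Suc (idx k) - 1)))"
        by blast
      then show ?thesis by (simp add: obs_def S)
    qed
  next
    assume R: "\<forall>k. ?R k"
    show ?L
    proof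
      fix i assume i: "i \<in> {2..n}"
      then have "i - 1 \<in> {1..n}" by auto
      with i have "idx (Suc (i - 1)) = i" "idx (i - 1) = i - 1" using idx_id[of i] idx_id[of "i - 1"] by auto
      then show "ide C (sob K i) = hadd C (cmp C (\<Theta> i) (sar K i)) (cmp C (sar K (i - 1)) (\<Theta> (i - 1)))"
        using R[rule_format, of "i - 1"] unfolding obs_def by simp
    qed
    show ?M using R[rule_format, of 0] unfolding obs_def idx_numeral .
  qed
  then show ?thesis
    unfolding is_contractible_def idx_all ext_Suc Id_simps using K by (simp add: obs_def all_conj_distrib)
qed

lemma contractible_rep:
  assumes K: "is_nseq C Idf n K" and \<Theta>: "\<And>k. \<Theta> (idx k) \<in> homs C (obs K (Suc k)) (obs K k)"
  shows "ide C (obs K (Suc k)) = hadd C (cmp C (\<Theta> (idx (Suc k))) (sar K (idx (Suc k)))) (cmp C (sar K (idx k)) (\<Theta> (idx k)))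
    \<longleftrightarrow> rp (ide C (obs K (Suc k))) = rp (\<Theta> (idx (Suc k))) * ars K (Suc k) + ars K k * rp (\<Theta> (idx k))"
proof -
  note h = sar_hom[OF K]
  note c = cmp_hom[OF h \<Theta>, of "Suc k"] cmp_hom[OF \<Theta> h, of k]
  have "rp (hadd C (cmp C (\<Theta> (idx (Suc k))) (sar K (idx (Suc k)))) (cmp C (sar K (idx k)) (\<Theta> (idx k))))
    = rp (\<Theta> (idx (Suc k))) * ars K (Suc k) + ars K k * rp (\<Theta> (idx k))"
    by (simp add: rep_hadd[OF c] rep_cmp[OF h \<Theta>] rep_cmp[OF \<Theta> h] ars_def)
  then show ?thesis using homs_eqI[OF ide_hom[OF sob_obj[OF K]] hadd_hom[OF c]] by metis
qed

text \<open>The homotopy writes every cycle modulo \<open>p\<close> as a boundary modulo \<open>p\<close>;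
  the monodromy acts on zero groups.\<close>

lemma contractible_angles:
  assumes "is_candidate C Idf n K" "is_contractible C Idf n K"
  shows "K \<in> angles"
proof -
  have K: "is_nseq C Idf n K" "ps.complex (obs K) (ars K)" using assms candidate_iff by auto
  obtain \<Theta> where \<Theta>': "\<forall>k. \<Theta> (idx k) \<in> homs C (obs K (Suc k)) (obs K k) \<and>
    ide C (obs K (Suc k)) = hadd C (cmp C (\<Theta> (idx (Suc k))) (sar K (idx (Suc k)))) (cmp C (sar K (idx k)) (\<Theta> (idx k)))"
    using assms(2) unfolding contractible_iff[OF K(1)] by (elim exE)
  then have \<Theta>: "\<Theta> (idx k) \<in> homs C (obs K (Suc k)) (obs K k)" for k by blast
  have "ps.angle (obs K) (ars K)"
    using \<Theta>' contractible_rep[OF K(1) \<Theta>]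
    by (intro ps.contractible_angle[OF K(2), of "\<lambda>k. rp (\<Theta> (idx k))"]) (simp_all add: RH[OF \<Theta>])
  then show ?thesis using K by (simp add: angles_def)
qed

definition central_nseq :: "'o \<Rightarrow> ('o, 'a) nseq" where
  "central_nseq F = \<lparr>sob = (\<lambda>_. F), sar = (\<lambda>_. z F)\<rparr>"

lemma central_nseq:
  assumes F: "F \<in> obj C"
  shows "is_nseq C Idf n (central_nseq F)" "obs (central_nseq F) = (\<lambda>_. F)"
    "ars (central_nseq F) = (\<lambda>_. central * rp (ide C F))"
proof -
  have z: "z F \<in> homs C F F" using csz F by (auto simp: central_square_zero_def)
  show o: "obs (central_nseq F) = (\<lambda>_. F)" by (simp add: fun_eq_iff obs_def central_nseq_def)
  show "is_nseq C Idf n (central_nseq F)" unfolding is_nseq_iff o using F z by (simp add: central_nseq_def)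
  show "ars (central_nseq F) = (\<lambda>_. central * rp (ide C F))"
    using rep_central[OF ide_hom[OF F]] ide_right[OF z] by (simp add: fun_eq_iff ars_def central_nseq_def)
qed

lemma angles_decomposition:
  assumes "A \<in> angles"
  shows "\<exists>K F. is_candidate C Idf n K \<and> is_contractible C Idf n K \<and> F \<in> obj C \<and>
    is_direct_sum C Idf n A K (central_nseq F)"
proof -
  have A: "is_nseq C Idf n A" "ps.angle (obs A) (ars A)" using assms by (auto simp: angles_def)
  obtain F Ko \<kappa> L u i r q where F: "F \<in> obj C" and cx: "ps.complex Ko \<kappa>" and all: "\<forall>k.
    ps.bip (obs A k) (Ko k) F (u k) (i k) (r k) (q k) \<and>
    u (k + n) = u k \<and> i (k + n) = i k \<and> r (k + n) = r k \<and> q (k + n) = q k \<and> L (k + n) = L k \<and>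
    L k \<in> RH (Ko (Suc k)) (Ko k) \<and> rp (ide C (Ko (Suc k))) = L (Suc k) * \<kappa> (Suc k) + \<kappa> k * L k \<and>
    ars A k = u (Suc k) * (\<kappa> k * r k) + i (Suc k) * (central * rp (ide C F) * q k)"
    using ps.angle_decomposition[OF A(2)] by (elim exE conjE)
  have bip: "ps.bip (obs A k) (Ko k) F (u k) (i k) (r k) (q k)"
    and per: "u (k + n) = u k" "i (k + n) = i k" "r (k + n) = r k" "q (k + n) = q k" "L (k + n) = L k"
    and L: "L k \<in> RH (Ko (Suc k)) (Ko k)"
    and h: "rp (ide C (Ko (Suc k))) = L (Suc k) * \<kappa> (Suc k) + \<kappa> k * L k"
    and a: "ars A k = u (Suc k) * (\<kappa> k * r k) + i (Suc k) * (central * rp (ide C F) * q k)" for k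
    using all by blast+
  obtain K where K: "is_nseq C Idf n K" "obs K = Ko" "ars K = \<kappa>"
    using realize[OF ps.complexD(1)[OF cx]] by (elim exE conjE)
  have peri: "f (idx k) = f k" if "\<And>k. f (k + n) = f k" for f :: "nat \<Rightarrow> ('o, 'a) yoneda_end" and k
    using ps.periodic_cong[of f, OF that idx_mod] .
  have oi: "Ko (idx k) = Ko k" "Ko (Suc (idx k)) = Ko (Suc k)" "obs A (idx k) = obs A k" for k
    unfolding K(2)[symmetric] obs_def by (simp_all add: idx_id[OF idx_range] idx_Suc_idx)
  have "is_candidate C Idf n K" using K cx candidate_iff by simp
  moreover have "is_contractible C Idf n K"
  proof -
    define \<Theta> where "\<Theta> k = lift (Ko (Suc k)) (Ko k) (L k)" for k
    have \<Theta>: "\<Theta> (idx k) \<in> homs C (obs K (Suc k)) (obs K k)" "rp (\<Theta> (idx k)) = L k" for k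
      using lift[OF L[of "idx k"]] peri[of L, OF per(5)] unfolding \<Theta>_def K(2) oi by simp_all
    show ?thesis
      unfolding contractible_iff[OF K(1)]
    proof (intro exI[of _ \<Theta>] allI conjI \<Theta>(1))
      fix k
      show "ide C (obs K (Suc k)) = hadd C (cmp C (\<Theta> (idx (Suc k))) (sar K (idx (Suc k)))) (cmp C (sar K (idx k)) (\<Theta> (idx k)))"
        unfolding contractible_rep[OF K(1) \<Theta>(1)] unfolding \<Theta>(2) K(2,3) by (rule h)
    qed
  qed
  moreover have "is_direct_sum C Idf n A K (central_nseq F)"
  proof -
    define D where "D k = \<lparr>bobj = obs A k, in1 = lift (Ko k) (obs A k) (u k), in2 = lift F (obs A k) (i k),
      pr1 = lift (obs A k) (Ko k) (r k), pr2 = lift (obs A k) F (q k)\<rparr>" for k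
    note b = ps.bipD[OF bip]
    have D: "is_biproduct C (Ko k) F (D (idx k))" "bobj (D (idx k)) = obs A k" for k
      using bip_lift[OF bip[of "idx k"]] unfolding D_def oi by simp_all
    have rD: "rp (in1 (D (idx k))) = u k" "rp (in2 (D (idx k))) = i k" "rp (pr1 (D (idx k))) = r k" "rp (pr2 (D (idx k))) = q k" for k
      using lift(2)[OF b(1)[of "idx k"]] lift(2)[OF b(2)[of "idx k"]] lift(2)[OF b(3)[of "idx k"]] lift(2)[OF b(4)[of "idx k"]]
        peri[of u, OF per(1)] peri[of i, OF per(2)] peri[of r, OF per(3)] peri[of q, OF per(4)]
      unfolding D_def by simp_all
    have z: "z F \<in> homs C F F" "rp (z F) = central * rp (ide C F)"
      using sar_hom[OF central_nseq(1)[OF F]] central_nseq(2,3)[OF F]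
      by (simp_all add: central_nseq_def ars_def fun_eq_iff)
    have Ko: "Ko k \<in> obj C" for k using sob_obj[OF K(1)] K(2) by simp
    have kh: "sar K (idx k) \<in> homs C (Ko k) (Ko (Suc k))" "rp (sar K (idx k)) = \<kappa> k" for k
      using sar_hom[OF K(1), of k] K(2,3) by (auto simp: ars_def)
    note bm = bimat[OF D(1) D(1) kh(1) hzero_hom[OF F Ko] hzero_hom[OF Ko F] z(1)]
    have sar: "sar A (idx k) = bimat C (D (idx k)) (D (idx (Suc k))) (sar K (idx k)) (hzero C F (Ko (Suc k)))
          (hzero C (Ko k) F) (z F)" for k
    proof (rule homs_eqI[OF sar_hom[OF A(1)]])
      show "bimat C (D (idx k)) (D (idx (Suc k))) (sar K (idx k)) (hzero C F (Ko (Suc k))) (hzero C (Ko k) F) (z F)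
        \<in> homs C (obs A k) (obs A (Suc k))" using bm(1)[of k] unfolding D(2) .
      show "rp (sar A (idx k)) = rp (bimat C (D (idx k)) (D (idx (Suc k))) (sar K (idx k)) (hzero C F (Ko (Suc k)))
          (hzero C (Ko k) F) (z F))"
        unfolding bm(2) rD kh(2) z(2) rep_hzero[OF F Ko] rep_hzero[OF Ko F] using a[of k] by (simp add: ars_def mult.assoc)
    qed
    show ?thesis
      unfolding is_direct_sum_def idx_all ext_Suc
      using D sar K(2) by (intro exI[of _ D]) (simp add: central_nseq_def obs_def fun_eq_iff)
  qed
  ultimately show ?thesis using F by blast
qed

lemma isomorphic_refl:
  assumes A: "is_nseq C Idf n A"
  shows "isomorphic_nseqs C Idf n A A"
proof -
  have e: "ide C (obs A k) \<in> homs C (obs A k) (obs A k)" for k using ide_hom sob_obj[OF A] .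
  have "is_iso C (ide C (obs A k))" for k
    using e[of k] ide_left[OF e] unfolding is_iso_def homs_def by auto
  moreover have "cmp C (ide C (obs A (Suc k))) (sar A (idx k)) = cmp C (sar A (idx k)) (ide C (obs A k))" for k
    using ide_left[OF sar_hom[OF A]] ide_right[OF sar_hom[OF A]] by simp
  ultimately show ?thesis
    unfolding isomorphic_nseqs_def is_nseq_morphism_def idx_all ext_Suc using e
    by (intro exI[of _ "\<lambda>i. ide C (sob A i)"]) (simp add: obs_def)
qed

text \<open>Angles are closed under sums and isomorphisms and contain both kinds of building blocks; the
  converse is \<open>angle_decomposition\<close>, with \<open>A\<close> itself as the direct
  sum.\<close>

theorem angles_eq:
  "angles = {A. is_nseq C Idf n A \<and> (\<exists>S K F. is_candidate C Idf n K \<and> is_contractible C Idf n K \<and>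
     F \<in> obj C \<and> is_direct_sum C Idf n S K (central_nseq F) \<and> isomorphic_nseqs C Idf n A S)}"
proof (intro equalityI subsetI CollectI conjI)
  fix A assume A: "A \<in> angles"
  then show N: "is_nseq C Idf n A" by (simp add: angles_def)
  show "\<exists>S K F. is_candidate C Idf n K \<and> is_contractible C Idf n K \<and>
     F \<in> obj C \<and> is_direct_sum C Idf n S K (central_nseq F) \<and> isomorphic_nseqs C Idf n A S"
    using angles_decomposition[OF A] isomorphic_refl[OF N] by (elim exE conjE) (intro exI conjI)
next
  fix A assume "A \<in> {A. is_nseq C Idf n A \<and> (\<exists>S K F. is_candidate C Idf n K \<and> is_contractible C Idf n K \<and>
     F \<in> obj C \<and> is_direct_sum C Idf n S K (central_nseq F) \<and> isomorphic_nseqs C Idf n A S)}"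
  then obtain S K F where A: "is_nseq C Idf n A" and K: "is_candidate C Idf n K" "is_contractible C Idf n K"
    and F: "F \<in> obj C" and S: "is_direct_sum C Idf n S K (central_nseq F)" and iso: "isomorphic_nseqs C Idf n A S"
    by (elim CollectE exE conjE)
  have "central_nseq F \<in> angles"
    using central_nseq[OF F] ps.multiplication_angle[OF F] by (simp add: angles_def)
  then have "S \<in> angles" using direct_sum_angles contractible_angles[OF K] S by blast
  then show "A \<in> angles" using isomorphic_angle_iff[OF A _ iso] A by (auto simp: angles_def)
qed

theorem n_angulated: "n_angulated_category C Idf n angles"
proof -
  interpret additive_category C by (rule additive)
  have aut: "category_automorphism C Idf"
    by (unfold_locales) (auto simp: bij_betw_def inj_on_def)
  show ?thesis
  proof (intro n_angulated_category.intro n_angulated_category_axioms.intro additive aut n3)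
    show "is_nseq C Idf n A" if "A \<in> angles" for A using that by (simp add: angles_def)
    show "B \<in> angles" if "A \<in> angles" "is_nseq C Idf n B" "isomorphic_nseqs C Idf n A B" for A B
      using that isomorphic_angle_iff by (auto simp: angles_def)
    show "\<exists>\<phi>. \<phi> 1 = f1 \<and> \<phi> 2 = f2 \<and> is_nseq_morphism C Idf n A B \<phi>"
      if "A \<in> angles" "B \<in> angles" "f1 \<in> homs C (sob A 1) (sob B 1)" "f2 \<in> homs C (sob A 2) (sob B 2)"
        "cmp C f2 (sar A 1) = cmp C (sar B 1) f1" for A B f1 f2
      using extension_angles[OF that] by (elim exE conjE) (intro exI conjI)
  qed (fact direct_sum_angles summand_angles trivial_angles first_angles rotation_angles extension_angles)+
qed

end

section \<open>The theorem for free modules\<close>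

text \<open>For odd \<open>n\<close>, the condition $2p = 0$ makes twice the action of \<open>p\<close>
  vanish on all modules.\<close>

lemma (in square_zero_ring) n_angulated_modules:
  fixes n :: nat
  assumes n: "n \<ge> 3" and par: "even n \<or> p \<oplus> p = \<zero>"
  shows "n_angulated_category (fg_free_modules R :: (('r, 'u) module, ('r, 'u) module_arrow) addcat)
    identity_functor n (N_collection R p n)"
proof -
  obtain I :: "('r, 'u) module" and b where I: "is_fg_free R I" "indexed_basis R I (Suc 0) b"
    using ex_free_of_rank[of "Suc 0"] by (elim exE conjE)
  interpret cc: central_category modR "mult_arrow p"
    by (intro central_category.intro preadditive_fg_free_modules central_category_axioms.intro
        mult_arrow_central_square_zero p)
  have "central * x + central * x = 0" if "odd n" and x: "x \<in> cc.RH A B" for x A B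
  proof -
    obtain f where f: "f \<in> homs modR A B" "x = rp f" using x by (elim imageE) simp
    have A: "A \<in> obj modR" "B \<in> obj modR" using cc.homs_obj[OF f(1)] by auto
    then have fgB: "is_fg_free R B" by simp
    interpret B: module R B by (rule fg_free_module[OF fgB])
    note h = cc.cmp_hom[OF f(1) mult_arrow_hom[OF fgB p(1)]]
    have "p \<odot>\<^bsub>B\<^esub> y \<oplus>\<^bsub>B\<^esub> p \<odot>\<^bsub>B\<^esub> y = \<zero>\<^bsub>B\<^esub>" if "y \<in> carrier B" for y
      using that p(1) par \<open>odd n\<close> B.smult_l_distr[OF p(1) p(1) that] by simp
    then have "hadd modR (cmp modR (mult_arrow p B) f) (cmp modR (mult_arrow p B) f) = hzero modR A B"
      using f(1) by (auto simp: mod_homs_iff mult_arrow_def compose_def fun_eq_iff restrict_def module_homsD(1))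
    then show ?thesis
      using cc.rep_hadd[OF h h] cc.rep_central[OF f(1)] cc.rep_hzero[OF A] f(2) by simp
  qed
  then have "even n \<or> (\<forall>A B. \<forall>x\<in>cc.RH A B. central * x + central * x = 0)" by blast
  then interpret fc: free_category modR "mult_arrow p" I n
    by (intro free_category.intro cc.central_category_axioms free_category_axioms.intro
        free_ring_category_modules[OF I] n)
  have "fc.central_nseq = mult_nseq p"
    by (simp add: fun_eq_iff fc.central_nseq_def mult_nseq_def mult_arrow_def)
  then have "N_collection R p n = fc.angles"
    unfolding N_collection_def fc.angles_eq by simp
  then show ?thesis using fc.n_angulated by simp
qed

text \<open>If \<open>r\<close> lies outside the maximal ideal, then $(p) + (r)$ is the whole ring, so $1
  = ap + br$. Since $ap$ squares to zero, $br = 1 - ap$ is a unit, and so is \<open>r\<close>.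
  In particular no such \<open>r\<close> can annihilate $p \neq 0$.\<close>

lemma square_zero_local_ring:
  fixes R :: "('r, 'x) ring_scheme" (structure) and enc :: "'r list \<Rightarrow> 'u"
  assumes R: "cring R" and p: "p \<in> carrier R" and max: "maximalideal (PIdl p) R"
    and nz: "PIdl p \<noteq> {\<zero>}" and sq: "(PIdl p) \<cdot> (PIdl p) = {\<zero>}" and enc: "inj_on enc (lists (carrier R))"
  shows "square_zero_ring R p enc"
proof -
  interpret cring R by (rule R)
  have pI: "p \<in> PIdl p" using cgenideal_self[OF p] .
  have "p \<otimes> p \<in> (PIdl p) \<cdot> (PIdl p)" by (rule ideal_prod.prod[OF pI pI])
  then have pp: "p \<otimes> p = \<zero>" using sq by simp
  have p0: "p \<noteq> \<zero>"
  proof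
    assume "p = \<zero>"
    then have "PIdl p = {\<zero>}" by (auto simp: cgenideal_def intro!: exI[of _ \<zero>])
    then show False using nz by simp
  qed
  have du: "(\<exists>s\<in>carrier R. r = p \<otimes> s) \<or> (\<exists>s\<in>carrier R. r \<otimes> s = \<one>)" if r: "r \<in> carrier R" for r
  proof (cases "r \<in> PIdl p")
    case True
    then show ?thesis using p m_comm by (auto simp: cgenideal_def)
  next
    case False
    have J: "ideal (PIdl p <+> PIdl r) R" by (intro add_ideals cgenideal_ideal p r)
    have sub: "PIdl p \<subseteq> PIdl p <+> PIdl r" "PIdl r \<subseteq> PIdl p <+> PIdl r"
    proof -
      have z: "\<zero> \<in> PIdl p" "\<zero> \<in> PIdl r" using p r by (auto simp: cgenideal_def intro: exI[of _ \<zero>])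
      have c: "PIdl p \<subseteq> carrier R" "PIdl r \<subseteq> carrier R" using p r by (auto simp: cgenideal_def)
      show "PIdl p \<subseteq> PIdl p <+> PIdl r" "PIdl r \<subseteq> PIdl p <+> PIdl r"
        using z c by (auto simp: set_add_def' intro: bexI[of _ \<zero>] dest: subsetD) force+
    qed
    have "PIdl p <+> PIdl r = carrier R"
      using maximalideal.I_maximal[OF max J sub(1)] ideal.Icarr[OF J] sub(2) cgenideal_self[OF r] False by blast
    then have "\<one> \<in> PIdl p <+> PIdl r" by simp
    then obtain a b where ab: "a \<in> carrier R" "b \<in> carrier R" "\<one> = a \<otimes> p \<oplus> b \<otimes> r"
      by (auto simp: set_add_def' cgenideal_def)
    \<comment> \<open>As \<open>a \<otimes> p\<close> squares to zero, \<open>\<one> \<oplus> a \<otimes> p\<close> inverts \<open>b \<otimes> r = \<one> \<ominus> a \<otimes> p\<close>.\<close>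
    have br: "b \<otimes> r = \<one> \<ominus> a \<otimes> p" using ab p r by algebra
    have "r \<otimes> (b \<otimes> (\<one> \<oplus> a \<otimes> p)) = (b \<otimes> r) \<otimes> (\<one> \<oplus> a \<otimes> p)" using ab(1,2) p r by algebra
    also have "\<dots> = \<one> \<ominus> a \<otimes> a \<otimes> (p \<otimes> p)" unfolding br using ab(1,2) p by algebra
    also have "\<dots> = \<one>" unfolding pp using ab(1) by algebra
    finally show ?thesis using ab(1,2) p by (intro disjI2 bexI[of _ "b \<otimes> (\<one> \<oplus> a \<otimes> p)"]) auto
  qed
  show ?thesis
  proof
    show "\<one> \<noteq> \<zero>" using p0 p by (metis l_one l_null)
    show "\<exists>s\<in>carrier R. r = p \<otimes> s" if r: "r \<in> carrier R" "p \<otimes> r = \<zero>" for r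
    proof -
      have False if s: "s \<in> carrier R" "r \<otimes> s = \<one>" for s
      proof -
        have "p \<otimes> r \<otimes> s = p \<otimes> (r \<otimes> s)" by (rule m_assoc[OF p r(1) s(1)])
        then show False using r(2) s p p0 by simp
      qed
      then show ?thesis using du[OF r(1)] by blast
    qed
  qed (use R p pp du enc in auto)
qed

theorem theorem3p6:
  fixes R :: "('r, 'x) ring_scheme" (structure)
    and p :: 'r and n :: nat and enc :: "'r list \<Rightarrow> 'u"
  assumes "local_ring R"
    and "p \<in> carrier R"
    and "maximalideal (PIdl p) R"
    and "PIdl p \<noteq> {\<zero>}"
    and "(PIdl p) \<cdot> (PIdl p) = {\<zero>}"
    and "n \<ge> 3"
    and "even n \<or> (odd n \<and> p \<oplus> p = \<zero>)"
    and universe_large_enough: "inj_on enc (lists (carrier R))"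
  shows "n_angulated_category
    (fg_free_modules R :: (('r, 'u) module, ('r, 'u) module_arrow) addcat)
    identity_functor n (N_collection R p n)"
proof -
  interpret square_zero_ring R p enc
    using assms by (intro square_zero_local_ring) (auto simp: local_ring_def)
  show ?thesis using assms by (intro n_angulated_modules) auto
qed

end
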